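(* Let $\Gamma$ be a finitely generated torsion-free nonelementary Kleinian group. Then $\Gamma$ is sharply MIF.
   Context: A Kleinian group is a discrete subgroup of $\mathrm{PSL}_2(\mathbb{C})$; it is nonelementary if it is not virtually abelian. For a group $\Gamma$, let $\Gamma\ast\mathbb{Z}$ be the free product of $\Gamma$ with an infinite cyclic group $\mathbb{Z}=\langle x\rangle$. For $w\in\Gamma\ast\mathbb{Z}$ and $g\in\Gamma$, let $w(g)\in\Gamma$ be the image of $w$ under the unique homomorphism $\Gamma\ast\mathbb{Z}\to\Gamma$ that is the identity on $\Gamma$ and sends $x$ to $g$. Given a finite generating set $S$ of $\Gamma$, $|\cdot|_S$ denotes word-length on $\Gamma$ with respect to $S$ and $|\cdot|_{S\cup\{x\}}$ denotes word-length on $\Gamma\ast\mathbb{Z}$ with respect to $S\cup\{x\}$. The complexity of $w$ is $\chi_\Gamma^S(w)=\min\{|g|_S : g\in\Gamma,\ w(g)\neq e_\Gamma\}$, with value $+\infty$ if there is no such $g$. The MIF growth function is $$\mathcal{M}_\Gamma^S(n)=\max\{\chi_\Gamma^S(w) : w\in\Gamma\ast\mathbb{Z},\ w\neq e,\ |w|_{S\cup\{x\}}\leq n\}.$$ A finitely generated group $\Gamma$ is sharply MIF if for some (equivalently, every) finite generating set $S$ there is a constant $C>0$ (depending on $S$) such that $\mathcal{M}_\Gamma^S(n)\leq C\log(n)$ for all $n\geq 2$. *)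

theory Defs
  imports "HOL-Analysis.Analysis" "HOL-Algebra.Generated_Groups" "HOL-Algebra.Elementary_Groups"
begin

section \<open>Kleinian groups\<close>

definition SL2C :: "(complex^2^2) monoid" where
  "SL2C = \<lparr>carrier = {A. det A = 1}, mult = (**), one = mat 1\<rparr>"

definition PSL2C :: "(complex^2^2) set monoid" where
  "PSL2C = SL2C Mod {mat 1, - mat 1}"

text \<open>The quotient topology of the subspace topology on \<open>SL\<^sub>2(\<complex>) \<subseteq> \<complex>\<^sup>2\<^sup>\<times>\<^sup>2\<close>.\<close>

definition PSL2C_topology :: "(complex^2^2) set topology" where
  "PSL2C_topology = topology (\<lambda>U. U \<subseteq> carrier PSL2C \<and>
     openin (top_of_set (carrier SL2C))
       {A \<in> carrier SL2C. {mat 1, - mat 1} #>\<^bsub>SL2C\<^esub> A \<in> U})"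

definition Kleinian_group :: "(complex^2^2) set set \<Rightarrow> bool" where
  "Kleinian_group \<Gamma> \<longleftrightarrow> subgroup \<Gamma> PSL2C \<and>
     subtopology PSL2C_topology \<Gamma> = discrete_topology \<Gamma>"

definition virtually_abelian :: "('a, 'b) monoid_scheme \<Rightarrow> bool" where
  "virtually_abelian G \<longleftrightarrow>
     (\<exists>H. subgroup H G \<and> finite (rcosets\<^bsub>G\<^esub> H) \<and> comm_group (G\<lparr>carrier := H\<rparr>))"

definition nonelementary :: "(complex^2^2) set set \<Rightarrow> bool" where
  "nonelementary \<Gamma> \<longleftrightarrow> \<not> virtually_abelian (PSL2C\<lparr>carrier := \<Gamma>\<rparr>)"

definition torsion_free :: "('a, 'b) monoid_scheme \<Rightarrow> bool" where
  "torsion_free G \<longleftrightarrow>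
     (\<forall>g \<in> carrier G. \<forall>n::nat. n > 0 \<longrightarrow> g [^]\<^bsub>G\<^esub> n = \<one>\<^bsub>G\<^esub> \<longrightarrow> g = \<one>\<^bsub>G\<^esub>)"

definition finite_generating_set :: "('a, 'b) monoid_scheme \<Rightarrow> 'a set \<Rightarrow> bool" where
  "finite_generating_set G S \<longleftrightarrow> finite S \<and> S \<subseteq> carrier G \<and> generate G S = carrier G"

definition finitely_generated :: "('a, 'b) monoid_scheme \<Rightarrow> bool" where
  "finitely_generated G \<longleftrightarrow> (\<exists>S. finite_generating_set G S)"

lemma matrix_neg_mult:
  fixes A B :: "complex^2^2"
  shows "(- A) ** B = - (A ** B)" "A ** (- B) = - (A ** B)"
  by (simp_all add: matrix_matrix_mult_def vec_eq_iff sum_negf)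

lemma det_neg_2: "det (- A) = det (A :: complex^2^2)"
  by (simp add: det_2)

lemma group_SL2C: "group SL2C"
proof (rule groupI)
  fix A assume A: "A \<in> carrier SL2C"
  then have "det A = 1" by (simp add: SL2C_def)
  then have "invertible A" by (simp add: invertible_det_nz)
  then obtain B where B: "B ** A = mat 1" unfolding invertible_def by blast
  moreover have "det B * det A = 1" using B by (metis det_I det_mul)
  ultimately show "\<exists>B\<in>carrier SL2C. B \<otimes>\<^bsub>SL2C\<^esub> A = \<one>\<^bsub>SL2C\<^esub>"
    using A by (auto simp: SL2C_def)
qed (auto simp: SL2C_def det_mul matrix_mul_assoc)

lemma normal_SL2C_center: "{mat 1, - mat 1} \<lhd> SL2C"
proof -
  interpret group SL2C by (rule group_SL2C)
  have sub: "subgroup {mat 1, - mat 1} SL2C"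
  proof (rule subgroupI)
    fix a assume "a \<in> {mat 1, - mat 1 :: complex^2^2}"
    then have "a \<otimes>\<^bsub>SL2C\<^esub> a = \<one>\<^bsub>SL2C\<^esub>" "a \<in> carrier SL2C"
      by (auto simp: SL2C_def matrix_neg_mult det_neg_2)
    then have "inv\<^bsub>SL2C\<^esub> a = a" using inv_equality by blast
    then show "inv\<^bsub>SL2C\<^esub> a \<in> {mat 1, - mat 1}"
      using \<open>a \<in> {mat 1, - mat 1}\<close> by simp
  qed (auto simp: SL2C_def matrix_neg_mult det_neg_2)
  show ?thesis
    by (rule normalI[OF sub]) (auto simp: r_coset_def l_coset_def SL2C_def matrix_neg_mult)
qed

lemma group_PSL2C: "group PSL2C"
  unfolding PSL2C_def by (rule normal.factorgroup_is_group[OF normal_SL2C_center])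

lemma carrier_PSL2C:
  "carrier PSL2C = (\<lambda>A. {mat 1, - mat 1} #>\<^bsub>SL2C\<^esub> A) ` carrier SL2C"
  by (auto simp: PSL2C_def FactGroup_def RCOSETS_def)

lemma openin_PSL2C_topology:
  "openin PSL2C_topology U \<longleftrightarrow> U \<subseteq> carrier PSL2C \<and>
     openin (top_of_set (carrier SL2C))
       {A \<in> carrier SL2C. {mat 1, - mat 1} #>\<^bsub>SL2C\<^esub> A \<in> U}"
proof -
  let ?f = "\<lambda>A. {mat 1, - mat 1} #>\<^bsub>SL2C\<^esub> A"
  let ?P = "\<lambda>U. {A \<in> carrier SL2C. ?f A \<in> U}"
  have 1: "?P (U \<inter> V) = ?P U \<inter> ?P V" for U V by auto
  have 2: "?P (\<Union>K) = \<Union>(?P ` K)" for K by auto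
  have "istopology (\<lambda>U. U \<subseteq> carrier PSL2C \<and> openin (top_of_set (carrier SL2C)) (?P U))"
    unfolding istopology_def 1 2 by auto
  then show ?thesis unfolding PSL2C_topology_def by (simp add: topology_inverse')
qed

lemma quotient_map_PSL2C_topology:
  "quotient_map (top_of_set (carrier SL2C)) PSL2C_topology
     (\<lambda>A. {mat 1, - mat 1} #>\<^bsub>SL2C\<^esub> A)"
proof -
  have "{A \<in> carrier SL2C. {mat 1, - mat 1} #>\<^bsub>SL2C\<^esub> A \<in> carrier PSL2C} = carrier SL2C"
    by (auto simp: carrier_PSL2C)
  then have "openin PSL2C_topology (carrier PSL2C)"
    by (simp add: openin_PSL2C_topology)
  then have "topspace PSL2C_topology = carrier PSL2C"
    using openin_subset openin_topspace[of PSL2C_topology]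
    unfolding openin_PSL2C_topology[of "topspace PSL2C_topology"] by blast
  then show ?thesis
    by (auto simp: quotient_map_def openin_PSL2C_topology carrier_PSL2C)
qed


section \<open>Free products\<close>

text \<open>The free product is the set of words in \<open>G \<uplus> H\<close> modulo the equivalence relation
  generated by deleting a trivial letter and multiplying two adjacent letters of the
  same factor.\<close>

abbreviation fp_words :: "('a, 'm) monoid_scheme \<Rightarrow> ('b, 'n) monoid_scheme \<Rightarrow> ('a + 'b) list set"
  where "fp_words G H \<equiv> lists (carrier G <+> carrier H)"

inductive fp_eq ::
    "('a, 'm) monoid_scheme \<Rightarrow> ('b, 'n) monoid_scheme \<Rightarrow> ('a + 'b) list \<Rightarrow> ('a + 'b) list \<Rightarrow> bool"
  for G H where
  refl: "u \<in> fp_words G H \<Longrightarrow> fp_eq G H u u"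
| sym: "fp_eq G H u v \<Longrightarrow> fp_eq G H v u"
| trans: "fp_eq G H u v \<Longrightarrow> fp_eq G H v w \<Longrightarrow> fp_eq G H u w"
| one_l: "u \<in> fp_words G H \<Longrightarrow> v \<in> fp_words G H \<Longrightarrow>
    fp_eq G H (u @ [Inl \<one>\<^bsub>G\<^esub>] @ v) (u @ v)"
| one_r: "u \<in> fp_words G H \<Longrightarrow> v \<in> fp_words G H \<Longrightarrow>
    fp_eq G H (u @ [Inr \<one>\<^bsub>H\<^esub>] @ v) (u @ v)"
| mult_l: "u \<in> fp_words G H \<Longrightarrow> v \<in> fp_words G H \<Longrightarrow> a \<in> carrier G \<Longrightarrow> b \<in> carrier G \<Longrightarrow>
    fp_eq G H (u @ [Inl a, Inl b] @ v) (u @ [Inl (a \<otimes>\<^bsub>G\<^esub> b)] @ v)"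
| mult_r: "u \<in> fp_words G H \<Longrightarrow> v \<in> fp_words G H \<Longrightarrow> a \<in> carrier H \<Longrightarrow> b \<in> carrier H \<Longrightarrow>
    fp_eq G H (u @ [Inr a, Inr b] @ v) (u @ [Inr (a \<otimes>\<^bsub>H\<^esub> b)] @ v)"

definition fp_class ::
    "('a, 'm) monoid_scheme \<Rightarrow> ('b, 'n) monoid_scheme \<Rightarrow> ('a + 'b) list \<Rightarrow> ('a + 'b) list set"
  where "fp_class G H u = {v. fp_eq G H u v}"

definition free_product ::
    "('a, 'm) monoid_scheme \<Rightarrow> ('b, 'n) monoid_scheme \<Rightarrow> ('a + 'b) list set monoid" where
  "free_product G H = \<lparr>carrier = fp_class G H ` fp_words G H,
     mult = (\<lambda>X Y. \<Union>u\<in>X. \<Union>v\<in>Y. fp_class G H (u @ v)),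
     one = fp_class G H []\<rparr>"

definition fp_inl ::
    "('a, 'm) monoid_scheme \<Rightarrow> ('b, 'n) monoid_scheme \<Rightarrow> 'a \<Rightarrow> ('a + 'b) list set" where
  "fp_inl G H a = fp_class G H [Inl a]"

definition fp_inr ::
    "('a, 'm) monoid_scheme \<Rightarrow> ('b, 'n) monoid_scheme \<Rightarrow> 'b \<Rightarrow> ('a + 'b) list set" where
  "fp_inr G H b = fp_class G H [Inr b]"

definition fp_val :: "('c, 'k) monoid_scheme \<Rightarrow> ('a \<Rightarrow> 'c) \<Rightarrow> ('b \<Rightarrow> 'c) \<Rightarrow> ('a + 'b) list \<Rightarrow> 'c"
  where "fp_val K f g u = foldr (\<lambda>s r. case_sum f g s \<otimes>\<^bsub>K\<^esub> r) u \<one>\<^bsub>K\<^esub>"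

text \<open>The homomorphism out of the free product induced by \<open>f\<close> and \<open>g\<close>. On an element of the
  free product the set below is a singleton; see \<open>fp_lift_hom\<close> and \<open>fp_lift_unique\<close>.\<close>

definition fp_lift ::
    "('c, 'k) monoid_scheme \<Rightarrow> ('a \<Rightarrow> 'c) \<Rightarrow> ('b \<Rightarrow> 'c) \<Rightarrow> ('a + 'b) list set \<Rightarrow> 'c" where
  "fp_lift K f g X = the_elem (fp_val K f g ` X)"

lemma fp_eq_words:
  assumes "group G" "group H" "fp_eq G H u v"
  shows "u \<in> fp_words G H \<and> v \<in> fp_words G H"
proof -
  interpret G: group G by fact
  interpret H: group H by fact
  show ?thesis using assms(3) by induction auto
qed

lemma fp_eq_append:
  assumes "group G" "group H" "fp_eq G H u u'" "p \<in> fp_words G H" "q \<in> fp_words G H"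
  shows "fp_eq G H (p @ u @ q) (p @ u' @ q)"
  using assms(3)
proof induction
  case (refl u) then show ?case using assms(4,5) by (intro fp_eq.refl) auto
next
  case sym then show ?case by (blast intro: fp_eq.sym)
next
  case trans then show ?case by (blast intro: fp_eq.trans)
next
  case (one_l u v) then show ?case
    using fp_eq.one_l[of "p @ u" G H "v @ q"] assms(4,5) by auto
next
  case (one_r u v) then show ?case
    using fp_eq.one_r[of "p @ u" G H "v @ q"] assms(4,5) by auto
next
  case (mult_l u v a b) then show ?case
    using fp_eq.mult_l[of "p @ u" G H "v @ q" a b] assms(4,5) by auto
next
  case (mult_r u v a b) then show ?case
    using fp_eq.mult_r[of "p @ u" G H "v @ q" a b] assms(4,5) by auto
qed

lemma fp_eq_append2:
  assumes "group G" "group H" "fp_eq G H u u'" "fp_eq G H v v'"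
  shows "fp_eq G H (u @ v) (u' @ v')"
proof -
  note w = fp_eq_words[OF assms(1,2,3)] fp_eq_words[OF assms(1,2,4)]
  have "fp_eq G H (u @ v) (u' @ v)"
    using fp_eq_append[OF assms(1,2,3), of "[]" v] w by auto
  moreover have "fp_eq G H (u' @ v) (u' @ v')"
    using fp_eq_append[OF assms(1,2,4), of u' "[]"] w by auto
  ultimately show ?thesis by (rule fp_eq.trans)
qed

lemma fp_class_eqI: "fp_eq G H u v \<Longrightarrow> fp_class G H u = fp_class G H v"
  unfolding fp_class_def by (blast intro: fp_eq.trans fp_eq.sym)

lemma free_product_mult:
  assumes "group G" "group H" "u \<in> fp_words G H" "v \<in> fp_words G H"
  shows "fp_class G H u \<otimes>\<^bsub>free_product G H\<^esub> fp_class G H v = fp_class G H (u @ v)"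
proof -
  have "fp_class G H (u' @ v') = fp_class G H (u @ v)"
    if "u' \<in> fp_class G H u" "v' \<in> fp_class G H v" for u' v'
    using that fp_eq_append2[OF assms(1,2)] fp_class_eqI
    by (metis fp_class_def mem_Collect_eq)
  then have "(\<Union>u'\<in>fp_class G H u. \<Union>v'\<in>fp_class G H v. fp_class G H (u' @ v'))
      = (\<Union>u'\<in>fp_class G H u. \<Union>v'\<in>fp_class G H v. fp_class G H (u @ v))"
    by (intro SUP_cong HOL.refl)
  moreover have "fp_class G H u \<noteq> {}" "fp_class G H v \<noteq> {}"
    using fp_eq.refl[OF assms(3)] fp_eq.refl[OF assms(4)] unfolding fp_class_def by blast+
  ultimately show ?thesis by (simp add: free_product_def)
qed

lemma group_free_product:
  assumes "group G" "group H"
  shows "group (free_product G H)"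
proof -
  interpret G: group G by fact
  interpret H: group H by fact
  let ?F = "free_product G H"
  note m = free_product_mult[OF assms]
  have c: "carrier ?F = fp_class G H ` fp_words G H" "\<one>\<^bsub>?F\<^esub> = fp_class G H []"
    by (auto simp: free_product_def)
  have inv: "\<exists>v\<in>fp_words G H. fp_eq G H (v @ u) []" if "u \<in> fp_words G H" for u
    using that
  proof (induction u)
    case Nil then show ?case by (intro bexI[of _ "[]"]) (auto intro: fp_eq.refl)
  next
    case (Cons s u)
    then obtain v where v: "v \<in> fp_words G H" "fp_eq G H (v @ u) []" by auto
    have u: "u \<in> fp_words G H" and s: "s \<in> carrier G <+> carrier H" using Cons by auto
    obtain t where t: "t \<in> carrier G <+> carrier H"
      and st: "\<And>p q. p \<in> fp_words G H \<Longrightarrow> q \<in> fp_words G H \<Longrightarrow>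
        fp_eq G H (p @ [t, s] @ q) (p @ q)"
    proof (cases s)
      case (Inl a)
      then have a: "a \<in> carrier G" using s by auto
      show ?thesis
      proof (rule that[of "Inl (inv\<^bsub>G\<^esub> a)"])
        fix p q assume pq: "p \<in> fp_words G H" "q \<in> fp_words G H"
        show "fp_eq G H (p @ [Inl (inv\<^bsub>G\<^esub> a), s] @ q) (p @ q)"
          using fp_eq.mult_l[OF pq, of "inv\<^bsub>G\<^esub> a" a] fp_eq.one_l[OF pq] a Inl
          by (auto intro: fp_eq.trans)
      qed (use a in auto)
    next
      case (Inr a)
      then have a: "a \<in> carrier H" using s by auto
      show ?thesis
      proof (rule that[of "Inr (inv\<^bsub>H\<^esub> a)"])
        fix p q assume pq: "p \<in> fp_words G H" "q \<in> fp_words G H"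
        show "fp_eq G H (p @ [Inr (inv\<^bsub>H\<^esub> a), s] @ q) (p @ q)"
          using fp_eq.mult_r[OF pq, of "inv\<^bsub>H\<^esub> a" a] fp_eq.one_r[OF pq] a Inr
          by (auto intro: fp_eq.trans)
      qed (use a in auto)
    qed
    have "fp_eq G H ((v @ [t]) @ s # u) []"
      using st[OF v(1) u] v(2) by (auto intro: fp_eq.trans)
    then show ?case using v(1) t by (intro bexI[of _ "v @ [t]"]) auto
  qed
  show ?thesis
  proof (rule groupI)
    fix X assume "X \<in> carrier ?F"
    then obtain u where u: "u \<in> fp_words G H" "X = fp_class G H u" by (auto simp: c)
    obtain v where "v \<in> fp_words G H" "fp_eq G H (v @ u) []" using inv u by blast
    then show "\<exists>Y\<in>carrier ?F. Y \<otimes>\<^bsub>?F\<^esub> X = \<one>\<^bsub>?F\<^esub>"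
      using u fp_class_eqI[of G H "v @ u" "[]"]
      by (intro bexI[of _ "fp_class G H v"]) (simp_all add: c m del: in_lists_conv_set)
  next
    fix X Y assume "X \<in> carrier ?F" "Y \<in> carrier ?F"
    then obtain u v where "u \<in> fp_words G H" "v \<in> fp_words G H"
      "X = fp_class G H u" "Y = fp_class G H v" unfolding c by blast
    then show "X \<otimes>\<^bsub>?F\<^esub> Y \<in> carrier ?F" using m by (auto simp: c)
  next
    fix X Y Z assume "X \<in> carrier ?F" "Y \<in> carrier ?F" "Z \<in> carrier ?F"
    then obtain u v w where "u \<in> fp_words G H" "v \<in> fp_words G H" "w \<in> fp_words G H"
      "X = fp_class G H u" "Y = fp_class G H v" "Z = fp_class G H w" unfolding c by blast
    then show "X \<otimes>\<^bsub>?F\<^esub> Y \<otimes>\<^bsub>?F\<^esub> Z = X \<otimes>\<^bsub>?F\<^esub> (Y \<otimes>\<^bsub>?F\<^esub> Z)"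
      using m by (simp del: in_lists_conv_set add: append_in_lists_conv)
  next
    fix X assume "X \<in> carrier ?F"
    then obtain u where "u \<in> fp_words G H" "X = fp_class G H u" unfolding c by blast
    then show "\<one>\<^bsub>?F\<^esub> \<otimes>\<^bsub>?F\<^esub> X = X" using m[of "[]" u] by (simp add: c)
  qed (auto simp: c)
qed

lemma fp_inl_hom:
  assumes "group G" "group H"
  shows "fp_inl G H \<in> hom G (free_product G H)"
proof (rule homI)
  fix a b assume ab: "a \<in> carrier G" "b \<in> carrier G"
  have "[Inl a] \<in> fp_words G H" "[Inl b] \<in> fp_words G H" using ab by auto
  with ab show "fp_inl G H (a \<otimes>\<^bsub>G\<^esub> b) = fp_inl G H a \<otimes>\<^bsub>free_product G H\<^esub> fp_inl G H b"
    using fp_class_eqI[OF fp_eq.mult_l[of "[]" G H "[]" a b]]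
    by (simp add: fp_inl_def free_product_mult[OF assms] del: in_lists_conv_set)
qed (auto simp: fp_inl_def free_product_def)

lemma fp_inr_hom:
  assumes "group G" "group H"
  shows "fp_inr G H \<in> hom H (free_product G H)"
proof (rule homI)
  fix a b assume ab: "a \<in> carrier H" "b \<in> carrier H"
  have "[Inr a] \<in> fp_words G H" "[Inr b] \<in> fp_words G H" using ab by auto
  with ab show "fp_inr G H (a \<otimes>\<^bsub>H\<^esub> b) = fp_inr G H a \<otimes>\<^bsub>free_product G H\<^esub> fp_inr G H b"
    using fp_class_eqI[OF fp_eq.mult_r[of "[]" G H "[]" a b]]
    by (simp add: fp_inr_def free_product_mult[OF assms] del: in_lists_conv_set)
qed (auto simp: fp_inr_def free_product_def)

lemma fp_val_closed:
  assumes "group K" "f \<in> hom G K" "g \<in> hom H K" "u \<in> fp_words G H"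
  shows "fp_val K f g u \<in> carrier K"
proof -
  interpret K: group K by fact
  show ?thesis using assms(4)
    by (induction u) (use assms(2,3) in \<open>auto simp: fp_val_def hom_def Pi_iff\<close>)
qed

lemma fp_val_append:
  assumes "group K" "f \<in> hom G K" "g \<in> hom H K" "u \<in> fp_words G H" "v \<in> fp_words G H"
  shows "fp_val K f g (u @ v) = fp_val K f g u \<otimes>\<^bsub>K\<^esub> fp_val K f g v"
proof -
  interpret K: group K by fact
  note cl = fp_val_closed[OF assms(1-3)]
  have s: "case_sum f g s \<in> carrier K" if "s \<in> carrier G <+> carrier H" for s
    using that assms(2,3) by (auto simp: hom_def)
  show ?thesis using assms(4)
  proof (induction u)
    case Nil then show ?case using cl[OF assms(5)] by (simp add: fp_val_def)
  next
    case (Cons t u)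
    then have "t \<in> carrier G <+> carrier H" "u \<in> fp_words G H" by auto
    then show ?case using Cons.IH cl[of u] cl[OF assms(5)] s[of t]
      by (simp add: fp_val_def K.m_assoc)
  qed
qed

lemma fp_val_cong:
  assumes "group G" "group H" "group K" "f \<in> hom G K" "g \<in> hom H K" "fp_eq G H u v"
  shows "fp_val K f g u = fp_val K f g v"
proof -
  interpret G: group G by fact
  interpret H: group H by fact
  interpret K: group K by fact
  note ap = fp_val_append[OF assms(3-5)]
  have f1: "f \<one>\<^bsub>G\<^esub> = \<one>\<^bsub>K\<^esub>" "g \<one>\<^bsub>H\<^esub> = \<one>\<^bsub>K\<^esub>"
    using assms hom_one by blast+
  have fg: "f a \<in> carrier K" if "a \<in> carrier G" for a using that assms(4) by (auto simp: hom_def)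
  have gg: "g a \<in> carrier K" if "a \<in> carrier H" for a using that assms(5) by (auto simp: hom_def)
  have tl: "fp_val K f g [Inl a, Inl b] = fp_val K f g [Inl (a \<otimes>\<^bsub>G\<^esub> b)]"
    if "a \<in> carrier G" "b \<in> carrier G" for a b
    using that fg assms(4) by (simp add: fp_val_def hom_mult)
  have tr: "fp_val K f g [Inr a, Inr b] = fp_val K f g [Inr (a \<otimes>\<^bsub>H\<^esub> b)]"
    if "a \<in> carrier H" "b \<in> carrier H" for a b
    using that gg assms(5) by (simp add: fp_val_def hom_mult)
  have o: "fp_val K f g [Inl \<one>\<^bsub>G\<^esub>] = \<one>\<^bsub>K\<^esub>" "fp_val K f g [Inr \<one>\<^bsub>H\<^esub>] = \<one>\<^bsub>K\<^esub>"
    using f1 by (auto simp: fp_val_def)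
  note cl = fp_val_closed[OF assms(3-5)]
  show ?thesis using assms(6)
  proof induction
    case (one_l u v)
    then show ?case using ap[of u "[Inl \<one>\<^bsub>G\<^esub>] @ v"] ap[of "[Inl \<one>\<^bsub>G\<^esub>]" v] ap[of u v] o cl[of v]
      by auto
  next
    case (one_r u v)
    then show ?case using ap[of u "[Inr \<one>\<^bsub>H\<^esub>] @ v"] ap[of "[Inr \<one>\<^bsub>H\<^esub>]" v] ap[of u v] o cl[of v]
      by auto
  next
    case (mult_l u v a b)
    have "fp_val K f g (u @ [Inl a, Inl b] @ v)
        = fp_val K f g u \<otimes>\<^bsub>K\<^esub> (fp_val K f g [Inl a, Inl b] \<otimes>\<^bsub>K\<^esub> fp_val K f g v)"
      using ap[of u "[Inl a, Inl b] @ v"] ap[of "[Inl a, Inl b]" v] mult_l by auto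
    moreover have "fp_val K f g (u @ [Inl (a \<otimes>\<^bsub>G\<^esub> b)] @ v)
        = fp_val K f g u \<otimes>\<^bsub>K\<^esub> (fp_val K f g [Inl (a \<otimes>\<^bsub>G\<^esub> b)] \<otimes>\<^bsub>K\<^esub> fp_val K f g v)"
      using ap[of u "[Inl (a \<otimes>\<^bsub>G\<^esub> b)] @ v"] ap[of "[Inl (a \<otimes>\<^bsub>G\<^esub> b)]" v] mult_l by auto
    ultimately show ?case using tl mult_l by simp
  next
    case (mult_r u v a b)
    have "fp_val K f g (u @ [Inr a, Inr b] @ v)
        = fp_val K f g u \<otimes>\<^bsub>K\<^esub> (fp_val K f g [Inr a, Inr b] \<otimes>\<^bsub>K\<^esub> fp_val K f g v)"
      using ap[of u "[Inr a, Inr b] @ v"] ap[of "[Inr a, Inr b]" v] mult_r by auto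
    moreover have "fp_val K f g (u @ [Inr (a \<otimes>\<^bsub>H\<^esub> b)] @ v)
        = fp_val K f g u \<otimes>\<^bsub>K\<^esub> (fp_val K f g [Inr (a \<otimes>\<^bsub>H\<^esub> b)] \<otimes>\<^bsub>K\<^esub> fp_val K f g v)"
      using ap[of u "[Inr (a \<otimes>\<^bsub>H\<^esub> b)] @ v"] ap[of "[Inr (a \<otimes>\<^bsub>H\<^esub> b)]" v] mult_r by auto
    ultimately show ?case using tr mult_r by simp
  qed auto
qed

lemma fp_lift_class:
  assumes "group G" "group H" "group K" "f \<in> hom G K" "g \<in> hom H K" "u \<in> fp_words G H"
  shows "fp_lift K f g (fp_class G H u) = fp_val K f g u"
proof -
  have "fp_val K f g v = fp_val K f g u" if "v \<in> fp_class G H u" for v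
    using that fp_val_cong[OF assms(1-5), of u v] by (simp add: fp_class_def)
  moreover have "u \<in> fp_class G H u"
    using fp_eq.refl[OF assms(6)] by (simp add: fp_class_def)
  ultimately have "fp_val K f g ` fp_class G H u = {fp_val K f g u}"
    by (metis (no_types, lifting) image_cong image_constant)
  then show ?thesis by (simp add: fp_lift_def)
qed

theorem fp_lift_hom:
  assumes "group G" "group H" "group K" "f \<in> hom G K" "g \<in> hom H K"
  shows "fp_lift K f g \<in> hom (free_product G H) K"
    and "a \<in> carrier G \<Longrightarrow> fp_lift K f g (fp_inl G H a) = f a"
    and "b \<in> carrier H \<Longrightarrow> fp_lift K f g (fp_inr G H b) = g b"
proof -
  interpret K: group K by fact
  note l = fp_lift_class[OF assms]
  show "fp_lift K f g \<in> hom (free_product G H) K"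
  proof (rule homI)
    fix X Y assume "X \<in> carrier (free_product G H)" "Y \<in> carrier (free_product G H)"
    then obtain u v where "u \<in> fp_words G H" "v \<in> fp_words G H"
      "X = fp_class G H u" "Y = fp_class G H v" by (auto simp: free_product_def)
    then show "fp_lift K f g (X \<otimes>\<^bsub>free_product G H\<^esub> Y)
        = fp_lift K f g X \<otimes>\<^bsub>K\<^esub> fp_lift K f g Y"
      using l[of "u @ v"]
      by (auto simp: free_product_mult[OF assms(1,2)] l fp_val_append[OF assms(3-5)])
  next
    fix X assume "X \<in> carrier (free_product G H)"
    then obtain u where "u \<in> fp_words G H" "X = fp_class G H u" by (auto simp: free_product_def)
    then show "fp_lift K f g X \<in> carrier K" using l fp_val_closed[OF assms(3-5)] by metis
  qed
  show "fp_lift K f g (fp_inl G H a) = f a" if "a \<in> carrier G"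
    using that l[of "[Inl a]"] hom_in_carrier[OF assms(4) that]
    by (simp add: fp_inl_def fp_val_def InlI)
  show "fp_lift K f g (fp_inr G H b) = g b" if "b \<in> carrier H"
    using that l[of "[Inr b]"] hom_in_carrier[OF assms(5) that]
    by (simp add: fp_inr_def fp_val_def InrI)
qed

theorem fp_lift_unique:
  assumes "group G" "group H" "group K" "f \<in> hom G K" "g \<in> hom H K"
    and h: "h \<in> hom (free_product G H) K"
      "\<And>a. a \<in> carrier G \<Longrightarrow> h (fp_inl G H a) = f a"
      "\<And>b. b \<in> carrier H \<Longrightarrow> h (fp_inr G H b) = g b"
    and X: "X \<in> carrier (free_product G H)"
  shows "h X = fp_lift K f g X"
proof -
  interpret K: group K by fact
  obtain u where u: "u \<in> fp_words G H" "X = fp_class G H u"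
    using X by (auto simp: free_product_def)
  have "h (fp_class G H u) = fp_val K f g u" using u(1)
  proof (induction u)
    case Nil
    have "h \<one>\<^bsub>free_product G H\<^esub> = \<one>\<^bsub>K\<^esub>"
      using hom_one[OF h(1) group_free_product[OF assms(1,2)] assms(3)] .
    then show ?case by (simp add: fp_val_def free_product_def)
  next
    case (Cons s u)
    then have s: "[s] \<in> fp_words G H" and u: "u \<in> fp_words G H" by auto
    have "h (fp_class G H (s # u)) = h (fp_class G H [s]) \<otimes>\<^bsub>K\<^esub> h (fp_class G H u)"
      using free_product_mult[OF assms(1,2) s u]
        hom_mult[OF h(1), of "fp_class G H [s]" "fp_class G H u"] s u
      by (simp add: free_product_def del: in_lists_conv_set)
    moreover have "h (fp_class G H [s]) = case_sum f g s"
      using s h(2,3) by (auto simp: fp_inl_def fp_inr_def)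
    ultimately show ?case using Cons.IH u by (simp add: fp_val_def)
  qed
  then show ?thesis using u fp_lift_class[OF assms(1-5)] by simp
qed


section \<open>Sharply MIF groups\<close>

text \<open>Only meaningful for \<open>g\<close> in the subgroup generated by \<open>S\<close>; otherwise the \<open>LEAST\<close> is
  unspecified.\<close>

definition word_length :: "('a, 'b) monoid_scheme \<Rightarrow> 'a set \<Rightarrow> 'a \<Rightarrow> nat" where
  "word_length G S g = (LEAST n. \<exists>ws. length ws = n \<and> set ws \<subseteq> S \<union> (\<lambda>s. inv\<^bsub>G\<^esub> s) ` S \<and>
     foldr (\<otimes>\<^bsub>G\<^esub>) ws \<one>\<^bsub>G\<^esub> = g)"

abbreviation free_product_Z :: "('a, 'b) monoid_scheme \<Rightarrow> ('a + int) list set monoid" where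
  "free_product_Z G \<equiv> free_product G integer_group"

text \<open>The generator \<open>x\<close> of the cyclic factor is the image of \<open>1 :: int\<close>.\<close>

definition mif_generators :: "('a, 'b) monoid_scheme \<Rightarrow> 'a set \<Rightarrow> ('a + int) list set set" where
  "mif_generators G S = fp_inl G integer_group ` S \<union> {fp_inr G integer_group 1}"

text \<open>\<open>w(g)\<close>: the homomorphism that is the identity on \<open>G\<close> and sends \<open>x\<close> to \<open>g\<close>,
  i.e. \<open>x\<^sup>k\<close> to \<open>g\<^sup>k\<close>.\<close>

definition mif_eval :: "('a, 'b) monoid_scheme \<Rightarrow> ('a + int) list set \<Rightarrow> 'a \<Rightarrow> 'a" where
  "mif_eval G w g = fp_lift G (\<lambda>a. a) (\<lambda>k. g [^]\<^bsub>G\<^esub> k) w"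

lemma mif_eval_hom:
  assumes "group G" "g \<in> carrier G"
  shows "(\<lambda>w. mif_eval G w g) \<in> hom (free_product_Z G) G"
    and "a \<in> carrier G \<Longrightarrow> mif_eval G (fp_inl G integer_group a) g = a"
    and "mif_eval G (fp_inr G integer_group 1) g = g"
proof -
  interpret group G by fact
  have 1: "(\<lambda>a. a) \<in> hom G G" by (auto simp: hom_def)
  have 2: "(\<lambda>k. g [^]\<^bsub>G\<^esub> k) \<in> hom integer_group G"
    using assms(2) by (auto simp: hom_def int_pow_mult)
  note l = fp_lift_hom[OF assms(1) group_integer_group assms(1) 1 2]
  show "(\<lambda>w. mif_eval G w g) \<in> hom (free_product_Z G) G"
    using l(1) by (simp add: mif_eval_def)
  show "mif_eval G (fp_inl G integer_group a) g = a" if "a \<in> carrier G"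
    using l(2)[OF that] by (simp add: mif_eval_def)
  show "mif_eval G (fp_inr G integer_group 1) g = g"
    using l(3)[of 1] assms(2) by (simp add: mif_eval_def)
qed

text \<open>As required, the infimum over the empty set is \<open>\<infinity>\<close>.\<close>

definition mif_complexity ::
    "('a, 'b) monoid_scheme \<Rightarrow> 'a set \<Rightarrow> ('a + int) list set \<Rightarrow> enat" where
  "mif_complexity G S w =
     (INF g \<in> {g \<in> carrier G. mif_eval G w g \<noteq> \<one>\<^bsub>G\<^esub>}. enat (word_length G S g))"

text \<open>For a finite generating set \<open>S\<close> the supremum ranges over a finite set, so it is a maximum.\<close>

definition mif_growth :: "('a, 'b) monoid_scheme \<Rightarrow> 'a set \<Rightarrow> nat \<Rightarrow> enat" where
  "mif_growth G S n =
     (SUP w \<in> {w \<in> carrier (free_product_Z G). w \<noteq> \<one>\<^bsub>free_product_Z G\<^esub> \<and>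
        word_length (free_product_Z G) (mif_generators G S) w \<le> n}. mif_complexity G S w)"

text \<open>The condition does not depend on the choice of the finite generating set \<open>S\<close>: changing it
  distorts both word lengths by bounded factors only.\<close>

definition sharply_MIF :: "('a, 'b) monoid_scheme \<Rightarrow> bool" where
  "sharply_MIF G \<longleftrightarrow> (\<exists>S. finite_generating_set G S \<and>
     (\<exists>C>0. \<forall>n\<ge>2. ereal_of_enat (mif_growth G S n) \<le> ereal (C * ln (real n))))"

end

theory Submission
  imports Defs
begin

text \<open>Lift \<open>\<Gamma>\<close> to matrices of determinant 1. The elements \<open>g\<close> on which a given word does not
  vanish are found by ping-pong. The word \<open>w\<close> has at most \<open>n\<close> nontrivial coefficients \<open>a\<close> between
  consecutive powers of \<open>x\<close>, and \<open>w(g)\<close> is forced to be large as soon as \<open>g\<close> is close to a rank one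
  matrix with attracting direction \<open>P\<close> and repelling direction \<open>P'\<close>, and every coefficient moves
  \<open>P, P'\<close> away from \<open>P, P'\<close> by a definite amount, say \<open>n\<close> to a negative power. Discreteness
  makes the quadratic form \<open>v \<mapsto> det(a v, v)\<close> of a nontrivial \<open>a\<close> uniformly nondegenerate relative to
  the norm of \<open>a\<close>, so it is small near at most two directions. The words of length \<open>L\<close> in a Schottky
  pair \<open>s, t\<close> give \<open>2\<^sup>L\<close> directions whose mutual distances decay at most exponentially in \<open>L\<close>;
  with \<open>L\<close> a large multiple of \<open>log n\<close> there are more of them than all coefficients together can
  spoil. Having chosen \<open>P\<close> and \<open>P'\<close> in the orbits of the two fixed points of \<open>s\<close> under words \<open>h\<close> and
  \<open>h'\<close>, take \<open>g = h s\<^sup>N h'\<^sup>-\<^sup>1\<close> with \<open>N\<close> proportional to \<open>log n\<close>.\<close>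

section \<open>Two-by-two matrices\<close>

text \<open>The generating set may be chosen, so the Schottky pair is adjoined to it and only
  lengths of words in \<open>s\<close> and \<open>t\<close> have to be bounded. To make
  \<open>g\<close> a positive word, \<open>h'\<close> is taken as a word in the inverses of
  \<open>s\<close> and \<open>t\<close>; hence separation is proved for both pairs. A coefficient
  that is +-1 as a matrix moves no direction at all. In a reduced word it stands only between equal
  powers of \<open>x\<close>, and there it suffices that \<open>P\<close> and \<open>P'\<close> are
  apart. The coefficient in front of the first power of \<open>x\<close> is carried cyclically to
  the end and merged with the last one. All losses are measured on one scale
  \<open>l = M ^ L\<close>, polynomial in \<open>n\<close>: norms are at most \<open>l\<close>,
  separations at least \<open>1 / l\<close>, genericity costs \<open>l ^ 10\<close>, and the
  eigenvalue is at least \<open>l ^ 30\<close>. The gain of each letter absorbs the error made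
  there, so errors stay relative and do not accumulate along the word.\<close>

definition wedge :: "complex^2 \<Rightarrow> complex^2 \<Rightarrow> complex" where
  "wedge u v = u $ 1 * v $ 2 - u $ 2 * v $ 1"

text \<open>Sums of moduli of entries turn every product estimate into a comparison of expanded
  sums.\<close>

definition vnorm :: "complex^2 \<Rightarrow> real" where
  "vnorm v = cmod (v $ 1) + cmod (v $ 2)"

definition mnorm :: "complex^2^2 \<Rightarrow> real" where
  "mnorm A = cmod (A $ 1 $ 1) + cmod (A $ 1 $ 2) + cmod (A $ 2 $ 1) + cmod (A $ 2 $ 2)"

definition mk_mat :: "complex \<Rightarrow> complex \<Rightarrow> complex \<Rightarrow> complex \<Rightarrow> complex^2^2" where
  "mk_mat a b c d = (\<chi> i j. if i = 1 then (if j = 1 then a else b) else (if j = 1 then c else d))"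

text \<open>The adjugate: the inverse when the determinant is 1, yet linear in \<open>A\<close> and
  defined for all matrices.\<close>

definition adj2 :: "complex^2^2 \<Rightarrow> complex^2^2" where
  "adj2 A = mk_mat (A $ 2 $ 2) (- (A $ 1 $ 2)) (- (A $ 2 $ 1)) (A $ 1 $ 1)"

lemma mk_mat_nth [simp]:
  "mk_mat a b c d $ 1 $ 1 = a" "mk_mat a b c d $ 1 $ 2 = b"
  "mk_mat a b c d $ 2 $ 1 = c" "mk_mat a b c d $ 2 $ 2 = d"
  by (auto simp: mk_mat_def)

lemma adj2_nth [simp]:
  "adj2 A $ 1 $ 1 = A $ 2 $ 2" "adj2 A $ 1 $ 2 = - (A $ 1 $ 2)"
  "adj2 A $ 2 $ 1 = - (A $ 2 $ 1)" "adj2 A $ 2 $ 2 = A $ 1 $ 1"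
  by (auto simp: adj2_def)

lemma matrix_vector_mult_nth2: "((A::complex^2^2) *v x) $ i = A $ i $ 1 * x $ 1 + A $ i $ 2 * x $ 2"
  by (simp add: matrix_vector_mult_def sum_2)

lemma matrix_matrix_mult_nth2:
  "((A::complex^2^2) ** B) $ i $ j = A $ i $ 1 * B $ 1 $ j + A $ i $ 2 * B $ 2 $ j"
  by (simp add: matrix_matrix_mult_def sum_2)

lemma mat_1_nth2 [simp]:
  "(mat 1 :: complex^2^2) $ 1 $ 1 = 1" "(mat 1 :: complex^2^2) $ 1 $ 2 = 0"
  "(mat 1 :: complex^2^2) $ 2 $ 1 = 0" "(mat 1 :: complex^2^2) $ 2 $ 2 = 1"
  by (auto simp: mat_def)

lemma matrix2_eq_iff:
  "(A::complex^2^2) = B \<longleftrightarrow> A $ 1 $ 1 = B $ 1 $ 1 \<and> A $ 1 $ 2 = B $ 1 $ 2 \<and>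
     A $ 2 $ 1 = B $ 2 $ 1 \<and> A $ 2 $ 2 = B $ 2 $ 2"
  by (auto simp: vec_eq_iff forall_2)

lemma vector2_eq_iff: "(u::complex^2) = v \<longleftrightarrow> u $ 1 = v $ 1 \<and> u $ 2 = v $ 2"
  by (auto simp: vec_eq_iff forall_2)

lemmas mat2_simps = matrix_vector_mult_nth2 matrix_matrix_mult_nth2 det_2

lemma adj2_mult: "det A = 1 \<Longrightarrow> adj2 A ** A = mat 1" "det A = 1 \<Longrightarrow> A ** adj2 A = mat 1"
  by (auto simp: matrix2_eq_iff mat2_simps algebra_simps)

lemma det_adj2 [simp]: "det (adj2 A) = det A"
  by (simp add: mat2_simps mult.commute)

lemma adj2_adj2 [simp]: "adj2 (adj2 A) = A"
  by (simp add: matrix2_eq_iff)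

lemma adj2_matrix_mult: "adj2 (A ** B) = adj2 B ** adj2 A"
  by (simp add: matrix2_eq_iff mat2_simps algebra_simps)

lemma adj2_mat_1 [simp]: "adj2 (mat 1) = mat 1"
  by (simp add: matrix2_eq_iff)

lemma mnorm_adj2 [simp]: "mnorm (adj2 A) = mnorm A"
  by (simp add: mnorm_def)

lemma mnorm_uminus [simp]: "mnorm (- A) = mnorm A"
  by (simp add: mnorm_def)

lemma mnorm_nonneg [simp]: "0 \<le> mnorm A"
  by (simp add: mnorm_def)

lemma vnorm_nonneg [simp]: "0 \<le> vnorm v"
  by (simp add: vnorm_def)

lemma mnorm_mat_1 [simp]: "mnorm (mat 1) = 2"
  by (simp add: mnorm_def)

lemma vnorm_uminus [simp]: "vnorm (- v) = vnorm v"
  by (simp add: vnorm_def)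

lemma vnorm_scale: "vnorm (c *s v) = cmod c * vnorm v"
  by (simp add: vnorm_def norm_mult algebra_simps)

lemma vnorm_add: "vnorm (u + v) \<le> vnorm u + vnorm v"
  using norm_triangle_ineq[of "u $ 1" "v $ 1"] norm_triangle_ineq[of "u $ 2" "v $ 2"]
  by (simp add: vnorm_def)

lemma vnorm_diff: "vnorm (u - v) \<le> vnorm u + vnorm v"
  using vnorm_add[of u "- v"] by simp

lemma cmod_mult_add_le: "cmod (a * b + c * d) \<le> cmod a * cmod b + cmod c * cmod d"
  by (rule order_trans[OF norm_triangle_ineq]) (simp add: norm_mult)

lemma cmod_mult_diff_le: "cmod (a * b - c * d) \<le> cmod a * cmod b + cmod c * cmod d"
  by (rule order_trans[OF norm_triangle_ineq4]) (simp add: norm_mult)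

lemma vnorm_matrix_vector_mult: "vnorm (A *v v) \<le> mnorm A * vnorm v"
proof -
  have 1: "cmod ((A *v v) $ i) \<le> cmod (A $ i $ 1) * cmod (v $ 1) + cmod (A $ i $ 2) * cmod (v $ 2)" for i
    unfolding matrix_vector_mult_nth2 by (rule cmod_mult_add_le)
  have "vnorm (A *v v) \<le> cmod (A $ 1 $ 1) * cmod (v $ 1) + cmod (A $ 1 $ 2) * cmod (v $ 2) +
     (cmod (A $ 2 $ 1) * cmod (v $ 1) + cmod (A $ 2 $ 2) * cmod (v $ 2))"
    unfolding vnorm_def using 1[of 1] 1[of 2] by linarith
  also have "\<dots> \<le> mnorm A * vnorm v"
    by (simp add: mnorm_def vnorm_def algebra_simps)
  finally show ?thesis .
qed

lemma cmod_wedge_le: "cmod (wedge u v) \<le> vnorm u * vnorm v"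
proof -
  have "cmod (wedge u v) \<le> cmod (u $ 1) * cmod (v $ 2) + cmod (u $ 2) * cmod (v $ 1)"
    unfolding wedge_def by (rule cmod_mult_diff_le)
  also have "\<dots> \<le> vnorm u * vnorm v"
    by (simp add: vnorm_def algebra_simps)
  finally show ?thesis .
qed

lemma mnorm_mult_le: "mnorm (A ** B) \<le> mnorm A * mnorm B"
proof -
  have "cmod ((A ** B) $ i $ j) \<le> cmod (A $ i $ 1) * cmod (B $ 1 $ j) + cmod (A $ i $ 2) * cmod (B $ 2 $ j)" for i j
    unfolding matrix_matrix_mult_nth2 by (rule cmod_mult_add_le)
  from this[of 1 1] this[of 1 2] this[of 2 1] this[of 2 2]
  have "mnorm (A ** B) \<le>
     (cmod (A $ 1 $ 1) * cmod (B $ 1 $ 1) + cmod (A $ 1 $ 2) * cmod (B $ 2 $ 1)) +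
     (cmod (A $ 1 $ 1) * cmod (B $ 1 $ 2) + cmod (A $ 1 $ 2) * cmod (B $ 2 $ 2)) +
     (cmod (A $ 2 $ 1) * cmod (B $ 1 $ 1) + cmod (A $ 2 $ 2) * cmod (B $ 2 $ 1)) +
     (cmod (A $ 2 $ 1) * cmod (B $ 1 $ 2) + cmod (A $ 2 $ 2) * cmod (B $ 2 $ 2))"
    unfolding mnorm_def by linarith
  also have "\<dots> \<le> mnorm A * mnorm B"
    by (simp add: mnorm_def algebra_simps)
  finally show ?thesis .
qed

text \<open>The determinant is bounded by the square of the norm. In ping-pong this ensures that
  coefficients do not lower the growth factor.\<close>

lemma mnorm_ge_1:
  assumes "det A = 1"
  shows "1 \<le> mnorm A"
proof -
  have "1 = cmod (A $ 1 $ 1 * A $ 2 $ 2 - A $ 1 $ 2 * A $ 2 $ 1)"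
    using assms by (simp add: det_2)
  also have "\<dots> \<le> cmod (A $ 1 $ 1) * cmod (A $ 2 $ 2) + cmod (A $ 1 $ 2) * cmod (A $ 2 $ 1)"
    by (rule cmod_mult_diff_le)
  also have "\<dots> \<le> mnorm A * mnorm A"
    by (simp add: mnorm_def algebra_simps)
  finally have 1: "1 \<le> mnorm A * mnorm A" .
  show ?thesis
  proof (rule ccontr)
    assume "\<not> 1 \<le> mnorm A"
    then show False using mult_left_mono[of "mnorm A" 1 "mnorm A"] 1 by simp
  qed
qed

section \<open>The area form \<open>wedge\<close> as a measure of the distance between
  directions\<close>

lemma wedge_self [simp]: "wedge v v = 0"
  by (simp add: wedge_def)

lemma wedge_commute: "wedge u v = - wedge v u"
  by (simp add: wedge_def)

lemma cmod_wedge_commute: "cmod (wedge u v) = cmod (wedge v u)"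
  by (metis wedge_commute norm_minus_cancel)

lemma wedge_linear:
  "wedge (u + u') v = wedge u v + wedge u' v" "wedge (u - u') v = wedge u v - wedge u' v"
  "wedge u (v + v') = wedge u v + wedge u v'" "wedge u (v - v') = wedge u v - wedge u v'"
  "wedge (c *s u) v = c * wedge u v" "wedge u (c *s v) = c * wedge u v"
  "wedge (- u) v = - wedge u v" "wedge u (- v) = - wedge u v"
  by (auto simp: wedge_def algebra_simps)

lemma wedge_matrix_mult:
  assumes "det A = 1"
  shows "wedge (A *v u) (A *v v) = wedge u v"
proof -
  have "wedge (A *v u) (A *v v) = det A * wedge u v"
    unfolding wedge_def mat2_simps by (simp add: algebra_simps)
  then show ?thesis using assms by simp
qed

text \<open>\<open>adj2 A\<close> is the adjoint of \<open>A\<close> for the area form, whatever the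
  determinant. This turns conditions on the image of a vector into linear conditions on the vector
  itself.\<close>

lemma wedge_matrix_adj2: "wedge (A *v u) v = wedge u (adj2 A *v v)"
  by (simp add: wedge_def mat2_simps algebra_simps)

text \<open>Cramer's rule for a basis of determinant 1.\<close>

lemma wedge_decompose: "wedge P R = 1 \<Longrightarrow> v = wedge v R *s P + wedge P v *s R"
proof -
  assume "wedge P R = 1"
  then have "(P $ 1 * R $ 2 - P $ 2 * R $ 1) * x = x" for x
    using \<open>wedge P R = 1\<close> by (simp add: wedge_def)
  from this[of "v $ 1"] this[of "v $ 2"] show ?thesis
    by (simp add: vector2_eq_iff wedge_def algebra_simps)
qed

text \<open>Lagrange interpolation for binary quadratic forms with denominators cleared:
  \<open>wedge v v1\<close> is the linear form vanishing in the direction of \<open>v1\<close>, so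
  three distinct directions determine \<open>Q\<close>.\<close>

lemma quadratic_lagrange:
  fixes Q :: "complex^2 \<Rightarrow> complex"
  assumes "\<And>v. Q v = \<alpha> * (v $ 1)\<^sup>2 + \<beta> * (v $ 1 * v $ 2) + \<gamma> * (v $ 2)\<^sup>2"
  shows "Q v * (wedge v1 v2 * wedge v1 v3 * wedge v2 v3) =
     Q v1 * wedge v v2 * wedge v v3 * wedge v2 v3 - Q v2 * wedge v v1 * wedge v v3 * wedge v1 v3
     + Q v3 * wedge v v1 * wedge v v2 * wedge v1 v2"
  unfolding assms wedge_def by algebra

text \<open>Interpolation from three separated vectors bounds \<open>Q\<close> everywhere, hence its
  coefficients. Contrapositively, a form with large coefficients is small at no more than two
  members of a separated family.\<close>

lemma quadratic_form_not_small:
  assumes "\<sigma> > 0" "\<rho> > 0"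
    and "\<sigma> \<le> cmod (wedge v1 v2)" "\<sigma> \<le> cmod (wedge v1 v3)" "\<sigma> \<le> cmod (wedge v2 v3)"
    and "vnorm v1 \<le> \<rho>" "vnorm v2 \<le> \<rho>" "vnorm v3 \<le> \<rho>"
    and Q: "\<And>v. Q v = \<alpha> * (v $ 1)\<^sup>2 + \<beta> * (v $ 1 * v $ 2) + \<gamma> * (v $ 2 :: complex)\<^sup>2"
    and "cmod (Q v1) < m" "cmod (Q v2) < m" "cmod (Q v3) < m"
  shows "cmod \<alpha> + cmod \<beta> + cmod \<gamma> < 24 * m * \<rho>\<^sup>2 / \<sigma>\<^sup>2"
proof -
  have nz: "wedge v1 v2 \<noteq> 0" "wedge v1 v3 \<noteq> 0" "wedge v2 v3 \<noteq> 0"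
    using assms(1,3-5) by auto
  note lag = quadratic_lagrange[of Q, OF Q, of _ v1 v2 v3]
  have Qv: "Q v = Q v1 * (wedge v v2 * wedge v v3) / (wedge v1 v2 * wedge v1 v3)
     - Q v2 * (wedge v v1 * wedge v v3) / (wedge v1 v2 * wedge v2 v3)
     + Q v3 * (wedge v v1 * wedge v v2) / (wedge v1 v3 * wedge v2 v3)" for v
    using nz lag[of v] by (simp add: field_simps)
  have bd: "cmod (x * (y * z) / (p * q)) < m * (vnorm v)\<^sup>2 * \<rho>\<^sup>2 / \<sigma>\<^sup>2"
    if "cmod x < m" "cmod y \<le> vnorm v * \<rho>" "cmod z \<le> vnorm v * \<rho>" "\<sigma> \<le> cmod p" "\<sigma> \<le> cmod q" "vnorm v > 0"
    for x y z p q v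
  proof -
    have "cmod (x * (y * z) / (p * q)) = cmod x * (cmod y * cmod z) / (cmod p * cmod q)"
      by (simp add: norm_mult norm_divide)
    also have "\<dots> \<le> cmod x * ((vnorm v * \<rho>) * (vnorm v * \<rho>)) / (\<sigma> * \<sigma>)"
      using that assms(1,2) by (intro frac_le mult_mono mult_pos_pos mult_nonneg_nonneg) auto
    also have "\<dots> < m * ((vnorm v * \<rho>) * (vnorm v * \<rho>)) / (\<sigma> * \<sigma>)"
      using that assms(1,2) by (intro divide_strict_right_mono mult_strict_right_mono) auto
    finally show ?thesis by (simp add: power2_eq_square algebra_simps)
  qed
  have sb: "cmod (wedge v u) \<le> vnorm v * \<rho>" if "vnorm u \<le> \<rho>" for u v
    using cmod_wedge_le[of v u] mult_left_mono[OF that vnorm_nonneg[of v]] by linarith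
  have val: "cmod (Q v) < 3 * m * (vnorm v)\<^sup>2 * \<rho>\<^sup>2 / \<sigma>\<^sup>2" if "vnorm v > 0" for v
  proof -
    have "cmod (Q v) \<le> cmod (Q v1 * (wedge v v2 * wedge v v3) / (wedge v1 v2 * wedge v1 v3))
     + cmod (Q v2 * (wedge v v1 * wedge v v3) / (wedge v1 v2 * wedge v2 v3))
     + cmod (Q v3 * (wedge v v1 * wedge v v2) / (wedge v1 v3 * wedge v2 v3))"
      unfolding Qv[of v] by (intro order_trans[OF norm_triangle_ineq] add_right_mono norm_triangle_ineq4)
    also have "\<dots> < m * (vnorm v)\<^sup>2 * \<rho>\<^sup>2 / \<sigma>\<^sup>2 + m * (vnorm v)\<^sup>2 * \<rho>\<^sup>2 / \<sigma>\<^sup>2 + m * (vnorm v)\<^sup>2 * \<rho>\<^sup>2 / \<sigma>\<^sup>2"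
      using assms that by (intro add_strict_mono bd sb) auto
    finally show ?thesis by (simp add: algebra_simps)
  qed
  \<comment> \<open>The coefficients are read off at (1,0), (0,1) and (1,1). In units of the
    \<open>X\<close> below, the last vector has norm 2 and costs 12, and \<open>\<beta>\<close> is
    \<open>Q e3 - \<alpha> - \<gamma>\<close>, so the sum is below 12 + 2 * (3 + 3), the 24 of the
    statement.\<close>
  define e1 e2 e3 :: "complex^2" where "e1 = (\<chi> i. if i = 1 then 1 else 0)"
    and "e2 = (\<chi> i. if i = 1 then 0 else 1)" and "e3 = (\<chi> i. 1)"
  have n: "vnorm e1 = 1" "vnorm e2 = 1" "vnorm e3 = 2"
    by (auto simp: e1_def e2_def e3_def vnorm_def)
  have q: "Q e1 = \<alpha>" "Q e2 = \<gamma>" "Q e3 = \<alpha> + \<beta> + \<gamma>"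
    by (auto simp: e1_def e2_def e3_def Q)
  have "cmod \<beta> \<le> cmod (Q e3) + cmod \<alpha> + cmod \<gamma>"
  proof -
    have "\<beta> = Q e3 - \<alpha> - \<gamma>" using q by simp
    then show ?thesis
      by (metis (no_types) order_trans[OF norm_triangle_ineq4 add_right_mono[OF norm_triangle_ineq4]])
  qed
  moreover define X where "X = m * \<rho>\<^sup>2 / \<sigma>\<^sup>2"
  have X: "3 * m * x * \<rho>\<^sup>2 / \<sigma>\<^sup>2 = 3 * x * X" "24 * m * \<rho>\<^sup>2 / \<sigma>\<^sup>2 = 24 * X" for x
    by (simp_all add: X_def)
  have "cmod \<alpha> < 3 * X" "cmod \<gamma> < 3 * X" "cmod (Q e3) < 12 * X"
    using val[of e1, unfolded X] val[of e2, unfolded X] val[of e3, unfolded X] n q by simp_all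
  ultimately show ?thesis unfolding X(2) by linarith
qed

text \<open>The analogue for linear forms uses two vectors: \<open>u\<close> is recovered by
  Cramer's rule from its pairings with \<open>v1\<close> and \<open>v2\<close>.\<close>

lemma linear_form_not_small:
  assumes "\<sigma> > 0" "\<rho> > 0" "\<sigma> \<le> cmod (wedge v1 v2)" "vnorm v1 \<le> \<rho>" "vnorm v2 \<le> \<rho>"
    and "cmod (wedge u v1) < m" "cmod (wedge u v2) < m"
  shows "vnorm u < 2 * m * \<rho> / \<sigma>"
proof -
  have "wedge v1 v2 *s u = wedge u v2 *s v1 - wedge u v1 *s v2"
    by (simp add: vector2_eq_iff wedge_def algebra_simps)
  then have "cmod (wedge v1 v2) * vnorm u = vnorm (wedge u v2 *s v1 - wedge u v1 *s v2)"
    by (metis vnorm_scale)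
  also have "\<dots> \<le> cmod (wedge u v2) * vnorm v1 + cmod (wedge u v1) * vnorm v2"
    using vnorm_diff[of "wedge u v2 *s v1" "wedge u v1 *s v2"] by (simp add: vnorm_scale)
  also have "\<dots> \<le> cmod (wedge u v2) * \<rho> + cmod (wedge u v1) * \<rho>"
    using assms by (intro add_mono mult_left_mono) auto
  also have "\<dots> < m * \<rho> + m * \<rho>"
    using assms by (intro add_strict_mono mult_strict_right_mono) auto
  finally have "cmod (wedge v1 v2) * vnorm u < 2 * m * \<rho>" by (simp add: algebra_simps)
  moreover have "\<sigma> * vnorm u \<le> cmod (wedge v1 v2) * vnorm u"
    using assms by (intro mult_right_mono) auto
  ultimately show ?thesis using assms(1) by (simp add: field_simps)
qed

section \<open>Loxodromic elements of discrete groups\<close>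

text \<open>The operation \<open>^\<close> on \<open>complex^2^2\<close> is the componentwise power, not the matrix power.\<close>

definition matpow :: "complex^2^2 \<Rightarrow> nat \<Rightarrow> complex^2^2" where
  "matpow A n = ((**) A ^^ n) (mat 1)"

text \<open>For \<open>det Q = 1\<close> this is the matrix of \<open>A\<close> in the basis of the
  columns of \<open>Q\<close>.\<close>

definition conj_by :: "complex^2^2 \<Rightarrow> complex^2^2 \<Rightarrow> complex^2^2" where
  "conj_by Q A = adj2 Q ** A ** Q"

lemma matpow_0 [simp]: "matpow A 0 = mat 1"
  by (simp add: matpow_def)

lemma matpow_Suc [simp]: "matpow A (Suc n) = A ** matpow A n"
  by (simp add: matpow_def)

lemma conj_by_mult:
  assumes "det Q = 1"
  shows "conj_by Q A ** conj_by Q B = conj_by Q (A ** B)"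
proof -
  have "conj_by Q A ** conj_by Q B = adj2 Q ** A ** (Q ** adj2 Q) ** B ** Q"
    unfolding conj_by_def by (simp add: matrix_mul_assoc)
  then show ?thesis using adj2_mult[OF assms] by (simp add: conj_by_def matrix_mul_assoc)
qed

lemma conj_by_adj2: "adj2 (conj_by Q A) = conj_by Q (adj2 A)"
  by (simp add: conj_by_def adj2_matrix_mult matrix_mul_assoc)

lemma conj_by_mat_1: "det Q = 1 \<Longrightarrow> conj_by Q (mat 1) = mat 1"
  by (simp add: conj_by_def adj2_mult)

lemma conj_by_uminus: "conj_by Q (- A) = - conj_by Q A"
  by (simp add: conj_by_def matrix_neg_mult)

lemma conj_by_diff: "conj_by Q (A - B) = conj_by Q A - conj_by Q B"
  by (simp add: conj_by_def matrix2_eq_iff mat2_simps algebra_simps)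

lemma det_conj_by: "det Q = 1 \<Longrightarrow> det (conj_by Q A) = det A"
  by (simp add: conj_by_def det_mul)

lemma conj_by_inverse:
  assumes "det Q = 1"
  shows "conj_by (adj2 Q) (conj_by Q A) = A"
proof -
  have "conj_by (adj2 Q) (conj_by Q A) = (Q ** adj2 Q) ** A ** (Q ** adj2 Q)"
    by (simp add: conj_by_def matrix_mul_assoc)
  then show ?thesis using adj2_mult[OF assms] by simp
qed

lemma conj_by_eq_iff: "det Q = 1 \<Longrightarrow> conj_by Q A = conj_by Q B \<longleftrightarrow> A = B"
  by (metis conj_by_inverse)

lemma matpow_conj_by: "det Q = 1 \<Longrightarrow> matpow (conj_by Q A) n = conj_by Q (matpow A n)"
  by (induction n) (simp_all add: conj_by_mat_1 conj_by_mult)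

lemma mnorm_conj_by: "mnorm (conj_by Q A) \<le> (mnorm Q)\<^sup>2 * mnorm A"
proof -
  have "mnorm (conj_by Q A) \<le> mnorm (adj2 Q ** A) * mnorm Q"
    unfolding conj_by_def by (rule mnorm_mult_le)
  also have "\<dots> \<le> mnorm (adj2 Q) * mnorm A * mnorm Q"
    by (intro mult_right_mono mnorm_mult_le) auto
  finally show ?thesis by (simp add: power2_eq_square algebra_simps)
qed

lemma trace_conj_by:
  assumes "det Q = 1"
  shows "conj_by Q A $ 1 $ 1 + conj_by Q A $ 2 $ 2 = A $ 1 $ 1 + A $ 2 $ 2"
proof -
  have "conj_by Q A $ 1 $ 1 + conj_by Q A $ 2 $ 2 = det Q * (A $ 1 $ 1 + A $ 2 $ 2)"
    by (simp add: conj_by_def mat2_simps algebra_simps)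
  then show ?thesis using assms by simp
qed

section \<open>Eigenvectors and normal forms\<close>

lemma singular_kernel:
  fixes p q r s :: complex
  assumes "p * s = q * r"
  obtains x y where "x \<noteq> 0 \<or> y \<noteq> 0" "p * x + q * y = 0" "r * x + s * y = 0"
proof (cases "p = 0 \<and> q = 0")
  case True
  show ?thesis
  proof (cases "r = 0 \<and> s = 0")
    case True
    then show ?thesis using that[of 1 0] \<open>p = 0 \<and> q = 0\<close> by simp
  next
    case False
    then show ?thesis using that[of "- s" r] \<open>p = 0 \<and> q = 0\<close> by auto
  qed
next
  case False
  then show ?thesis using that[of "- q" p] assms by (auto simp: algebra_simps)
qed

lemma eigenvector_exists:
  fixes A :: "complex^2^2"
  assumes "det A = 1" and a: "a\<^sup>2 - (A $ 1 $ 1 + A $ 2 $ 2) * a + 1 = 0"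
  obtains v where "v \<noteq> 0" "A *v v = a *s v"
proof -
  have "(A $ 1 $ 1 - a) * (A $ 2 $ 2 - a) = A $ 1 $ 2 * A $ 2 $ 1"
    using assms unfolding det_2 by algebra
  then obtain x y where xy: "x \<noteq> 0 \<or> y \<noteq> 0" "(A $ 1 $ 1 - a) * x + A $ 1 $ 2 * y = 0"
      "A $ 2 $ 1 * x + (A $ 2 $ 2 - a) * y = 0"
    by (rule singular_kernel)
  define v :: "complex^2" where "v = (\<chi> i. if i = 1 then x else y)"
  have "v $ 1 = x" "v $ 2 = y" by (auto simp: v_def)
  with xy have "v \<noteq> 0" "A *v v = a *s v"
    by (auto simp: vector2_eq_iff mat2_simps algebra_simps)
  then show ?thesis using that by blast
qed

lemma complex_quadratic_root: "\<exists>a::complex. a\<^sup>2 - t * a + 1 = 0"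
proof
  define s where "s = csqrt (t\<^sup>2 - 4)"
  have "((t + s) / 2)\<^sup>2 - t * ((t + s) / 2) + 1 = (s\<^sup>2 - t\<^sup>2 + 4) / 4"
    by (simp add: power2_eq_square field_simps)
  also have "\<dots> = 0" by (simp add: s_def)
  finally show "((t + s) / 2)\<^sup>2 - t * ((t + s) / 2) + 1 = 0" .
qed

definition of_columns :: "complex^2 \<Rightarrow> complex^2 \<Rightarrow> complex^2^2" where
  "of_columns u v = mk_mat (u $ 1) (v $ 1) (u $ 2) (v $ 2)"

lemma det_of_columns: "det (of_columns u v) = wedge u v"
  by (simp add: of_columns_def det_2 wedge_def)

text \<open>An eigenvector is completed to a basis of determinant 1; the lower left entry becomes
  its pairing with its own image.\<close>

lemma triangularize:
  assumes "det A = 1"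
  obtains Q where "det Q = 1" "conj_by Q A $ 2 $ 1 = 0"
proof -
  obtain a where "a\<^sup>2 - (A $ 1 $ 1 + A $ 2 $ 2) * a + 1 = 0"
    using complex_quadratic_root by blast
  then obtain v where v: "v \<noteq> 0" "A *v v = a *s v" by (rule eigenvector_exists[OF assms])
  obtain u where u: "wedge v u = 1"
  proof (cases "v $ 1 = 0")
    case True
    then have "v $ 2 \<noteq> 0" using v by (auto simp: vector2_eq_iff)
    then show ?thesis using True that[of "\<chi> i. if i = 1 then - 1 / v $ 2 else 0"]
      by (simp add: wedge_def)
  next
    case False
    then show ?thesis using that[of "\<chi> i. if i = 1 then 0 else 1 / v $ 1"]
      by (simp add: wedge_def)
  qed
  have "conj_by (of_columns v u) A $ 2 $ 1 = wedge v (A *v v)"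
    by (simp add: conj_by_def of_columns_def mat2_simps wedge_def algebra_simps)
  also have "\<dots> = 0" by (simp add: v wedge_linear)
  finally show ?thesis using that[of "of_columns v u"] u by (simp add: det_of_columns)
qed

text \<open>Trace different from 2 and -2 means that the eigenvalues \<open>a\<close> and
  \<open>inverse a\<close> differ, so their eigenvectors form a basis; exchanging them if necessary
  gives modulus at least 1.\<close>

lemma diagonalize:
  assumes A: "det A = 1" and t: "A $ 1 $ 1 + A $ 2 $ 2 \<noteq> 2" "A $ 1 $ 1 + A $ 2 $ 2 \<noteq> - 2"
  obtains Q a where "det Q = 1" "conj_by Q A = mk_mat a 0 0 (inverse a)"
    "a \<noteq> 1" "a \<noteq> - 1" "1 \<le> cmod a"
proof -
  let ?t = "A $ 1 $ 1 + A $ 2 $ 2"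
  obtain b where b: "b\<^sup>2 - ?t * b + 1 = 0"
    using complex_quadratic_root by blast
  have b0: "b \<noteq> 0" using b by auto
  have bi: "(inverse b)\<^sup>2 - ?t * inverse b + 1 = 0"
    using b b0 by (simp add: field_simps power2_eq_square)
  define a where "a = (if 1 \<le> cmod b then b else inverse b)"
  have a: "a\<^sup>2 - ?t * a + 1 = 0" "(inverse a)\<^sup>2 - ?t * inverse a + 1 = 0"
    using b bi by (auto simp: a_def)
  have "cmod b < 1 \<Longrightarrow> 1 \<le> cmod (inverse b)"
    using b0 by (simp add: norm_inverse one_le_inverse)
  then have a1: "1 \<le> cmod a" unfolding a_def by auto
  then have a0: "a \<noteq> 0" by auto
  have an: "a \<noteq> 1" "a \<noteq> - 1"
  proof -
    show "a \<noteq> 1" using a(1) t(1) by (auto simp: algebra_simps)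
    show "a \<noteq> - 1"
    proof
      assume "a = - 1"
      then have "A $ 1 $ 1 + A $ 2 $ 2 + 2 = 0" using a(1) by (simp add: add.commute)
      then show False using t(2) by (simp add: eq_neg_iff_add_eq_0)
    qed
  qed
  have ai: "a \<noteq> inverse a"
    using a0 an by (auto simp: field_simps square_eq_1_iff)
  obtain v where v: "v \<noteq> 0" "A *v v = a *s v" by (rule eigenvector_exists[OF A a(1)])
  obtain u where u: "u \<noteq> 0" "A *v u = inverse a *s u" by (rule eigenvector_exists[OF A a(2)])
  have "wedge v u \<noteq> 0"
  proof
    assume "wedge v u = 0"
    then have w: "v $ 1 * u $ 2 = v $ 2 * u $ 1" by (simp add: wedge_def)
    have "\<exists>x. u = x *s v"
    proof (cases "v $ 1 = 0")
      case True
      then have "v $ 2 \<noteq> 0" using v by (auto simp: vector2_eq_iff)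
      then show ?thesis using w True
        by (intro exI[of _ "u $ 2 / v $ 2"]) (auto simp: vector2_eq_iff)
    next
      case False
      then show ?thesis using w
        by (intro exI[of _ "u $ 1 / v $ 1"]) (auto simp: vector2_eq_iff field_simps)
    qed
    then obtain x where x: "u = x *s v" by blast
    have "A *v u = x *s (A *v v)" unfolding x by (simp add: vector2_eq_iff mat2_simps algebra_simps)
    also have "\<dots> = a *s u" by (simp add: v x vector2_eq_iff)
    finally have "inverse a *s u = a *s u" using u by simp
    then show False using u ai by (auto simp: vector2_eq_iff)
  qed
  \<comment> \<open>Rescaling the second eigenvector makes the change of basis unimodular.\<close>
  define w where "w = inverse (wedge v u) *s u"
  have w1: "wedge v w = 1" using \<open>wedge v u \<noteq> 0\<close> by (simp add: w_def wedge_linear)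
  have w2: "A *v w = inverse a *s w"
  proof -
    have "A *v w = inverse (wedge v u) *s (A *v u)"
      by (simp add: w_def vector2_eq_iff mat2_simps algebra_simps)
    then show ?thesis by (simp add: u w_def vector2_eq_iff)
  qed
  have "conj_by (of_columns v w) A =
      mk_mat (wedge (A *v v) w) (wedge (A *v w) w) (wedge v (A *v v)) (wedge v (A *v w))"
    by (simp add: matrix2_eq_iff conj_by_def of_columns_def mat2_simps wedge_def algebra_simps)
  also have "\<dots> = mk_mat a 0 0 (inverse a)"
    using w1 by (simp add: v w2 wedge_linear)
  finally show ?thesis using that[of "of_columns v w" a] w1 an a1 by (simp add: det_of_columns)
qed

text \<open>Two powers of \<open>a\<close> are close by compactness; dividing by one of them, which
  preserves distances as it has modulus 1, gives a power close to 1.\<close>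

lemma unit_circle_recurrence:
  assumes "cmod a = 1" "0 < e"
  obtains n where "0 < n" "cmod (a ^ n - 1) < e"
proof -
  have "\<forall>n. a ^ n \<in> cball 0 1" using assms by (simp add: norm_power)
  then obtain l r where r: "strict_mono r" "((\<lambda>n. a ^ n) \<circ> r) \<longlonglongrightarrow> l"
    using compact_cball[of "0::complex" 1] unfolding compact_def by metis
  then have "Cauchy ((\<lambda>n. a ^ n) \<circ> r)" by (auto intro: LIMSEQ_imp_Cauchy)
  then have "\<exists>N. \<forall>m\<ge>N. \<forall>n\<ge>N. cmod (a ^ r m - a ^ r n) < e"
    using assms(2) by (simp add: Cauchy_def dist_norm o_def)
  then obtain N where N: "\<And>m n. m \<ge> N \<Longrightarrow> n \<ge> N \<Longrightarrow> cmod (a ^ r m - a ^ r n) < e"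
    by blast
  have lt: "r N < r (Suc N)" using r(1) by (simp add: strict_mono_def)
  then have "a ^ r (Suc N) = a ^ r N * a ^ (r (Suc N) - r N)"
    by (simp flip: power_add)
  then have "a ^ r (Suc N) - a ^ r N = a ^ r N * (a ^ (r (Suc N) - r N) - 1)"
    by (simp add: algebra_simps)
  then have "cmod (a ^ r (Suc N) - a ^ r N) = cmod (a ^ (r (Suc N) - r N) - 1)"
    using assms(1) by (simp add: norm_mult norm_power)
  then show ?thesis using that[of "r (Suc N) - r N"] lt N[of "Suc N" N] by simp
qed

text \<open>Since \<open>x * x = 1\<close>, the numbers \<open>T\<close>,
  \<open>x * (x * T + u)\<close> and the third one form an arithmetic progression with difference
  \<open>x * u\<close>. Three terms in {2, -2} must be equal, because the mean of 2 and -2 is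
  0.\<close>

lemma progression_in_pm2:
  fixes x T u :: complex
  assumes "x \<in> {1, - 1}" "T \<in> {2, - 2}" "x * T + u \<in> {2, - 2}" "x * (x * T) + 2 * (x * u) \<in> {2, - 2}"
  shows "u = 0"
proof -
  define T' where "T' = x * T + u"
  have u: "u = T' - x * T" by (simp add: T'_def)
  have "x * (x * T) + 2 * (x * u) = 2 * x * T' - x * (x * T)"
    by (simp add: T'_def algebra_simps)
  then show ?thesis using assms unfolding T'_def[symmetric] u by auto
qed

text \<open>Models the full preimage of a torsion-free discrete group in PSL2:
  \<open>- mat 1\<close> belongs to it and has order 2, so torsion is excluded only modulo sign.
  Discreteness is asked at the identity, from where translation carries it to all of
  \<open>D\<close>.\<close>

locale discrete_SL2 =
  fixes D :: "(complex^2^2) set"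
  assumes det_D: "A \<in> D \<Longrightarrow> det A = 1"
    and one_D: "mat 1 \<in> D"
    and mult_D: "A \<in> D \<Longrightarrow> B \<in> D \<Longrightarrow> A ** B \<in> D"
    and adj2_D: "A \<in> D \<Longrightarrow> adj2 A \<in> D"
    and uminus_D: "A \<in> D \<Longrightarrow> - A \<in> D"
    and discrete_D: "\<exists>e>0. \<forall>A\<in>D. mnorm (A - mat 1) < e \<longrightarrow> A = mat 1"
    and torsion_free_D: "A \<in> D \<Longrightarrow> 0 < n \<Longrightarrow> matpow A n \<in> {mat 1, - mat 1} \<Longrightarrow> A \<in> {mat 1, - mat 1}"
begin

text \<open>Permits passing to normal forms: conjugation distorts the distance to the identity at
  most by the square of \<open>mnorm Q\<close>.\<close>

lemma discrete_conj_by: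
  assumes Q: "det Q = 1"
  shows "discrete_SL2 (conj_by Q ` D)"
proof
  obtain e where e: "e > 0" "\<And>A. A \<in> D \<Longrightarrow> mnorm (A - mat 1) < e \<Longrightarrow> A = mat 1"
    using discrete_D by blast
  have m: "1 \<le> mnorm Q" using mnorm_ge_1[OF Q] .
  show "\<exists>e>0. \<forall>A\<in>conj_by Q ` D. mnorm (A - mat 1) < e \<longrightarrow> A = mat 1"
  proof (intro exI[of _ "e / (mnorm Q)\<^sup>2"] conjI ballI impI)
    show "e / (mnorm Q)\<^sup>2 > 0" using e m by simp
    fix A assume "A \<in> conj_by Q ` D" and lt: "mnorm (A - mat 1) < e / (mnorm Q)\<^sup>2"
    then obtain B where B: "B \<in> D" "A = conj_by Q B" by blast
    have "B - mat 1 = conj_by (adj2 Q) (A - mat 1)"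
      using Q by (simp add: B conj_by_diff conj_by_inverse conj_by_mat_1)
    then have "mnorm (B - mat 1) \<le> (mnorm Q)\<^sup>2 * mnorm (A - mat 1)"
      using mnorm_conj_by[of "adj2 Q" "A - mat 1"] by simp
    also have "\<dots> < e" using lt m by (simp add: field_simps)
    finally show "A = mat 1" using e(2)[OF B(1)] B(2) conj_by_mat_1[OF Q] by simp
  qed
next
  fix A n assume "A \<in> conj_by Q ` D" and n: "0 < (n::nat)" "matpow A n \<in> {mat 1, - mat 1}"
  then obtain B where B: "B \<in> D" "A = conj_by Q B" by blast
  have "conj_by Q (matpow B n) \<in> {conj_by Q (mat 1), conj_by Q (- mat 1)}"
    using n(2) by (simp add: B matpow_conj_by[OF Q] conj_by_mat_1[OF Q] conj_by_uminus)
  then have "matpow B n \<in> {mat 1, - mat 1}" by (simp add: conj_by_eq_iff[OF Q])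
  then have "B \<in> {mat 1, - mat 1}" using torsion_free_D B n by blast
  then show "A \<in> {mat 1, - mat 1}" using B by (auto simp: conj_by_mat_1[OF Q] conj_by_uminus)
next
  show "mat 1 \<in> conj_by Q ` D" using one_D conj_by_mat_1[OF Q] by (metis imageI)
qed (use Q in \<open>auto simp: det_conj_by det_D conj_by_mult conj_by_adj2 mult_D adj2_D uminus_D
      simp flip: conj_by_uminus\<close>)

text \<open>The three terms on the right are the absolute values of the coefficients of the quadratic form
  \<open>v \<mapsto> wedge (A *v v) v\<close>. If all were small, \<open>A\<close> would be close to a scalar matrix of determinant 1.\<close>

lemma offscalar_part_bound:
  "\<exists>c>0. \<forall>A\<in>D. A \<notin> {mat 1, - mat 1} \<longrightarrow>
     c * mnorm A \<le> cmod (A $ 1 $ 2) + cmod (A $ 2 $ 1) + cmod (A $ 1 $ 1 - A $ 2 $ 2)"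
proof -
  obtain e0 where e0: "e0 > 0" "\<And>A. A \<in> D \<Longrightarrow> mnorm (A - mat 1) < e0 \<Longrightarrow> A = mat 1"
    using discrete_D by blast
  define e where "e = min e0 1"
  have e: "e > 0" "e \<le> 1" "\<And>A. A \<in> D \<Longrightarrow> mnorm (A - mat 1) < e \<Longrightarrow> A = mat 1"
    using e0 by (auto simp: e_def)
  \<comment> \<open>Small enough that \<open>12 * c < (e / 4)^2\<close>, which puts the diagonal
    entry \<open>x\<close> within \<open>e / 4\<close> of 1 or -1, and that the remaining error
    \<open>6 * c\<close> is below \<open>e / 2\<close>.\<close>
  define c where "c = e\<^sup>2 / 400"
  have c: "c > 0" "c \<le> 1 / 400" using e by (auto simp: c_def power_le_one)
  have key: "A \<in> {mat 1, - mat 1}" if A: "A \<in> D"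
    and lt: "cmod (A $ 1 $ 2) + cmod (A $ 2 $ 1) + cmod (A $ 1 $ 1 - A $ 2 $ 2) < c * mnorm A" for A
  proof -
    define x where "x = A $ 1 $ 1"
    define y where "y = A $ 2 $ 2 - x"
    define b where "b = A $ 1 $ 2"
    define d where "d = A $ 2 $ 1"
    define q where "q = cmod b + cmod d + cmod y"
    have q0: "0 \<le> q" by (simp add: q_def)
    have "cmod (A $ 2 $ 2) \<le> cmod x + cmod y"
      using norm_triangle_ineq[of x y] by (simp add: y_def)
    then have "mnorm A \<le> q + 2 * cmod x"
      by (simp add: mnorm_def q_def x_def b_def d_def)
    moreover have "q < c * mnorm A"
      using lt by (simp add: q_def y_def x_def b_def d_def norm_minus_commute)
    ultimately have "q < c * (q + 2 * cmod x)"
      using c(1) by (smt (verit) mult_left_mono)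
    moreover have "c * q \<le> q / 3" using c q0 mult_right_mono[of c "1/3" q] by simp
    ultimately have q3: "q < 3 * c * cmod x" by (simp add: algebra_simps)
    have "x * (x + y) - b * d = 1"
      using det_D[OF A] by (simp add: det_2 x_def y_def b_def d_def)
    \<comment> \<open>For nearly scalar \<open>A\<close> the determinant condition makes
      \<open>x\<close> almost a square root of 1.\<close>
    then have "x\<^sup>2 - 1 = b * d - x * y" by (simp add: algebra_simps power2_eq_square)
    then have x2: "cmod (x\<^sup>2 - 1) \<le> cmod b * cmod d + cmod x * cmod y"
      by (metis cmod_mult_diff_le)
    have bq: "cmod b \<le> q" "cmod d \<le> q" "cmod y \<le> q" by (auto simp: q_def)
    have "cmod x > 0" using q3 q0 c by (smt (verit) mult_nonneg_nonneg norm_ge_zero zero_less_mult_iff)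
    have "3 * c * cmod x \<le> 1 * cmod x" using c by (intro mult_right_mono) auto
    then have qx: "q \<le> cmod x" using q3 by linarith
    have "cmod b * cmod d \<le> cmod x * q" using bq qx by (intro mult_mono) auto
    moreover have "cmod x * cmod y \<le> cmod x * q" using bq by (intro mult_left_mono) auto
    moreover have "cmod x * q \<le> cmod x * (3 * c * cmod x)" using q3 by (intro mult_left_mono) auto
    ultimately have x3: "cmod (x\<^sup>2 - 1) \<le> 6 * c * (cmod x)\<^sup>2"
      using x2 by (simp add: power2_eq_square algebra_simps)
    have "(cmod x)\<^sup>2 \<le> cmod (x\<^sup>2 - 1) + 1"
      using norm_triangle_ineq[of "x\<^sup>2 - 1" 1] by (simp add: norm_power)
    moreover have "6 * c * (cmod x)\<^sup>2 \<le> (cmod x)\<^sup>2 / 2"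
      using c mult_right_mono[of "6 * c" "1/2" "(cmod x)\<^sup>2"] by simp
    ultimately have x4: "(cmod x)\<^sup>2 \<le> 2" using x3 by linarith
    then have x5: "cmod x \<le> 2" using power2_le_imp_le[of "cmod x" 2] by simp
    have "3 * c * cmod x \<le> 3 * c * 2" using x5 c by (intro mult_left_mono) auto
    then have q6: "q \<le> 6 * c" using q3 by linarith
    have ce: "c \<le> e / 400" using e by (simp add: c_def power2_eq_square mult_left_le)
    have "6 * c * (cmod x)\<^sup>2 \<le> 6 * c * 2" using x4 c by (intro mult_left_mono) auto
    then have "cmod (x\<^sup>2 - 1) \<le> 12 * c" using x3 by linarith
    then have "cmod (x - 1) * cmod (x + 1) \<le> 12 * c"
      by (simp add: power2_eq_square algebra_simps flip: norm_mult)
    also have "\<dots> < (e / 4) * (e / 4)" using e by (simp add: c_def power2_eq_square)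
    finally have "cmod (x - 1) < e / 4 \<or> cmod (x + 1) < e / 4"
      using e by (smt (verit) mult_mono divide_nonneg_nonneg norm_ge_zero)
    then show ?thesis
    proof
      assume x: "cmod (x - 1) < e / 4"
      have "cmod (x + y - 1) \<le> cmod (x - 1) + cmod y"
        using norm_triangle_ineq[of "x - 1" y] by (simp add: algebra_simps)
      then have "mnorm (A - mat 1) \<le> 2 * cmod (x - 1) + q"
        by (simp add: mnorm_def q_def x_def y_def b_def d_def)
      then have "mnorm (A - mat 1) < e" using x q6 ce e by linarith
      then show ?thesis using e(3)[OF A] by simp
    next
      \<comment> \<open>Near -1 the isolation of the identity is applied to \<open>- A\<close>,
        which also lies in \<open>D\<close>.\<close>
      assume x: "cmod (x + 1) < e / 4"
      have "cmod (x + y + 1) \<le> cmod (x + 1) + cmod y"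
        using norm_triangle_ineq[of "x + 1" y] by (simp add: algebra_simps)
      moreover have "cmod (- z - 1) = cmod (z + 1)" for z :: complex
        by (metis minus_diff_minus norm_minus_cancel diff_minus_eq_add uminus_add_conv_diff add.commute)
      ultimately have "mnorm (- A - mat 1) \<le> 2 * cmod (x + 1) + q"
        by (simp add: mnorm_def q_def x_def y_def b_def d_def)
      then have "mnorm (- A - mat 1) < e" using x q6 ce e by linarith
      then have "- A = mat 1" using e(3)[OF uminus_D[OF A]] by simp
      then have "A = - mat 1" by (metis minus_minus)
      then show ?thesis by simp
    qed
  qed
  show ?thesis using c(1) key by (meson linorder_not_le)
qed

lemma matpow_diagonal: "matpow (mk_mat a 0 0 b) n = mk_mat (a ^ n) 0 0 (b ^ n)"
  by (induction n) (auto simp: matrix2_eq_iff mat2_simps)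

lemma matpow_D: "A \<in> D \<Longrightarrow> matpow A n \<in> D"
  by (induction n) (auto simp: one_D mult_D)

text \<open>Powers of a rotation return arbitrarily close to the identity; by discreteness one of
  them equals it, and without torsion the matrix is then central.\<close>

lemma diagonal_not_elliptic:
  assumes "mk_mat a 0 0 (inverse a) \<in> D" "cmod a = 1"
  shows "a = 1 \<or> a = - 1"
proof -
  obtain e where e: "e > 0" "\<And>A. A \<in> D \<Longrightarrow> mnorm (A - mat 1) < e \<Longrightarrow> A = mat 1"
    using discrete_D by blast
  obtain n where n: "0 < n" "cmod (a ^ n - 1) < e / 2"
    using unit_circle_recurrence[OF assms(2), of "e / 2"] e(1) by auto
  have a0: "a \<noteq> 0" using assms by auto
  have "inverse a ^ n - 1 = - (inverse a ^ n * (a ^ n - 1))"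
    using a0 by (simp add: algebra_simps power_inverse)
  then have "cmod (inverse a ^ n - 1) = cmod (inverse a) ^ n * cmod (a ^ n - 1)"
    by (metis norm_minus_cancel norm_mult norm_power)
  then have "cmod (inverse a ^ n - 1) = cmod (a ^ n - 1)"
    using assms(2) by (simp add: norm_inverse)
  then have "mnorm (matpow (mk_mat a 0 0 (inverse a)) n - mat 1) < e"
    using n(2) by (simp add: matpow_diagonal mnorm_def)
  then have "matpow (mk_mat a 0 0 (inverse a)) n = mat 1"
    using e(2) matpow_D[OF assms(1)] by blast
  then have "mk_mat a 0 0 (inverse a) \<in> {mat 1, - mat 1}"
    using torsion_free_D[OF assms(1) n(1)] by simp
  then show ?thesis by (auto simp: matrix2_eq_iff)
qed

text \<open>The traces of \<open>B\<close>, \<open>A B\<close> and \<open>A\<^sup>2 B\<close> form, up to signs, an arithmetic progression in \<open>{2, -2}\<close>.\<close>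

lemma all_unipotent_upper_triangular:
  assumes tr: "\<And>A. A \<in> D \<Longrightarrow> A $ 1 $ 1 + A $ 2 $ 2 \<in> {2, - 2}"
    and A: "A \<in> D" "A $ 2 $ 1 = 0" "A \<notin> {mat 1, - mat 1}" and B: "B \<in> D"
  shows "B $ 2 $ 1 = 0" "B $ 2 $ 2 = B $ 1 $ 1"
proof -
  have dia: "C $ 2 $ 2 = C $ 1 $ 1 \<and> C $ 1 $ 1 \<in> {1, - 1}" if C: "C \<in> D" "C $ 2 $ 1 = 0" for C
  proof -
    let ?a = "C $ 1 $ 1" and ?d = "C $ 2 $ 2"
    have ad: "?a * ?d = 1" using det_D[OF C(1)] C(2) by (simp add: det_2)
    obtain s where s: "s = 1 \<or> s = - 1" "?a + ?d = 2 * s" using tr[OF C(1)] by auto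
    then have d: "?d = 2 * s - ?a" by (simp add: algebra_simps)
    have "s\<^sup>2 = 1" using s by auto
    then have "(?a - s)\<^sup>2 = 0" using ad unfolding d by (simp add: power2_eq_square algebra_simps)
    then have "?a = s" by simp
    then show ?thesis using d s by auto
  qed
  define x b where "x = A $ 1 $ 1" and "b = A $ 1 $ 2"
  have x: "A = mk_mat x b 0 x" "x \<in> {1, - 1}"
    using dia[OF A(1,2)] A(2) by (auto simp: matrix2_eq_iff x_def b_def)
  have b: "b \<noteq> 0" using A(3) x by (auto simp: matrix2_eq_iff)
  have "B $ 2 $ 1 = 0"
  proof -
    let ?T = "B $ 1 $ 1 + B $ 2 $ 2" and ?g = "B $ 2 $ 1"
    have T: "?T \<in> {2, - 2}" using tr[OF B] .
    have T1: "x * ?T + b * ?g \<in> {2, - 2}"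
      using tr[OF mult_D[OF A(1) B]] unfolding x(1) by (simp add: mat2_simps algebra_simps)
    have T2: "x * x * ?T + 2 * x * b * ?g \<in> {2, - 2}"
      using tr[OF mult_D[OF A(1) mult_D[OF A(1) B]]] unfolding x(1) by (simp add: mat2_simps algebra_simps)
    have "b * ?g = 0"
      using progression_in_pm2[OF x(2) T T1] T2 by (simp only: mult.assoc)
    then show ?thesis using b by simp
  qed
  then show "B $ 2 $ 1 = 0" "B $ 2 $ 2 = B $ 1 $ 1" using dia[OF B] by auto
qed

text \<open>A group whose traces are all 2 or -2 becomes, in a basis adapted to one nontrivial
  element, a group of upper triangular matrices with equal diagonal entries, which is commutative.
  So some trace is different, and the eigenvalues of that element cannot have modulus 1.\<close>

lemma loxodromic_exists:
  assumes AB: "A \<in> D" "B \<in> D" "A ** B \<noteq> B ** A"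
  obtains Q a where "det Q = 1" "1 < cmod a" "mk_mat a 0 0 (inverse a) \<in> conj_by Q ` D"
proof (cases "\<forall>A\<in>D. A $ 1 $ 1 + A $ 2 $ 2 \<in> {2, - 2}")
  case True
  obtain Q where Q: "det Q = 1" "conj_by Q A $ 2 $ 1 = 0"
    using triangularize[OF det_D[OF AB(1)]] by blast
  interpret Q: discrete_SL2 "conj_by Q ` D" by (rule discrete_conj_by[OF Q(1)])
  have "A \<notin> {mat 1, - mat 1}" using AB(3) by (auto simp: matrix_neg_mult)
  then have nA: "conj_by Q A \<notin> {mat 1, - mat 1}"
    using conj_by_eq_iff[OF Q(1), of A "mat 1"] conj_by_eq_iff[OF Q(1), of A "- mat 1"]
    by (simp add: conj_by_mat_1[OF Q(1)] conj_by_uminus)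
  have tr: "C $ 1 $ 1 + C $ 2 $ 2 \<in> {2, - 2}" if "C \<in> conj_by Q ` D" for C
    using that True trace_conj_by[OF Q(1)] by auto
  have up: "C $ 2 $ 1 = 0" "C $ 2 $ 2 = C $ 1 $ 1" if "C \<in> conj_by Q ` D" for C
    using Q.all_unipotent_upper_triangular[OF _ imageI[OF AB(1)] Q(2) nA that] tr by blast+
  have "conj_by Q A ** conj_by Q B = conj_by Q B ** conj_by Q A"
    using up[OF imageI[OF AB(1)]] up[OF imageI[OF AB(2)]]
    by (simp add: matrix2_eq_iff mat2_simps algebra_simps)
  then show ?thesis using AB(3) by (simp add: conj_by_mult[OF Q(1)] conj_by_eq_iff[OF Q(1)])
next
  case False
  then obtain C where C: "C \<in> D" "C $ 1 $ 1 + C $ 2 $ 2 \<noteq> 2" "C $ 1 $ 1 + C $ 2 $ 2 \<noteq> - 2"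
    by auto
  obtain Q a where Q: "det Q = 1" "conj_by Q C = mk_mat a 0 0 (inverse a)"
    "a \<noteq> 1" "a \<noteq> - 1" "1 \<le> cmod a"
    using diagonalize[OF det_D[OF C(1)] C(2,3)] by blast
  interpret Q: discrete_SL2 "conj_by Q ` D" by (rule discrete_conj_by[OF Q(1)])
  have in_D: "mk_mat a 0 0 (inverse a) \<in> conj_by Q ` D" using C(1) Q(2) by (metis imageI)
  then have "cmod a \<noteq> 1" using Q.diagonal_not_elliptic Q(3,4) by blast
  then show ?thesis using that[OF Q(1) _ in_D] Q(5) by simp
qed

text \<open>Otherwise the commutator of \<open>B\<close> with the diagonal matrix is a nontrivial unipotent matrix, and
  conjugation by powers of the diagonal matrix contracts it to the identity.\<close>

lemma upper_triangular_diagonal: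
  assumes g: "mk_mat a 0 0 (inverse a) \<in> D" "1 < cmod a" and B: "B \<in> D" "B $ 2 $ 1 = 0"
  shows "B $ 1 $ 2 = 0"
proof -
  have a0: "a \<noteq> 0" using g by auto
  let ?g = "mk_mat a 0 0 (inverse a)"
  define z where "z = B $ 1 $ 1 * B $ 1 $ 2 * (1 - a\<^sup>2)"
  have ad: "B $ 1 $ 1 * B $ 2 $ 2 = 1" using det_D[OF B(1)] B(2) by (simp add: det_2)
  have "B ** ?g ** adj2 B ** adj2 ?g = mk_mat 1 z 0 1"
    using a0 ad B(2)
    by (simp add: matrix2_eq_iff mat2_simps z_def field_simps power2_eq_square)
  then have "mk_mat 1 z 0 1 \<in> D" using B g by (metis mult_D adj2_D)
  then have "mk_mat 1 (z / (a\<^sup>2) ^ n) 0 1 \<in> D" for n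
  proof (induction n)
    case (Suc n)
    have "adj2 ?g ** mk_mat 1 (z / (a\<^sup>2) ^ n) 0 1 ** ?g = mk_mat 1 (z / (a\<^sup>2) ^ Suc n) 0 1"
      using a0 by (simp add: matrix2_eq_iff mat2_simps field_simps power2_eq_square)
    then show ?case using Suc g by (metis mult_D adj2_D)
  qed simp
  moreover obtain e where e: "e > 0" "\<And>A. A \<in> D \<Longrightarrow> mnorm (A - mat 1) < e \<Longrightarrow> A = mat 1"
    using discrete_D by blast
  moreover obtain n where n: "cmod z / e < (cmod (a\<^sup>2)) ^ n"
    using real_arch_pow[of "cmod (a\<^sup>2)"] g(2) by (metis norm_power one_less_power pos2)
  have "cmod (z / (a\<^sup>2) ^ n) < e"
    using n e(1) a0 by (simp add: norm_divide norm_power field_simps)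
  ultimately have "mk_mat 1 (z / (a\<^sup>2) ^ n) 0 1 = mat 1"
    using e(2)[of "mk_mat 1 (z / (a\<^sup>2) ^ n) 0 1"] by (simp add: mnorm_def)
  then have "z = 0" using a0 by (simp add: matrix2_eq_iff)
  moreover have "a\<^sup>2 \<noteq> 1" using g(2) by (auto simp: power2_eq_1_iff)
  ultimately show ?thesis using ad by (auto simp: z_def)
qed

text \<open>Conjugation by \<open>?J\<close> swaps the axes: it exchanges upper and lower triangular
  matrices and carries the inverse of the diagonal matrix to the matrix itself.\<close>

lemma lower_triangular_diagonal:
  assumes g: "mk_mat a 0 0 (inverse a) \<in> D" "1 < cmod a" and B: "B \<in> D" "B $ 1 $ 2 = 0"
  shows "B $ 2 $ 1 = 0"
proof -
  let ?J = "mk_mat 0 1 (- 1) 0"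
  have J: "det ?J = 1" by (simp add: det_2)
  interpret J: discrete_SL2 "conj_by ?J ` D" by (rule discrete_conj_by[OF J])
  have "conj_by ?J (adj2 (mk_mat a 0 0 (inverse a))) = mk_mat a 0 0 (inverse a)"
    by (simp add: conj_by_def matrix2_eq_iff mat2_simps)
  then have "mk_mat a 0 0 (inverse a) \<in> conj_by ?J ` D" using adj2_D[OF g(1)] by (metis imageI)
  moreover have "conj_by ?J B $ 2 $ 1 = - (B $ 1 $ 2)" "conj_by ?J B $ 1 $ 2 = - (B $ 2 $ 1)"
    by (simp_all add: conj_by_def mat2_simps)
  ultimately show ?thesis
    using J.upper_triangular_diagonal[OF _ g(2), of "conj_by ?J B"] B by simp
qed

text \<open>By the previous lemmas the only remaining possibility is an antidiagonal matrix, whose square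
  is \<open>-1\<close>; this is excluded because there is no torsion.\<close>

lemma nondiagonal_entries_nonzero:
  assumes g: "mk_mat a 0 0 (inverse a) \<in> D" "1 < cmod a"
    and B: "B \<in> D" "B $ 1 $ 2 \<noteq> 0 \<or> B $ 2 $ 1 \<noteq> 0"
  shows "B $ 1 $ 1 \<noteq> 0" "B $ 1 $ 2 \<noteq> 0" "B $ 2 $ 1 \<noteq> 0" "B $ 2 $ 2 \<noteq> 0"
proof -
  have a0: "a \<noteq> 0" "a\<^sup>2 \<noteq> 1" using g by (auto simp: power2_eq_1_iff)
  let ?g = "mk_mat a 0 0 (inverse a)"
  have nz: "C $ 1 $ 1 \<noteq> 0" if C: "C \<in> D" "C $ 1 $ 2 \<noteq> 0" "C $ 2 $ 1 \<noteq> 0" for C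
  proof
    assume 0: "C $ 1 $ 1 = 0"
    have "- (C $ 1 $ 2 * C $ 2 $ 1) = 1" using det_D[OF C(1)] 0 by (simp add: det_2)
    then have bc: "C $ 1 $ 2 * C $ 2 $ 1 = - 1" by (metis minus_minus)
    \<comment> \<open>\<open>C\<close> sends the first axis to the second, so the conjugate of
      \<open>?g\<close> shares a fixed direction with \<open>?g\<close> and must be
      diagonal.\<close>
    have "C ** ?g ** adj2 C \<in> D" using C g by (metis mult_D adj2_D)
    moreover have "(C ** ?g ** adj2 C) $ 1 $ 2 = 0" by (simp add: mat2_simps 0)
    ultimately have "(C ** ?g ** adj2 C) $ 2 $ 1 = 0" by (rule lower_triangular_diagonal[OF g])
    then have "C $ 2 $ 1 * C $ 2 $ 2 * (a\<^sup>2 - 1) = 0"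
      using a0 by (simp add: mat2_simps 0 field_simps power2_eq_square)
    then have "C $ 2 $ 2 = 0" using C a0 by auto
    then have "matpow C 2 = - mat 1"
      using bc 0 by (simp add: numeral_2_eq_2 matrix2_eq_iff mat2_simps algebra_simps)
    then have "C \<in> {mat 1, - mat 1}" using torsion_free_D[OF C(1), of 2] by simp
    then show False using 0 by (auto simp: matrix2_eq_iff)
  qed
  show 12: "B $ 1 $ 2 \<noteq> 0" "B $ 2 $ 1 \<noteq> 0"
    using upper_triangular_diagonal[OF g B(1)] lower_triangular_diagonal[OF g B(1)] B(2) by auto
  show "B $ 1 $ 1 \<noteq> 0" using nz[OF B(1) 12] .
  \<comment> \<open>The inverse has this entry in its upper left corner.\<close>
  show "B $ 2 $ 2 \<noteq> 0" using nz[OF adj2_D[OF B(1)]] 12 by simp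
qed

end

text \<open>\<open>wedge v R\<close> and \<open>wedge P v\<close> are the coordinates of
  \<open>v\<close> in the basis \<open>P\<close>, \<open>R\<close>, so the formula says that
  \<open>A\<close> is diagonal there with entries \<open>\<mu>\<close> and
  \<open>inverse \<mu>\<close>.\<close>

definition hyperbolic_on :: "complex^2^2 \<Rightarrow> complex \<Rightarrow> complex^2 \<Rightarrow> complex^2 \<Rightarrow> bool" where
  "hyperbolic_on A \<mu> P R \<longleftrightarrow> wedge P R = 1 \<and>
     (\<forall>v. A *v v = (\<mu> * wedge v R) *s P + (inverse \<mu> * wedge P v) *s R)"

lemma hyperbolic_onI:
  assumes "wedge P R = 1" "A *v P = \<mu> *s P" "A *v R = inverse \<mu> *s R"
  shows "hyperbolic_on A \<mu> P R"
  unfolding hyperbolic_on_def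
proof (intro conjI allI)
  fix v
  have "A *v v = A *v (wedge v R *s P + wedge P v *s R)"
    using wedge_decompose[OF assms(1), of v] by simp
  also have "\<dots> = wedge v R *s (A *v P) + wedge P v *s (A *v R)"
    by (simp add: vector2_eq_iff mat2_simps algebra_simps)
  finally show "A *v v = (\<mu> * wedge v R) *s P + (inverse \<mu> * wedge P v) *s R"
    by (simp add: assms vector2_eq_iff algebra_simps)
qed (rule assms)

lemma hyperbolic_onD:
  assumes "hyperbolic_on A \<mu> P R"
  shows "wedge P R = 1" "A *v P = \<mu> *s P" "A *v R = inverse \<mu> *s R"
  using assms unfolding hyperbolic_on_def by simp_all

text \<open>If every element were diagonal in the eigenbasis of \<open>g\<close>, the group would be
  commutative. A nondiagonal \<open>k\<close> has four nonzero entries there, and up to sign these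
  entries are the four pairings.\<close>

theorem (in discrete_SL2) independent_loxodromic_exists:
  assumes AB: "A \<in> D" "B \<in> D" "A ** B \<noteq> B ** A"
  obtains g k \<mu> P R where "g \<in> D" "k \<in> D" "1 < cmod \<mu>" "hyperbolic_on g \<mu> P R"
    "wedge (k *v P) P \<noteq> 0" "wedge (k *v P) R \<noteq> 0" "wedge (k *v R) P \<noteq> 0" "wedge (k *v R) R \<noteq> 0"
proof -
  obtain Q a where Q: "det Q = 1" "1 < cmod a" "mk_mat a 0 0 (inverse a) \<in> conj_by Q ` D"
    using loxodromic_exists[OF AB] by blast
  interpret Q: discrete_SL2 "conj_by Q ` D" by (rule discrete_conj_by[OF Q(1)])
  obtain g where g: "g \<in> D" "conj_by Q g = mk_mat a 0 0 (inverse a)" using Q(3) by auto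
  have "\<exists>k\<in>D. conj_by Q k $ 1 $ 2 \<noteq> 0 \<or> conj_by Q k $ 2 $ 1 \<noteq> 0"
  proof (rule ccontr)
    assume "\<not> ?thesis"
    then have "conj_by Q A ** conj_by Q B = conj_by Q B ** conj_by Q A"
      using AB(1,2) by (simp add: matrix2_eq_iff mat2_simps algebra_simps)
    then show False using AB(3) by (simp add: conj_by_mult[OF Q(1)] conj_by_eq_iff[OF Q(1)])
  qed
  then obtain k where k: "k \<in> D" "conj_by Q k $ 1 $ 2 \<noteq> 0 \<or> conj_by Q k $ 2 $ 1 \<noteq> 0" by blast
  note nz = Q.nondiagonal_entries_nonzero[OF Q(3) Q(2) imageI[OF k(1)] k(2)]
  define P R :: "complex^2" where "P = (\<chi> i. Q $ i $ 1)" and "R = (\<chi> i. Q $ i $ 2)"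
  have ent: "conj_by Q C $ 1 $ 1 = wedge (C *v P) R" "conj_by Q C $ 1 $ 2 = wedge (C *v R) R"
    "conj_by Q C $ 2 $ 1 = - wedge (C *v P) P" "conj_by Q C $ 2 $ 2 = - wedge (C *v R) P" for C
    by (simp_all add: conj_by_def mat2_simps wedge_def P_def R_def algebra_simps)
  have 1: "wedge P R = 1" using Q(1) by (simp add: wedge_def P_def R_def det_2 algebra_simps)
  have "g *v P = a *s P" "g *v R = inverse a *s R"
    using wedge_decompose[OF 1, of "g *v P"] wedge_decompose[OF 1, of "g *v R"] ent[of g] g(2)
      wedge_commute[of P]
    by simp_all
  then have "hyperbolic_on g a P R" using 1 by (rule hyperbolic_onI[rotated])
  then show ?thesis using that[OF g(1) k(1) Q(2)] nz ent[of k] by simp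
qed

section \<open>Ping-pong\<close>

text \<open>A cone around the direction of \<open>P\<close>. The coordinate \<open>c\<close> is kept
  as an argument because the final contradiction comes from its size.\<close>

definition near :: "real \<Rightarrow> complex^2 \<Rightarrow> complex^2 \<Rightarrow> complex \<Rightarrow> bool" where
  "near \<eta> P v c \<longleftrightarrow> vnorm (v - c *s P) \<le> \<eta> * cmod c"

text \<open>The model is the rank one map with image spanned by \<open>P\<close> and kernel spanned
  by \<open>R\<close>, so \<open>R\<close> is the repelling direction.\<close>

definition almost_rank_one :: "complex^2^2 \<Rightarrow> complex \<Rightarrow> complex^2 \<Rightarrow> complex^2 \<Rightarrow> real \<Rightarrow> bool" where
  "almost_rank_one A x P R \<tau> \<longleftrightarrow> (\<forall>v. vnorm (A *v v - (x * wedge v R) *s P) \<le> \<tau> * vnorm v)"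

text \<open>\<open>B\<close> keeps \<open>P\<close> away from the repelling direction
  \<open>R\<close>, so half of the pairing survives the error of \<open>v\<close>, and
  \<open>A\<close> turns it into a multiple of \<open>P'\<close>. The last bound lets the gain of
  \<open>A\<close> absorb its own error, so the cone does not widen.\<close>

lemma near_step:
  assumes v: "near \<eta> P v c" and A: "almost_rank_one A x P' R \<tau>"
    and B: "\<delta> * mnorm B \<le> cmod (wedge (B *v P) R)"
    and bd: "vnorm P \<le> \<rho>" "vnorm R \<le> \<rho>" "0 \<le> \<eta>" "0 \<le> \<tau>" "\<eta> * \<rho> \<le> \<delta> / 2"
      "\<tau> * (\<rho> + \<eta>) \<le> \<eta> * (cmod x * \<delta> / 2)"
  shows "\<exists>c'. near \<eta> P' (A *v (B *v v)) c' \<and> cmod x * \<delta> / 2 * mnorm B * cmod c \<le> cmod c'"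
proof (intro exI conjI)
  let ?c' = "x * wedge (B *v v) R"
  define e where "e = v - c *s P"
  have v_eq: "v = c *s P + e" by (simp add: e_def)
  have e: "vnorm e \<le> \<eta> * cmod c" using v by (simp add: near_def e_def)
  have Bv: "B *v v = c *s (B *v P) + B *v e"
    by (simp add: v_eq vector2_eq_iff mat2_simps algebra_simps)
  have 1: "cmod (wedge (B *v e) R) \<le> mnorm B * cmod c * (\<delta> / 2)"
  proof -
    have "cmod (wedge (B *v e) R) \<le> vnorm (B *v e) * vnorm R" by (rule cmod_wedge_le)
    also have "\<dots> \<le> (mnorm B * (\<eta> * cmod c)) * \<rho>"
      using bd e by (intro mult_mono order_trans[OF vnorm_matrix_vector_mult] mult_left_mono) auto
    also have "\<dots> = mnorm B * cmod c * (\<eta> * \<rho>)" by simp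
    also have "\<dots> \<le> mnorm B * cmod c * (\<delta> / 2)" using bd by (intro mult_left_mono) auto
    finally show ?thesis .
  qed
  have "cmod c * (\<delta> * mnorm B) \<le> cmod (c * wedge (B *v P) R)"
    using B by (simp add: norm_mult mult_left_mono)
  also have "\<dots> \<le> cmod (wedge (B *v v) R) + cmod (wedge (B *v e) R)"
  proof -
    have "c * wedge (B *v P) R = wedge (B *v v) R - wedge (B *v e) R"
      by (simp add: Bv wedge_linear)
    then show ?thesis by (metis norm_triangle_ineq4)
  qed
  finally have 2: "mnorm B * cmod c * (\<delta> / 2) \<le> cmod (wedge (B *v v) R)"
    using 1 by (simp add: algebra_simps)
  have "cmod x * (mnorm B * cmod c * (\<delta> / 2)) \<le> cmod ?c'"
    unfolding norm_mult by (rule mult_left_mono[OF 2 norm_ge_zero])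
  then show 3: "cmod x * \<delta> / 2 * mnorm B * cmod c \<le> cmod ?c'" by (simp add: algebra_simps)
  have "vnorm v \<le> cmod c * \<rho> + \<eta> * cmod c"
    using vnorm_add[of "c *s P" e] e mult_left_mono[OF bd(1), of "cmod c"]
    by (simp add: v_eq vnorm_scale)
  then have "vnorm v \<le> cmod c * (\<rho> + \<eta>)" by (simp add: algebra_simps)
  then have "vnorm (B *v v) \<le> mnorm B * (cmod c * (\<rho> + \<eta>))"
    by (intro order_trans[OF vnorm_matrix_vector_mult] mult_left_mono) auto
  then have "\<tau> * vnorm (B *v v) \<le> \<tau> * (mnorm B * (cmod c * (\<rho> + \<eta>)))"
    using bd by (intro mult_left_mono) auto
  also have "\<dots> = mnorm B * cmod c * (\<tau> * (\<rho> + \<eta>))" by simp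
  also have "\<dots> \<le> mnorm B * cmod c * (\<eta> * (cmod x * \<delta> / 2))"
    using bd by (intro mult_left_mono) auto
  also have "\<dots> = \<eta> * (cmod x * \<delta> / 2 * mnorm B * cmod c)" by simp
  also have "\<dots> \<le> \<eta> * cmod ?c'" using 3 bd by (intro mult_left_mono) auto
  finally have "\<tau> * vnorm (B *v v) \<le> \<eta> * cmod ?c'" .
  then show "near \<eta> P' (A *v (B *v v)) ?c'"
    using A unfolding near_def almost_rank_one_def by (meson order_trans)
qed

text \<open>Bilinearity: relative to the product of the coordinates, the mixed terms cost
  \<open>2 * \<eta> * \<rho>\<close> and the product of the errors \<open>\<eta>^2\<close>.\<close>

lemma near_wedge:
  assumes "near \<eta> P v c" "near \<eta> P' v' c'" "vnorm P \<le> \<rho>" "vnorm P' \<le> \<rho>" "0 \<le> \<eta>"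
    and "2 * \<eta> * \<rho> + \<eta>\<^sup>2 \<le> \<delta>" "2 * \<delta> \<le> cmod (wedge P P')"
  shows "\<delta> * (cmod c * cmod c') \<le> cmod (wedge v v')"
proof -
  define e e' where "e = v - c *s P" and "e' = v' - c' *s P'"
  have v: "v = c *s P + e" "v' = c' *s P' + e'" by (simp_all add: e_def e'_def)
  have e: "vnorm e \<le> \<eta> * cmod c" "vnorm e' \<le> \<eta> * cmod c'"
    using assms(1,2) by (simp_all add: near_def e_def e'_def)
  have \<rho>: "0 \<le> \<rho>" using assms(3) vnorm_nonneg[of P] by linarith
  let ?r = "wedge (c *s P) e' + wedge e (c' *s P') + wedge e e'"
  have w: "c * c' * wedge P P' = wedge v v' - ?r"
    by (simp add: v wedge_linear algebra_simps)
  have "cmod ?r \<le> cmod (wedge (c *s P) e') + cmod (wedge e (c' *s P')) + cmod (wedge e e')"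
    by (intro order_trans[OF norm_triangle_ineq] add_right_mono norm_triangle_ineq)
  also have "\<dots> \<le> (cmod c * \<rho>) * (\<eta> * cmod c') + (\<eta> * cmod c) * (cmod c' * \<rho>) + (\<eta> * cmod c) * (\<eta> * cmod c')"
    using assms(3-5) e \<rho>
    by (intro add_mono order_trans[OF cmod_wedge_le] mult_mono) (auto simp: vnorm_scale mult_left_mono)
  also have "\<dots> = (2 * \<eta> * \<rho> + \<eta>\<^sup>2) * (cmod c * cmod c')"
    by (simp add: algebra_simps power2_eq_square)
  also have "\<dots> \<le> \<delta> * (cmod c * cmod c')" using assms by (intro mult_right_mono) auto
  finally have r: "cmod ?r \<le> \<delta> * (cmod c * cmod c')" .
  have "2 * \<delta> * (cmod c * cmod c') \<le> cmod (wedge P P') * (cmod c * cmod c')"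
    using assms by (intro mult_right_mono) auto
  also have "\<dots> = cmod (c * c' * wedge P P')" by (simp add: norm_mult)
  also have "\<dots> \<le> cmod (wedge v v') + cmod ?r" unfolding w by (rule norm_triangle_ineq4)
  finally show ?thesis using r by linarith
qed

section \<open>Powers, inverses and products of hyperbolic matrices\<close>

lemma hyperbolic_on_matpow:
  assumes "hyperbolic_on A \<mu> P R"
  shows "hyperbolic_on (matpow A n) (\<mu> ^ n) P R"
proof (rule hyperbolic_onI)
  note h = hyperbolic_onD[OF assms]
  show "wedge P R = 1" by (rule h)
  show "matpow A n *v P = \<mu> ^ n *s P"
  proof (induction n)
    case (Suc n)
    have "matpow A (Suc n) *v P = A *v (\<mu> ^ n *s P)"
      using Suc by (simp add: matrix_vector_mul_assoc[symmetric])
    also have "\<dots> = \<mu> ^ n *s (A *v P)" by (simp add: vector2_eq_iff mat2_simps algebra_simps)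
    finally show ?case by (simp add: h)
  qed simp
  show "matpow A n *v R = inverse (\<mu> ^ n) *s R"
  proof (induction n)
    case (Suc n)
    have "matpow A (Suc n) *v R = A *v (inverse (\<mu> ^ n) *s R)"
      using Suc by (simp add: matrix_vector_mul_assoc[symmetric])
    also have "\<dots> = inverse (\<mu> ^ n) *s (A *v R)" by (simp add: vector2_eq_iff mat2_simps algebra_simps)
    finally show ?case by (simp add: h vector2_eq_iff)
  qed simp
qed

text \<open>The inverse exchanges the two eigendirections; the sign keeps the determinant of the
  basis equal to 1.\<close>

lemma hyperbolic_on_adj2:
  assumes "hyperbolic_on A \<mu> P R" "det A = 1" "\<mu> \<noteq> 0"
  shows "hyperbolic_on (adj2 A) \<mu> R (- P)"
proof (rule hyperbolic_onI)
  note h = hyperbolic_onD[OF assms(1)]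
  show "wedge R (- P) = 1" using h(1) by (simp add: wedge_def algebra_simps)
  have *: "adj2 A *v v = inverse x *s v" if "A *v v = x *s v" "x \<noteq> 0" for v x
  proof -
    have "v = adj2 A *v (A *v v)" by (simp add: matrix_vector_mul_assoc adj2_mult assms)
    also have "\<dots> = x *s (adj2 A *v v)"
      unfolding that by (simp add: vector2_eq_iff mat2_simps algebra_simps)
    finally have "inverse x *s v = inverse x *s (x *s (adj2 A *v v))" by simp
    then show ?thesis using that by (simp add: vector2_eq_iff)
  qed
  show "adj2 A *v R = \<mu> *s R" using *[OF h(3)] assms by simp
  have "adj2 A *v P = inverse \<mu> *s P" using *[OF h(2)] assms by simp
  then show "adj2 A *v (- P) = inverse \<mu> *s (- P)"
    by (simp add: vector2_eq_iff mat2_simps) (simp add: algebra_simps)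
qed

text \<open>Different factors on the two sides move the attracting direction by \<open>U\<close> and
  the repelling one by \<open>U'\<close> independently. The error is the component with eigenvalue
  \<open>inverse x\<close>.\<close>

lemma hyperbolic_on_sandwich:
  assumes "hyperbolic_on A x P R" "det U' = 1"
  shows "almost_rank_one (U ** A ** adj2 U') x (U *v P) (U' *v R)
     (vnorm (U' *v P) * vnorm (U *v R) / cmod x)"
  unfolding almost_rank_one_def
proof
  fix v
  let ?w = "adj2 U' *v v"
  have w: "wedge ?w R = wedge v (U' *v R)" "wedge P ?w = wedge (U' *v P) v"
    by (simp_all add: wedge_matrix_adj2)
  have "(U ** A ** adj2 U') *v v = U *v (A *v ?w)"
    by (simp add: matrix_vector_mul_assoc matrix_mul_assoc)
  also have "A *v ?w = (x * wedge ?w R) *s P + (inverse x * wedge P ?w) *s R"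
    using assms(1) by (simp add: hyperbolic_on_def)
  finally have "(U ** A ** adj2 U') *v v - (x * wedge v (U' *v R)) *s (U *v P)
      = (inverse x * wedge (U' *v P) v) *s (U *v R)"
    by (simp add: w vector2_eq_iff mat2_simps algebra_simps)
  then have "vnorm ((U ** A ** adj2 U') *v v - (x * wedge v (U' *v R)) *s (U *v P))
     = inverse (cmod x) * cmod (wedge (U' *v P) v) * vnorm (U *v R)"
    by (simp add: vnorm_scale norm_mult norm_inverse)
  also have "\<dots> \<le> inverse (cmod x) * (vnorm (U' *v P) * vnorm v) * vnorm (U *v R)"
    by (intro mult_right_mono mult_left_mono cmod_wedge_le) auto
  finally show "vnorm ((U ** A ** adj2 U') *v v - (x * wedge v (U' *v R)) *s (U *v P))
     \<le> vnorm (U' *v P) * vnorm (U *v R) / cmod x * vnorm v"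
    by (simp add: field_simps)
qed

section \<open>Positive words in two matrices and the separation of their images\<close>

definition word_mat :: "complex^2^2 \<Rightarrow> complex^2^2 \<Rightarrow> bool list \<Rightarrow> complex^2^2" where
  "word_mat s t bs = foldr (\<lambda>b M. (if b then t else s) ** M) bs (mat 1)"

lemma word_mat_simps [simp]:
  "word_mat s t [] = mat 1" "word_mat s t (b # bs) = (if b then t else s) ** word_mat s t bs"
  by (simp_all add: word_mat_def)

lemma word_mat_append: "word_mat s t (bs @ bs') = word_mat s t bs ** word_mat s t bs'"
  by (induction bs) (auto simp: matrix_mul_assoc)

lemma word_mat_replicate: "word_mat s t (replicate n False) = matpow s n"
  by (induction n) auto

lemma adj2_word_mat: "adj2 (word_mat s t bs) = word_mat (adj2 s) (adj2 t) (rev bs)"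
  by (induction bs) (auto simp: adj2_matrix_mult word_mat_append)

lemma det_word_mat: "det s = 1 \<Longrightarrow> det t = 1 \<Longrightarrow> det (word_mat s t bs) = 1"
  by (induction bs) (auto simp: det_mul)

lemma vnorm_word_mat:
  "vnorm (word_mat s t bs *v v) \<le> (mnorm s + mnorm t) ^ length bs * vnorm v"
proof (induction bs)
  case (Cons b bs)
  let ?w = "word_mat s t bs *v v"
  have "vnorm (word_mat s t (b # bs) *v v) = vnorm ((if b then t else s) *v ?w)"
    by (simp add: matrix_vector_mul_assoc)
  also have "\<dots> \<le> mnorm (if b then t else s) * vnorm ?w" by (rule vnorm_matrix_vector_mult)
  also have "\<dots> \<le> (mnorm s + mnorm t) * ((mnorm s + mnorm t) ^ length bs * vnorm v)"
    using Cons by (intro mult_mono) auto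
  finally show ?case by (simp add: mult.assoc)
qed simp

text \<open>The vectors are not normalized: \<open>\<sigma>\<close> is independent of the length,
  and angles decay only through the growth of the norms.\<close>

definition separated_words :: "complex^2^2 \<Rightarrow> complex^2^2 \<Rightarrow> complex^2 \<Rightarrow> real \<Rightarrow> bool" where
  "separated_words s t P \<sigma> \<longleftrightarrow> (\<forall>bs bs'. length bs = length bs' \<longrightarrow> bs \<noteq> bs' \<longrightarrow>
     \<sigma> \<le> cmod (wedge (word_mat s t bs *v P) (word_mat s t bs' *v P)))"

lemma list_common_prefix:
  assumes "length xs = length ys" "xs \<noteq> ys"
  shows "\<exists>zs x xs' y ys'. xs = zs @ x # xs' \<and> ys = zs @ y # ys' \<and> x \<noteq> y"
  using assms
proof (induction xs ys rule: list_induct2)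
  case (Cons x xs y ys)
  show ?case
  proof (cases "x = y")
    case True
    then have "xs \<noteq> ys" using Cons.prems by simp
    then obtain zs x' xs' y' ys' where "xs = zs @ x' # xs'" "ys = zs @ y' # ys'" "x' \<noteq> y'"
      using Cons.IH by blast
    then show ?thesis using True by (metis append_Cons)
  next
    case False
    then show ?thesis by (metis append_Nil)
  qed
qed simp

text \<open>A common prefix has determinant 1 and drops out of the pairing. After it the words start
  with different letters, so the vectors lie in the cones around \<open>p False\<close> and
  \<open>p True\<close>, with coordinates of modulus at least 1.\<close>

lemma separated_wordsI:
  fixes s t :: "complex^2^2" and p r :: "bool \<Rightarrow> complex^2"
  assumes det: "det s = 1" "det t = 1"
    and A: "\<And>b. almost_rank_one (if b then t else s) x (p b) (r b) \<tau>"
    and bd: "\<And>b. vnorm (p b) \<le> \<rho>" "\<And>b. vnorm (r b) \<le> \<rho>" "0 \<le> \<eta>" "0 \<le> \<tau>" "\<eta> * \<rho> \<le> \<delta> / 2"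
      "2 * \<eta> * \<rho> + \<eta>\<^sup>2 \<le> \<delta>" "\<tau> * (\<rho> + \<eta>) \<le> \<eta> * (cmod x * \<delta> / 2)" "1 \<le> cmod x * \<delta> / 2" "0 \<le> \<delta>"
    and w: "\<And>b b'. 2 * \<delta> \<le> cmod (wedge (p b) (r b'))" "2 * \<delta> \<le> cmod (wedge (p False) (p True))"
  shows "separated_words s t (p False) \<delta>"
proof -
  have step: "\<exists>c'. near \<eta> (p b) ((if b then t else s) *v v) c' \<and> 1 \<le> cmod c'"
    if v: "near \<eta> (p b') v c" "1 \<le> cmod c" for b b' v c
  proof -
    \<comment> \<open>No coefficient stands between two letters, so \<open>B\<close> is the
      identity, whose norm is 2; hence the factor 2 in the hypotheses on the pairings.\<close>
    obtain c' where c': "near \<eta> (p b) ((if b then t else s) *v (mat 1 *v v)) c'"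
      "cmod x * \<delta> / 2 * mnorm (mat 1) * cmod c \<le> cmod c'"
      using near_step[OF v(1) A[of b], of \<delta> "mat 1" \<rho>] bd w(1)[of b' b] by auto
    have "1 * 2 * 1 \<le> cmod x * \<delta> / 2 * mnorm (mat 1) * cmod c"
      using bd(8) v(2) by (intro mult_mono) auto
    then show ?thesis using c' by (intro exI[of _ c']) auto
  qed
  have word: "word_mat s t (b # bs) *v v = (if b then t else s) *v (word_mat s t bs *v v)" for b bs v
    by (simp add: matrix_vector_mul_assoc)
  have ex: "\<exists>b c. near \<eta> (p b) (word_mat s t bs *v p False) c \<and> 1 \<le> cmod c" for bs
  proof (induction bs)
    case Nil
    show ?case using bd(3) by (intro exI[of _ False] exI[of _ 1]) (simp add: near_def vnorm_def)
  next
    case (Cons b bs)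
    then show ?case using step unfolding word by blast
  qed
  have Cons: "\<exists>c. near \<eta> (p b) (word_mat s t (b # bs) *v p False) c \<and> 1 \<le> cmod c" for b bs
    using ex[of bs] step unfolding word by blast
  have main: "\<delta> \<le> cmod (wedge (word_mat s t (False # bs) *v p False) (word_mat s t (True # bs') *v p False))"
    for bs bs'
  proof -
    obtain c c' where c: "near \<eta> (p False) (word_mat s t (False # bs) *v p False) c" "1 \<le> cmod c"
      "near \<eta> (p True) (word_mat s t (True # bs') *v p False) c'" "1 \<le> cmod c'"
      using Cons[of False bs] Cons[of True bs'] by blast
    have "\<delta> * (cmod c * cmod c') \<le> cmod (wedge (word_mat s t (False # bs) *v p False) (word_mat s t (True # bs') *v p False))"
      by (rule near_wedge[OF c(1,3) bd(1) bd(1) bd(3) bd(6) w(2)])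
    moreover have "\<delta> * (1 * 1) \<le> \<delta> * (cmod c * cmod c')"
      using c bd(9) by (intro mult_left_mono mult_mono) auto
    ultimately show ?thesis by simp
  qed
  show ?thesis unfolding separated_words_def
  proof (intro allI impI)
    fix bs bs' :: "bool list" assume "length bs = length bs'" "bs \<noteq> bs'"
    then obtain zs b xs b' ys where *: "bs = zs @ b # xs" "bs' = zs @ b' # ys" "b \<noteq> b'"
      using list_common_prefix by blast
    have "wedge (word_mat s t bs *v p False) (word_mat s t bs' *v p False) =
       wedge (word_mat s t (b # xs) *v p False) (word_mat s t (b' # ys) *v p False)"
      unfolding * word_mat_append matrix_vector_mul_assoc[symmetric]
      by (rule wedge_matrix_mult[OF det_word_mat[OF det]])
    moreover have "\<delta> \<le> cmod (wedge (word_mat s t (b # xs) *v p False) (word_mat s t (b' # ys) *v p False))"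
      using main[of xs ys] main[of ys xs] *(3) cmod_wedge_commute by (cases b; cases b') metis+
    ultimately show "\<delta> \<le> cmod (wedge (word_mat s t bs *v p False) (word_mat s t bs' *v p False))"
      by simp
  qed
qed

text \<open>\<open>k\<close> carries the eigendirections of \<open>s\<close> to those of its
  conjugate. Transversality depends on \<open>P\<close>, \<open>R\<close> and \<open>k\<close>
  alone, so a large eigenvalue is all that is asked of \<open>s\<close>.\<close>

lemma separated_words_hyperbolic:
  assumes P: "wedge P R = 1" and k: "det k = 1"
    "wedge (k *v P) P \<noteq> 0" "wedge (k *v P) R \<noteq> 0" "wedge (k *v R) P \<noteq> 0"
  shows "\<exists>\<sigma>>0. \<exists>K. \<forall>s x. det s = 1 \<longrightarrow> hyperbolic_on s x P R \<longrightarrow> K < cmod x \<longrightarrow>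
     separated_words s (k ** s ** adj2 k) P \<sigma>"
proof -
  define p r where "p b = (if b then k *v P else P)" and "r b = (if b then k *v R else R)" for b
  \<comment> \<open>Half of the least pairing; the entry 1 stands for \<open>wedge P R\<close> and
    for \<open>wedge (k *v P) (k *v R)\<close>.\<close>
  define \<delta> where "\<delta> = Min {1, cmod (wedge (k *v P) P), cmod (wedge (k *v P) R), cmod (wedge (k *v R) P)} / 2"
  have d: "0 < \<delta>" "2 * \<delta> \<le> 1" "2 * \<delta> \<le> cmod (wedge (k *v P) P)" "2 * \<delta> \<le> cmod (wedge (k *v P) R)"
    "2 * \<delta> \<le> cmod (wedge (k *v R) P)"
    using k by (auto simp: \<delta>_def)
  define \<rho> where "\<rho> = 1 + vnorm P + vnorm R + vnorm (k *v P) + vnorm (k *v R)"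
  have \<rho>: "1 \<le> \<rho>" "vnorm (p b) \<le> \<rho>" "vnorm (r b) \<le> \<rho>" for b by (auto simp: \<rho>_def p_def r_def)
  define \<eta> where "\<eta> = \<delta> / (4 * \<rho>)"
  have \<eta>: "0 < \<eta>" "\<eta> * \<rho> = \<delta> / 4" using d \<rho> by (auto simp: \<eta>_def)
  have "\<eta> \<le> \<eta> * \<rho>" using \<eta>(1) \<rho>(1) by simp
  then have "\<eta>\<^sup>2 \<le> (\<delta> / 4) * 1" unfolding power2_eq_square using \<eta> d by (intro mult_mono) auto
  then have \<eta>2: "2 * \<eta> * \<rho> + \<eta>\<^sup>2 \<le> \<delta>" using \<eta> d by simp
  have w: "2 * \<delta> \<le> cmod (wedge (p b) (r b'))" for b b'
    using d P wedge_matrix_mult[OF k(1), of P R] cmod_wedge_commute[of P "k *v R"]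
    by (auto simp: p_def r_def)
  have w': "2 * \<delta> \<le> cmod (wedge (p False) (p True))"
    using d cmod_wedge_commute[of P "k *v P"] by (auto simp: p_def)
  \<comment> \<open>The summands give, in this order, \<open>1 <= cmod x\<close>, a growth factor of
    at least 1 per letter, and the absorption of the rank one error.\<close>
  define K where "K = 1 + 2 / \<delta> + 2 * \<rho>\<^sup>2 * (\<rho> + \<eta>) / (\<eta> * \<delta>)"
  have "separated_words s (k ** s ** adj2 k) P \<delta>"
    if s: "det s = 1" "hyperbolic_on s x P R" "K < cmod x" for s x
  proof -
    have K0: "0 \<le> 2 / \<delta>" "0 \<le> 2 * \<rho>\<^sup>2 * (\<rho> + \<eta>) / (\<eta> * \<delta>)" using d \<eta> \<rho>(1) by auto
    have x: "1 \<le> cmod x" "2 / \<delta> \<le> cmod x" "2 * \<rho>\<^sup>2 * (\<rho> + \<eta>) / (\<eta> * \<delta>) \<le> cmod x"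
      using s(3) K0 unfolding K_def by linarith+
    have t: "0 \<le> \<rho>\<^sup>2 / cmod x" by simp
    have rk: "almost_rank_one (if b then k ** s ** adj2 k else s) x (p b) (r b) (\<rho>\<^sup>2 / cmod x)" for b
    proof -
      define U where "U = (if b then k else mat 1)"
      have U: "det U = 1" "U *v P = p b" "U *v R = r b" "U ** s ** adj2 U = (if b then k ** s ** adj2 k else s)"
        using k by (auto simp: U_def p_def r_def)
      have "almost_rank_one (if b then k ** s ** adj2 k else s) x (p b) (r b) (vnorm (p b) * vnorm (r b) / cmod x)"
        using hyperbolic_on_sandwich[OF s(2) U(1), of U] unfolding U by simp
      moreover have "vnorm (p b) * vnorm (r b) / cmod x \<le> \<rho>\<^sup>2 / cmod x"
        unfolding power2_eq_square using \<rho>(1) \<rho>(2)[of b] \<rho>(3)[of b] x by (intro divide_right_mono mult_mono) auto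
      ultimately show ?thesis unfolding almost_rank_one_def
        by (meson mult_right_mono order_trans vnorm_nonneg)
    qed
    have "\<rho>\<^sup>2 / cmod x * (\<rho> + \<eta>) \<le> \<rho>\<^sup>2 * (\<rho> + \<eta>)"
    proof -
      have "\<rho>\<^sup>2 / cmod x \<le> \<rho>\<^sup>2 / 1" using x \<rho>(1) by (intro divide_left_mono) auto
      then show ?thesis using \<eta> \<rho>(1) by (intro mult_right_mono) auto
    qed
    also have "\<dots> \<le> \<eta> * (cmod x * \<delta> / 2)" using x(3) \<eta> d by (simp add: field_simps)
    finally have b7: "\<rho>\<^sup>2 / cmod x * (\<rho> + \<eta>) \<le> \<eta> * (cmod x * \<delta> / 2)" .
    have b8: "1 \<le> cmod x * \<delta> / 2" using x(2) d by (simp add: field_simps)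
    have "det (k ** s ** adj2 k) = 1" using s k by (simp add: det_mul)
    then have "separated_words s (k ** s ** adj2 k) (p False) \<delta>"
      using \<eta> d by (intro separated_wordsI[where p = p and r = r, OF s(1) _ rk \<rho>(2,3) _ t _ \<eta>2 b7 b8 _ w w']) auto
    then show ?thesis by (simp add: p_def)
  qed
  then show ?thesis using d(1) by blast
qed

text \<open>For the inverses the roles of \<open>P\<close> and \<open>R\<close> are taken by
  \<open>R\<close> and \<open>- P\<close>. The four nonzero pairings cover both applications, and
  one power of \<open>g\<close> exceeds both thresholds.\<close>

lemma (in discrete_SL2) schottky_pair_exists:
  assumes AB: "A \<in> D" "B \<in> D" "A ** B \<noteq> B ** A"
  obtains s t \<mu> P R \<sigma> where "s \<in> D" "t \<in> D" "1 < cmod \<mu>" "hyperbolic_on s \<mu> P R" "0 < \<sigma>"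
    "separated_words s t P \<sigma>" "separated_words (adj2 s) (adj2 t) R \<sigma>"
proof -
  obtain g k \<mu> P R where g: "g \<in> D" "k \<in> D" "1 < cmod \<mu>" "hyperbolic_on g \<mu> P R"
    and w: "wedge (k *v P) P \<noteq> 0" "wedge (k *v P) R \<noteq> 0" "wedge (k *v R) P \<noteq> 0" "wedge (k *v R) R \<noteq> 0"
    using independent_loxodromic_exists[OF AB] by blast
  have dk: "det k = 1" using det_D g by blast
  note PR = hyperbolic_onD(1)[OF g(4)]
  have RP: "wedge R (- P) = 1" using PR by (simp add: wedge_def algebra_simps)
  have kP: "k *v (- P) = - (k *v P)" by (simp add: vector2_eq_iff mat2_simps)
  obtain \<sigma>1 K1 where 1: "\<sigma>1 > 0" "\<And>s x. det s = 1 \<Longrightarrow> hyperbolic_on s x P R \<Longrightarrow> K1 < cmod x \<Longrightarrow>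
     separated_words s (k ** s ** adj2 k) P \<sigma>1"
    using separated_words_hyperbolic[OF PR dk w(1,2,3)] by blast
  obtain \<sigma>2 K2 where 2: "\<sigma>2 > 0" "\<And>s x. det s = 1 \<Longrightarrow> hyperbolic_on s x R (- P) \<Longrightarrow> K2 < cmod x \<Longrightarrow>
     separated_words s (k ** s ** adj2 k) R \<sigma>2"
    using separated_words_hyperbolic[OF RP dk w(4)] w by (auto simp: kP wedge_linear)
  obtain m where m: "max 1 (max K1 K2) < cmod \<mu> ^ m"
    using real_arch_pow[OF g(3)] by blast
  define s t where "s = matpow g m" and "t = k ** s ** adj2 k"
  have s: "s \<in> D" "t \<in> D" using g by (auto simp: s_def t_def matpow_D mult_D adj2_D)
  have hs: "hyperbolic_on s (\<mu> ^ m) P R" unfolding s_def by (rule hyperbolic_on_matpow[OF g(4)])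
  have x: "1 < cmod (\<mu> ^ m)" "K1 < cmod (\<mu> ^ m)" "K2 < cmod (\<mu> ^ m)" using m by (auto simp: norm_power)
  have hs': "hyperbolic_on (adj2 s) (\<mu> ^ m) R (- P)"
    by (rule hyperbolic_on_adj2[OF hs det_D[OF s(1)]]) (use x(1) in \<open>metis norm_zero not_one_less_zero\<close>)
  have "adj2 t = k ** adj2 s ** adj2 k" by (simp add: t_def adj2_matrix_mult matrix_mul_assoc)
  then have "separated_words (adj2 s) (adj2 t) R \<sigma>2"
    using 2(2)[OF _ hs' x(3)] det_D[OF s(1)] by simp
  moreover have "separated_words s t P \<sigma>1" unfolding t_def using 1(2)[OF _ hs x(2)] det_D[OF s(1)] by simp
  ultimately have "separated_words s t P (min \<sigma>1 \<sigma>2)" "separated_words (adj2 s) (adj2 t) R (min \<sigma>1 \<sigma>2)"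
    unfolding separated_words_def by (meson min.coboundedI1 min.coboundedI2)+
  then show ?thesis using that[OF s x(1) hs, of "min \<sigma>1 \<sigma>2"] 1(1) 2(1) by simp
qed

section \<open>Escaping from the degenerate directions\<close>

text \<open>Union bound: no bad predicate holds at three indices, so each of them spoils at most
  two.\<close>

lemma exists_avoiding_all:
  assumes "finite I" "finite \<K>" "2 * card \<K> < card I"
    and "\<And>B i j k. B \<in> \<K> \<Longrightarrow> i \<in> I \<Longrightarrow> j \<in> I \<Longrightarrow> k \<in> I \<Longrightarrow> i \<noteq> j \<Longrightarrow> i \<noteq> k \<Longrightarrow> j \<noteq> k \<Longrightarrow>
      B i \<Longrightarrow> B j \<Longrightarrow> B k \<Longrightarrow> False"
  obtains i where "i \<in> I" "\<And>B. B \<in> \<K> \<Longrightarrow> \<not> B i"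
proof -
  have le: "card {i \<in> I. B i} \<le> 2" if B: "B \<in> \<K>" for B
  proof (rule ccontr)
    assume "\<not> ?thesis"
    then have "3 \<le> card {i \<in> I. B i}" by simp
    then obtain T where "T \<subseteq> {i \<in> I. B i}" "card T = 3" by (rule obtain_subset_with_card_n)
    then show False using assms(4)[OF B] unfolding card_3_iff by blast
  qed
  have "card (\<Union>B\<in>\<K>. {i \<in> I. B i}) \<le> (\<Sum>B\<in>\<K>. card {i \<in> I. B i})"
    by (rule card_UN_le[OF assms(2)])
  also have "\<dots> \<le> 2 * card \<K>" using sum_bounded_above[of \<K> "\<lambda>B. card {i \<in> I. B i}" 2] le by simp
  finally have "card (\<Union>B\<in>\<K>. {i \<in> I. B i}) < card I" using assms(3) by simp
  then have "\<not> I \<subseteq> (\<Union>B\<in>\<K>. {i \<in> I. B i})"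
    using card_mono[of "\<Union>B\<in>\<K>. {i \<in> I. B i}" I] assms(1,2) by auto
  then show ?thesis using that by blast
qed

text \<open>Interpolation loses \<open>24 * l ^ 4\<close>, so values below \<open>l ^ 6\<close> in
  the denominator give coefficients below \<open>24 / l ^ 2 <= 1 / l\<close>, all relative to
  \<open>mnorm a\<close>; this contradicts nondegeneracy.\<close>

lemma quadratic_not_small_at_three:
  assumes l: "24 \<le> l" and u: "vnorm v1 \<le> l" "vnorm v2 \<le> l" "vnorm v3 \<le> l"
      "1 / l \<le> cmod (wedge v1 v2)" "1 / l \<le> cmod (wedge v1 v3)" "1 / l \<le> cmod (wedge v2 v3)"
    and off: "mnorm a / l \<le> cmod (a $ 1 $ 2) + cmod (a $ 2 $ 1) + cmod (a $ 1 $ 1 - a $ 2 $ 2)"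
    and small: "cmod (wedge (a *v v1) v1) < mnorm a / l ^ 6" "cmod (wedge (a *v v2) v2) < mnorm a / l ^ 6"
      "cmod (wedge (a *v v3) v3) < mnorm a / l ^ 6"
  shows False
proof -
  have Q: "wedge (a *v v) v = - (a $ 2 $ 1) * (v $ 1)\<^sup>2 + (a $ 1 $ 1 - a $ 2 $ 2) * (v $ 1 * v $ 2)
      + a $ 1 $ 2 * (v $ 2)\<^sup>2" for v
    by (simp add: wedge_def mat2_simps algebra_simps power2_eq_square)
  have l0: "0 < 1 / l" "0 < l" using l by auto
  have "cmod (- (a $ 2 $ 1)) + cmod (a $ 1 $ 1 - a $ 2 $ 2) + cmod (a $ 1 $ 2)
      < 24 * (mnorm a / l ^ 6) * l\<^sup>2 / (1 / l)\<^sup>2"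
    by (rule quadratic_form_not_small[OF l0 u(4-6) u(1-3) Q small])
  also have "\<dots> = 24 * (mnorm a / l\<^sup>2)"
    using l0 by (simp add: field_simps eval_nat_numeral)
  also have "\<dots> \<le> l * (mnorm a / l\<^sup>2)" using l by (intro mult_right_mono) auto
  also have "\<dots> = mnorm a / l" using l0 by (simp add: power2_eq_square)
  finally show False using off by simp
qed

text \<open>The loss is now \<open>2 * l ^ 2\<close>: from \<open>m / l ^ 10\<close> to
  \<open>2 * m / l ^ 8 <= m / l ^ 7\<close>, the lower bound available for \<open>w\<close>.\<close>

lemma linear_not_small_at_two:
  assumes l: "24 \<le> l" and u: "vnorm v1 \<le> l" "vnorm v2 \<le> l" "1 / l \<le> cmod (wedge v1 v2)"
    and w: "m / l ^ 7 \<le> vnorm w" and m: "0 \<le> m"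
    and small: "cmod (wedge w v1) < m / l ^ 10" "cmod (wedge w v2) < m / l ^ 10"
  shows False
proof -
  have l0: "0 < 1 / l" "0 < l" using l by auto
  have "vnorm w < 2 * (m / l ^ 10) * l / (1 / l)"
    by (rule linear_form_not_small[OF l0 u(3,1,2) small])
  also have "\<dots> = 2 * (m / l ^ 8)" using l0 by (simp add: field_simps eval_nat_numeral)
  also have "\<dots> \<le> l * (m / l ^ 8)" using l m by (intro mult_right_mono) auto
  also have "\<dots> = m / l ^ 7" using l0 by (simp add: field_simps eval_nat_numeral)
  finally show False using w by simp
qed

text \<open>The vector \<open>u i\<close> is chosen first; the conditions mixing \<open>u i\<close> and \<open>u' j\<close> are then linear in \<open>u' j\<close>,
  and the vectors representing these linear forms are not small because \<open>wedge (a *v u i) (u i)\<close> is not.\<close>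

lemma generic_pair_exists:
  fixes u u' :: "'i \<Rightarrow> complex^2"
  assumes I: "finite I" "6 * card \<A> + 2 < card I" and A: "finite \<A>"
    and l: "24 \<le> l" and u: "\<And>i. i \<in> I \<Longrightarrow> vnorm (u i) \<le> l"
      "\<And>i j. i \<in> I \<Longrightarrow> j \<in> I \<Longrightarrow> i \<noteq> j \<Longrightarrow> 1 / l \<le> cmod (wedge (u i) (u j))"
    and u': "\<And>i. i \<in> I \<Longrightarrow> vnorm (u' i) \<le> l"
      "\<And>i j. i \<in> I \<Longrightarrow> j \<in> I \<Longrightarrow> i \<noteq> j \<Longrightarrow> 1 / l \<le> cmod (wedge (u' i) (u' j))"
    and off: "\<And>a. a \<in> \<A> \<Longrightarrow> mnorm a / l \<le> cmod (a $ 1 $ 2) + cmod (a $ 2 $ 1) + cmod (a $ 1 $ 1 - a $ 2 $ 2)"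
  obtains i j where "i \<in> I" "j \<in> I" "2 / l ^ 10 \<le> cmod (wedge (u i) (u' j))"
    "\<And>a v v'. a \<in> \<A> \<Longrightarrow> v \<in> {u i, u' j} \<Longrightarrow> v' \<in> {u i, u' j} \<Longrightarrow> mnorm a / l ^ 10 \<le> cmod (wedge (a *v v) v')"
proof -
  have l0: "0 < l" using l by simp
  define bad1 where "bad1 = (\<lambda>a i. cmod (wedge (a *v u i) (u i)) < mnorm a / l ^ 6)"
  obtain i where i: "i \<in> I" "\<And>B. B \<in> bad1 ` \<A> \<Longrightarrow> \<not> B i"
  proof (rule exists_avoiding_all[OF I(1), of "bad1 ` \<A>"])
    show "2 * card (bad1 ` \<A>) < card I" using card_image_le[OF A, of bad1] I(2) by simp
    fix B i j k assume "B \<in> bad1 ` \<A>" and ijk: "i \<in> I" "j \<in> I" "k \<in> I" "i \<noteq> j" "i \<noteq> k" "j \<noteq> k" "B i" "B j" "B k"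
    then obtain a where "B = bad1 a" "a \<in> \<A>" by blast
    then show False
      using quadratic_not_small_at_three[OF l u(1) u(1) u(1) u(2) u(2) u(2) off, of i j k a] ijk
      by (auto simp: bad1_def)
  qed (use A in auto)
  define P where "P = u i"
  have P: "mnorm a / l ^ 6 \<le> cmod (wedge (a *v P) P)" if "a \<in> \<A>" for a
    using i(2)[of "bad1 a"] that by (auto simp: bad1_def P_def)
  have Pl: "vnorm P \<le> l" using u i by (simp add: P_def)
  \<comment> \<open>Dividing the bound \<open>m / l ^ 6\<close> by \<open>vnorm P <= l\<close> gives
    the exponent 7.\<close>
  have big: "m / l ^ 7 \<le> vnorm w" if "m / l ^ 6 \<le> cmod (wedge w P)" for m w
  proof -
    have "m / l ^ 6 \<le> vnorm w * l"
      using that cmod_wedge_le[of w P] mult_left_mono[OF Pl vnorm_nonneg[of w]] by linarith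
    then show ?thesis using l0 by (simp add: field_simps eval_nat_numeral)
  qed
  \<comment> \<open>The vector \<open>P\<close> represents the requirement that \<open>u' j\<close>
    be apart from \<open>P\<close>. It plays the part of the coefficient 1, of norm 2, and is not
    small because another \<open>u j\<close> is apart from it.\<close>
  have P0: "2 / l ^ 7 \<le> vnorm P"
  proof -
    have "1 < card I" using I by simp
    then obtain j where j: "j \<in> I" "j \<noteq> i" by (metis card_le_Suc0_iff_eq I(1) One_nat_def not_le)
    then have "1 / l \<le> vnorm P * l"
      using u(2)[OF i(1) j(1)] cmod_wedge_le[of P "u j"] mult_left_mono[OF u(1)[OF j(1)] vnorm_nonneg[of P]]
      by (simp add: P_def)
    then have "1 / l\<^sup>2 \<le> vnorm P" using l0 by (simp add: field_simps power2_eq_square)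
    moreover have "2 / l ^ 7 \<le> l / l ^ 7" using l by (intro divide_right_mono) auto
    moreover have "l / l ^ 7 = 1 / l ^ 6" using l0 by (simp add: field_simps eval_nat_numeral)
    moreover have "1 / l ^ 6 \<le> 1 / l\<^sup>2" using l by (intro divide_left_mono power_increasing mult_pos_pos) auto
    ultimately show ?thesis by linarith
  qed
  define bad2 where "bad2 = (\<lambda>a j. cmod (wedge (a *v u' j) (u' j)) < mnorm a / l ^ 6)"
  define bad3 where "bad3 = (\<lambda>w m j. cmod (wedge w (u' j)) < m / l ^ 10)"
  \<comment> \<open>\<open>X\<close> is quadratic in \<open>u' j\<close>; \<open>Y\<close> and
    \<open>Z\<close> are the linear conditions pairing \<open>a *v P\<close> with
    \<open>u' j\<close> and \<open>a *v u' j\<close> with \<open>P\<close>. Together with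
    \<open>P\<close> itself there are at most \<open>3 * card \<A> + 1\<close>, each excluding two
    indices, which is the count in the hypothesis.\<close>
  define X Y Z where "X = bad2 ` \<A>" and "Y = (\<lambda>a. bad3 (a *v P) (mnorm a)) ` \<A>"
    and "Z = (\<lambda>a. bad3 (adj2 a *v P) (mnorm a)) ` \<A>"
  define \<K> where "\<K> = insert (bad3 P 2) (X \<union> Y \<union> Z)"
  have XYZ: "finite X" "finite Y" "finite Z" "card X \<le> card \<A>" "card Y \<le> card \<A>" "card Z \<le> card \<A>"
    unfolding X_def Y_def Z_def by (simp_all add: A card_image_le)
  then have fin: "finite \<K>" by (simp add: \<K>_def)
  have "card \<K> \<le> Suc (card (X \<union> Y \<union> Z))"
    using XYZ by (simp add: \<K>_def card_insert_if)
  then have "card \<K> \<le> 1 + (card \<A> + card \<A> + card \<A>)"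
    using card_Un_le[of "X \<union> Y" Z] card_Un_le[of X Y] XYZ(4-6) by linarith
  then have card: "2 * card \<K> < card I" using I(2) by simp
  have adjP: "mnorm a / l ^ 6 \<le> cmod (wedge (adj2 a *v P) P)" if "a \<in> \<A>" for a
    using P[OF that] cmod_wedge_commute[of P "a *v P"] wedge_matrix_adj2[of "adj2 a" P P] by simp
  obtain j where j: "j \<in> I" "\<And>B. B \<in> \<K> \<Longrightarrow> \<not> B j"
  proof (rule exists_avoiding_all[OF I(1) fin card])
    fix B i j k assume B: "B \<in> \<K>" and ijk: "i \<in> I" "j \<in> I" "k \<in> I" "i \<noteq> j" "i \<noteq> k" "j \<noteq> k" "B i" "B j" "B k"
    have lin: False if "B = bad3 w m" "m / l ^ 7 \<le> vnorm w" "0 \<le> m" for w m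
      using linear_not_small_at_two[OF l u'(1) u'(1) u'(2) that(2,3), of i j] ijk that(1)
      by (auto simp: bad3_def)
    show False using B unfolding \<K>_def X_def Y_def Z_def
    proof (elim insertE UnE imageE)
      assume "B = bad3 P 2" then show False using lin[of P 2] P0 by simp
    next
      fix a assume "B = bad2 a" "a \<in> \<A>"
      then show False
        using quadratic_not_small_at_three[OF l u'(1) u'(1) u'(1) u'(2) u'(2) u'(2) off, of i j k a] ijk
        by (auto simp: bad2_def)
    next
      fix a assume "B = bad3 (a *v P) (mnorm a)" "a \<in> \<A>"
      then show False using lin[of "a *v P" "mnorm a"] big[OF P] by simp
    next
      fix a assume "B = bad3 (adj2 a *v P) (mnorm a)" "a \<in> \<A>"
      then show False using lin[of "adj2 a *v P" "mnorm a"] big[OF adjP] by simp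
    qed
  qed blast
  have le: "mnorm a / l ^ 10 \<le> mnorm a / l ^ 6" for a
    using l by (intro divide_left_mono power_increasing mult_pos_pos) auto
  define P' where "P' = u' j"
  have n3: "\<not> bad3 P 2 j" using j(2)[of "bad3 P 2"] by (simp add: \<K>_def)
  have all: "mnorm a / l ^ 10 \<le> cmod (wedge (a *v P) P)" "mnorm a / l ^ 10 \<le> cmod (wedge (a *v P') P')"
    "mnorm a / l ^ 10 \<le> cmod (wedge (a *v P) P')" "mnorm a / l ^ 10 \<le> cmod (wedge (a *v P') P)" if a: "a \<in> \<A>" for a
  proof -
    have "\<not> bad2 a j" "\<not> bad3 (a *v P) (mnorm a) j" "\<not> bad3 (adj2 a *v P) (mnorm a) j"
      using j(2) a by (auto simp: \<K>_def X_def Y_def Z_def)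
    then show "mnorm a / l ^ 10 \<le> cmod (wedge (a *v P) P)" "mnorm a / l ^ 10 \<le> cmod (wedge (a *v P') P')"
      "mnorm a / l ^ 10 \<le> cmod (wedge (a *v P) P')" "mnorm a / l ^ 10 \<le> cmod (wedge (a *v P') P)"
      using P[OF a] le[of a] cmod_wedge_commute[of P' "adj2 a *v P"]
      by (auto simp: bad2_def bad3_def P'_def[symmetric] not_less wedge_matrix_adj2[of a P' P] 
          simp del: adj2_nth intro: order_trans)
  qed
  show ?thesis
    by (rule that[OF i(1) j(1)]) (use n3 all in \<open>auto simp: bad3_def P_def P'_def not_less\<close>)
qed

section \<open>Ping-pong for reduced words over matrices\<close>

definition pm1 :: "(complex^2^2) set" where
  "pm1 = {mat 1, - mat 1}"

text \<open>A syllable \<open>(e, a)\<close> stands for \<open>x a\<close> if \<open>e\<close> holds and for \<open>x\<^sup>-\<^sup>1 a\<close> otherwise.\<close>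

fun reduced_word :: "(bool \<times> (complex^2^2)) list \<Rightarrow> bool" where
  "reduced_word ((e, a) # (e', a') # xs) \<longleftrightarrow> (a \<in> pm1 \<longrightarrow> e = e') \<and> reduced_word ((e', a') # xs)"
| "reduced_word _ \<longleftrightarrow> True"

definition eval_word :: "complex^2^2 \<Rightarrow> (bool \<times> (complex^2^2)) list \<Rightarrow> complex^2^2" where
  "eval_word g xs = foldr (\<lambda>(e, a) M. (if e then g else adj2 g) ** a ** M) xs (mat 1)"

lemma eval_word_simps [simp]:
  "eval_word g [] = mat 1" "eval_word g ((e, a) # xs) = (if e then g else adj2 g) ** a ** eval_word g xs"
  by (simp_all add: eval_word_def)

text \<open>Induction from the right end. A coefficient in \<open>\<A>\<close> keeps both directions
  apart from both; a coefficient +-1 stands between equal exponents, where \<open>same\<close>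
  suffices. At the start \<open>a0\<close> is merged with the last coefficient; if the product is
  +-1, the starting vector must be the attracting one of the last letter.\<close>

lemma ping_pong:
  fixes p r :: "bool \<Rightarrow> complex^2"
  assumes g: "\<And>e. almost_rank_one (if e then g else adj2 g) x (p e) (r e) \<tau>"
    and bd: "\<And>b. vnorm (p b) \<le> \<rho>" "\<And>b. vnorm (r b) \<le> \<rho>" "0 \<le> \<eta>" "0 \<le> \<tau>" "\<eta> * \<rho> \<le> \<delta> / 2"
      "\<tau> * (\<rho> + \<eta>) \<le> \<eta> * (cmod x * \<delta> / 2)" "1 \<le> cmod x * \<delta> / 2"
    and same: "\<And>a e. a \<in> pm1 \<Longrightarrow> \<delta> * mnorm a \<le> cmod (wedge (a *v p e) (r e))"
    and A: "\<And>a e e'. a \<in> \<A> \<Longrightarrow> \<delta> * mnorm a \<le> cmod (wedge (a *v p e) (r e'))"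
    and xs: "xs \<noteq> []" "reduced_word xs" "\<And>a. a \<in> snd ` set xs \<Longrightarrow> det a = 1"
      "\<And>a. a \<in> snd ` set xs \<Longrightarrow> a \<in> pm1 \<or> a \<in> \<A>"
    and a0: "det a0 = 1" "snd (last xs) ** a0 \<in> \<A> \<or> snd (last xs) ** a0 \<in> pm1 \<and> i = fst (last xs)"
  shows "\<exists>c. near \<eta> (p (fst (hd xs))) (eval_word g xs *v (a0 *v p i)) c \<and> cmod x * \<delta> / 2 \<le> cmod c"
  using xs a0(2)
proof (induction xs rule: reduced_word.induct)
  case (1 e a e' a' xs)
  define v where "v = eval_word g ((e', a') # xs) *v (a0 *v p i)"
  have "\<exists>c. near \<eta> (p (fst (hd ((e', a') # xs)))) v c \<and> cmod x * \<delta> / 2 \<le> cmod c"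
    unfolding v_def by (rule "1.IH") (use "1.prems" in auto)
  then obtain c where c: "near \<eta> (p e') v c" "cmod x * \<delta> / 2 \<le> cmod c" by auto
  have "\<delta> * mnorm a \<le> cmod (wedge (a *v p e') (r e))"
    using "1.prems"(2) "1.prems"(4)[of a] same[of a e] A[of a e' e] by auto
  from near_step[OF c(1) g this bd(1) bd(2) bd(3-6)]
  obtain c' where c': "near \<eta> (p e) ((if e then g else adj2 g) *v (a *v v)) c'"
    "cmod x * \<delta> / 2 * mnorm a * cmod c \<le> cmod c'" by blast
  \<comment> \<open>Both \<open>mnorm a\<close> and the previous coordinate are at least 1, so the
    bound for a single letter persists.\<close>
  have "cmod x * \<delta> / 2 * 1 * 1 \<le> cmod x * \<delta> / 2 * mnorm a * cmod c"
    using bd(7) c(2) mnorm_ge_1[of a] "1.prems"(3)[of a] by (intro mult_mono) auto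
  then have "cmod x * \<delta> / 2 \<le> cmod c'" using c'(2) by simp
  moreover have "eval_word g ((e, a) # (e', a') # xs) *v (a0 *v p i) = (if e then g else adj2 g) *v (a *v v)"
    unfolding v_def eval_word_simps(2)[of g e a] by (simp only: matrix_vector_mul_assoc[symmetric])
  ultimately show ?case using c'(1) by auto
next
  case ("2_2" ea)
  obtain e a where ea: "ea = (e, a)" by fastforce
  have n: "near \<eta> (p i) (p i) 1" using bd(3) by (simp add: near_def vnorm_def)
  have "\<delta> * mnorm (a ** a0) \<le> cmod (wedge ((a ** a0) *v p i) (r e))"
    using "2_2.prems"(5) same[of "a ** a0" e] A[of "a ** a0" i e] by (auto simp: ea)
  from near_step[OF n g this bd(1) bd(2) bd(3-6)]
  obtain c' where c': "near \<eta> (p e) ((if e then g else adj2 g) *v ((a ** a0) *v p i)) c'"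
    "cmod x * \<delta> / 2 * mnorm (a ** a0) * cmod 1 \<le> cmod c'" by blast
  have "det (a ** a0) = 1" using "2_2.prems"(3)[of a] a0(1) by (simp add: ea det_mul)
  then have "cmod x * \<delta> / 2 * 1 \<le> cmod x * \<delta> / 2 * mnorm (a ** a0)"
    using bd(7) mnorm_ge_1[of "a ** a0"] by (intro mult_left_mono) auto
  then have "cmod x * \<delta> / 2 \<le> cmod c'" using c'(2) by simp
  moreover have "eval_word g [(e, a)] *v (a0 *v p i) = (if e then g else adj2 g) *v ((a ** a0) *v p i)"
    by (simp add: matrix_vector_mul_assoc matrix_mul_assoc)
  ultimately show ?case using c'(1) by (auto simp: ea)
qed simp

lemma almost_rank_one_mono:
  "almost_rank_one A x P R \<tau> \<Longrightarrow> \<tau> \<le> \<tau>' \<Longrightarrow> almost_rank_one A x P R \<tau>'"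
  unfolding almost_rank_one_def by (meson mult_right_mono order_trans vnorm_nonneg)

lemma pm1_simps: "a \<in> pm1 \<Longrightarrow> mnorm a = 2" "a \<in> pm1 \<Longrightarrow> wedge (a *v u) v \<in> {wedge u v, - wedge u v}"
  "a \<in> pm1 \<Longrightarrow> vnorm (a *v u) = vnorm u"
  by (auto simp: pm1_def wedge_def mat2_simps vnorm_def algebra_simps)

text \<open>Centrality of +-1; it serves to move the initial coefficient of a word to its
  end.\<close>

lemma pm1_mult_commute:
  assumes "det A = 1" "A ** B \<in> pm1"
  shows "B ** A \<in> pm1"
proof -
  have "B = adj2 A ** (A ** B)" by (simp add: matrix_mul_assoc adj2_mult assms)
  then have "B = adj2 A \<or> B = - adj2 A" using assms(2) by (auto simp: pm1_def matrix_neg_mult)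
  then show ?thesis using assms by (auto simp: pm1_def matrix_neg_mult adj2_mult)
qed

text \<open>Minimality gives \<open>2 ^ L <= 32 * n <= n ^ 6\<close> as \<open>n >= 2\<close>,
  whence the 6. The factor 16 leaves room for \<open>6 * (n + 1) + 2\<close>, the threshold for
  \<open>n + 1\<close> coefficients.\<close>

lemma power_of_two_between:
  assumes "2 \<le> n"
  obtains L where "1 \<le> L" "16 * n \<le> 2 ^ L" "real L \<le> 6 / ln 2 * ln (real n)"
proof -
  define L where "L = (LEAST L. 16 * n \<le> 2 ^ L)"
  have "16 * n \<le> 2 ^ (16 * n)" using less_exp[of "16 * n"] by simp
  then have L: "16 * n \<le> 2 ^ L" unfolding L_def by (rule LeastI)
  have "L \<noteq> 0" using L assms by (cases L) auto
  then obtain L' where L': "L = Suc L'" by (cases L) auto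
  have "\<not> 16 * n \<le> 2 ^ L'" using not_less_Least[of L' "\<lambda>L. 16 * n \<le> 2 ^ L"] L' by (simp add: L_def)
  then have "2 ^ L \<le> 2 ^ 5 * n" by (simp add: L')
  also have "\<dots> \<le> n ^ 5 * n" using assms by (intro mult_right_mono power_mono) auto
  finally have "2 ^ L \<le> n ^ 6" by (simp add: eval_nat_numeral)
  then have "real (2 ^ L) \<le> real (n ^ 6)" by (simp only: of_nat_le_iff)
  then have "ln (2 ^ L) \<le> ln (real n ^ 6)" using assms by (simp del: ln_realpow)
  then have "real L * ln 2 \<le> 6 * ln (real n)" using assms by (simp add: ln_realpow)
  then have "real L \<le> 6 / ln 2 * ln (real n)" by (simp add: field_simps)
  then show ?thesis using that[of L] L L' by simp
qed

lemma (in discrete_SL2) word_mat_D: "s \<in> D \<Longrightarrow> t \<in> D \<Longrightarrow> word_mat s t bs \<in> D"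
  by (induction bs) (auto simp: one_D mult_D)

text \<open>\<open>M\<close> and \<open>j\<close> depend only on the group and the Schottky pair;
  the length bound enters through \<open>L\<close>, which is logarithmic in
  \<open>n\<close>.\<close>

theorem (in discrete_SL2) log_length_nonsolution:
  assumes AB: "A \<in> D" "B \<in> D" "A ** B \<noteq> B ** A"
  obtains s t C where "s \<in> D" "t \<in> D" "0 < C"
    "\<And>n a0 xs. 2 \<le> n \<Longrightarrow> xs \<noteq> [] \<Longrightarrow> length xs \<le> n \<Longrightarrow> a0 \<in> D \<Longrightarrow> snd ` set xs \<subseteq> D \<Longrightarrow> reduced_word xs \<Longrightarrow>
      \<exists>bs. real (length bs) \<le> C * ln (real n) \<and> a0 ** eval_word (word_mat s t bs) xs \<notin> pm1"
proof -
  obtain s t \<mu> P R \<sigma> where st: "s \<in> D" "t \<in> D" "1 < cmod \<mu>" "hyperbolic_on s \<mu> P R" "0 < \<sigma>"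
    "separated_words s t P \<sigma>" "separated_words (adj2 s) (adj2 t) R \<sigma>"
    using schottky_pair_exists[OF AB] by blast
  note det_st = det_D[OF st(1)] det_D[OF st(2)]
  obtain c where c: "c > 0" "\<And>A. A \<in> D \<Longrightarrow> A \<notin> pm1 \<Longrightarrow>
     c * mnorm A \<le> cmod (A $ 1 $ 2) + cmod (A $ 2 $ 1) + cmod (A $ 1 $ 1 - A $ 2 $ 2)"
    using offscalar_part_bound unfolding pm1_def by blast
  \<comment> \<open>One base for everything that degrades with the length: its powers bound
    separation, nondegeneracy and the norms of the vectors. The 24 comes from the quadratic
    estimate.\<close>
  define M where "M = 24 + 1 / \<sigma> + 1 / c + (mnorm s + mnorm t) * (1 + vnorm P + vnorm R)"
  have pos: "0 \<le> (mnorm s + mnorm t) * (1 + vnorm P + vnorm R)" "0 < 1 / \<sigma>" "0 < 1 / c"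
    using st(5) c(1) by auto
  have M: "24 \<le> M" "1 / \<sigma> \<le> M" "1 / c \<le> M" "(mnorm s + mnorm t) * (1 + vnorm P + vnorm R) \<le> M"
    using pos unfolding M_def by linarith+
  \<comment> \<open>Genericity will cost \<open>l ^ 10\<close>; an eigenvalue of size
    \<open>l ^ 30\<close> leaves a gain of \<open>l ^ 20\<close>.\<close>
  obtain j where j: "M ^ 30 < cmod \<mu> ^ j" using real_arch_pow[OF st(3)] by blast
  \<comment> \<open>The word for \<open>g\<close> has length
    \<open>N + 2 * L = (j + 2) * L\<close>.\<close>
  define C where "C = (real j + 2) * (6 / ln 2)"
  have C: "0 < C" by (simp add: C_def)
  have "\<exists>bs. real (length bs) \<le> C * ln (real n) \<and> a0 ** eval_word (word_mat s t bs) xs \<notin> pm1"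
    if n: "2 \<le> n" and xs: "xs \<noteq> []" "length xs \<le> n" "a0 \<in> D" "snd ` set xs \<subseteq> D" "reduced_word xs" for n a0 xs
  proof -
    obtain L where L: "1 \<le> L" "16 * n \<le> 2 ^ L" "real L \<le> 6 / ln 2 * ln (real n)"
      using power_of_two_between[OF n] by blast
    define l where "l = M ^ L"
    have "M ^ 1 \<le> l" unfolding l_def using M L by (intro power_increasing) auto
    then have l: "24 \<le> l" "M \<le> l" using M by auto
    then have l0: "0 < l" by simp
    have \<sigma>l: "1 / l \<le> \<sigma>" using order_trans[OF M(2) l(2)] st(5) l0 by (simp add: field_simps)
    have cl: "1 / l \<le> c" using order_trans[OF M(3) l(2)] c(1) l0 by (simp add: field_simps)
    have word_le: "vnorm (word_mat s' t' bs *v v) \<le> l"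
      if "length bs = L" "mnorm s' = mnorm s" "mnorm t' = mnorm t" "vnorm v \<le> vnorm P + vnorm R" for s' t' bs v
    proof -
      have "vnorm (word_mat s' t' bs *v v) \<le> (mnorm s + mnorm t) ^ L * vnorm v"
        using vnorm_word_mat[of s' t' bs v] that by simp
      \<comment> \<open>The factor for \<open>v\<close> is raised to the power \<open>L\<close> as
        well, so that the product fits under \<open>M ^ L\<close>.\<close>
      also have "\<dots> \<le> (mnorm s + mnorm t) ^ L * (1 + vnorm P + vnorm R) ^ L"
      proof (intro mult_left_mono)
        have "vnorm v \<le> (1 + vnorm P + vnorm R) ^ 1" using that by simp
        also have "\<dots> \<le> (1 + vnorm P + vnorm R) ^ L" using L by (intro power_increasing) auto
        finally show "vnorm v \<le> (1 + vnorm P + vnorm R) ^ L" .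
      qed simp
      also have "\<dots> = ((mnorm s + mnorm t) * (1 + vnorm P + vnorm R)) ^ L" by (simp add: power_mult_distrib)
      also have "\<dots> \<le> l" unfolding l_def using M(4) pos by (intro power_mono) auto
      finally show ?thesis .
    qed
    define N where "N = j * L"
    define x where "x = \<mu> ^ N"
    have "l ^ 30 = (M ^ 30) ^ L" by (simp add: l_def flip: power_mult) (simp add: mult.commute)
    also have "\<dots> \<le> (cmod \<mu> ^ j) ^ L" using j M by (intro power_mono) auto
    finally have x: "l ^ 30 \<le> cmod x" by (simp add: x_def N_def norm_power power_mult)
    define I where "I = {bs :: bool list. length bs = L}"
    have I: "finite I" "card I = 2 ^ L"
      using finite_lists_length_eq[of "UNIV :: bool set" L] card_lists_length_eq[of "UNIV :: bool set" L]
      by (simp_all add: I_def)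
    \<comment> \<open>The coefficient created by closing up the word cyclically. Coefficients +-1
      are removed from \<open>\<A>\<close>, since their quadratic form vanishes identically.\<close>
    define a1 where "a1 = snd (last xs) ** a0"
    define \<A> where "\<A> = insert a1 (snd ` set xs) - pm1"
    have last: "snd (last xs) \<in> D" using xs by auto
    have \<A>: "finite \<A>" "\<A> \<subseteq> D" using xs last by (auto simp: \<A>_def a1_def mult_D)
    have "card \<A> \<le> card (insert a1 (snd ` set xs))" unfolding \<A>_def by (intro card_mono) auto
    also have "\<dots> \<le> Suc (card (snd ` set xs))" by (simp add: card_insert_if)
    also have "card (snd ` set xs) \<le> n"
      using card_image_le[of "set xs" snd] card_length[of xs] xs(2) by simp
    finally have "6 * card \<A> + 2 < card I" using I(2) L(2) n by simp
    then obtain bs bs' where bs: "bs \<in> I" "bs' \<in> I"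
      and PP: "2 / l ^ 10 \<le> cmod (wedge (word_mat s t bs *v P) (word_mat (adj2 s) (adj2 t) bs' *v R))"
      and gen: "\<And>a v v'. a \<in> \<A> \<Longrightarrow> v \<in> {word_mat s t bs *v P, word_mat (adj2 s) (adj2 t) bs' *v R} \<Longrightarrow>
         v' \<in> {word_mat s t bs *v P, word_mat (adj2 s) (adj2 t) bs' *v R} \<Longrightarrow> mnorm a / l ^ 10 \<le> cmod (wedge (a *v v) v')"
    proof (rule generic_pair_exists[OF I(1) _ \<A>(1) l(1), where u = "\<lambda>bs. word_mat s t bs *v P"
          and u' = "\<lambda>bs. word_mat (adj2 s) (adj2 t) bs *v R"])
      show "mnorm a / l \<le> cmod (a $ 1 $ 2) + cmod (a $ 2 $ 1) + cmod (a $ 1 $ 1 - a $ 2 $ 2)" if "a \<in> \<A>" for a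
      proof -
        have "a \<in> D" "a \<notin> pm1" using that \<A>(2) by (auto simp: \<A>_def)
        then show ?thesis using c(2)[of a] mult_right_mono[OF cl mnorm_nonneg[of a]] by simp
      qed
    qed (use st(6,7) \<sigma>l word_le in \<open>auto simp: I_def separated_words_def intro: order_trans\<close>)
    \<comment> \<open>\<open>U'\<close> is a word in the inverses, so its adjugate is a positive
      word in \<open>s\<close> and \<open>t\<close>, and hence so is \<open>g\<close>.\<close>
    define U U' where "U = word_mat s t bs" and "U' = word_mat (adj2 s) (adj2 t) bs'"
    have dU: "det U = 1" "det U' = 1" using det_st by (simp_all add: U_def U'_def det_word_mat)
    define g where "g = U ** matpow s N ** adj2 U'"
    define w where "w = bs @ replicate N False @ rev bs'"
    have gw: "g = word_mat s t w"
      by (simp add: g_def w_def U_def U'_def adj2_word_mat word_mat_append word_mat_replicate matrix_mul_assoc)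
    have "real (length w) = (real j + 2) * real L" using bs by (simp add: w_def N_def I_def algebra_simps)
    also have "\<dots> \<le> (real j + 2) * (6 / ln 2 * ln (real n))" using L(3) by (intro mult_left_mono) auto
    also have "\<dots> = C * ln (real n)" by (simp add: C_def)
    finally have len: "real (length w) \<le> C * ln (real n)" .
    \<comment> \<open>\<open>True\<close> stands for \<open>g\<close>, which attracts to
      \<open>U *v P\<close> and repels from \<open>U' *v R\<close>. For the inverse they are
      interchanged, with the sign from \<open>hyperbolic_on_adj2\<close>.\<close>
    define p r where "p e = (if e then U *v P else U' *v R)" and "r e = (if e then U' *v R else - (U *v P))" for e
    have Ul: "vnorm (U *v P) \<le> l" "vnorm (U *v R) \<le> l" "vnorm (U' *v P) \<le> l" "vnorm (U' *v R) \<le> l"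
      using bs by (auto simp: U_def U'_def I_def intro!: word_le)
    have pl: "vnorm (p e) \<le> l" "vnorm (r e) \<le> l" for e using Ul by (auto simp: p_def r_def)
    define \<tau> where "\<tau> = l\<^sup>2 / cmod x"
    have \<tau>: "a * b / cmod x \<le> \<tau>" if "a \<le> l" "b \<le> l" "0 \<le> b" for a b
      unfolding \<tau>_def power2_eq_square using that l0 by (intro divide_right_mono mult_mono) auto
    have h: "hyperbolic_on (matpow s N) x P R" unfolding x_def by (rule hyperbolic_on_matpow[OF st(4)])
    have x0: "x \<noteq> 0" using x l0 by (metis norm_zero not_le zero_less_power)
    have h': "hyperbolic_on (adj2 (matpow s N)) x R (- P)"
      by (rule hyperbolic_on_adj2[OF h det_D[OF matpow_D[OF st(1)]] x0])
    have "almost_rank_one g x (U *v P) (U' *v R) \<tau>"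
      unfolding g_def by (rule almost_rank_one_mono[OF hyperbolic_on_sandwich[OF h dU(2)]]) (use \<tau> Ul in auto)
    moreover have "almost_rank_one (adj2 g) x (U' *v R) (- (U *v P)) \<tau>"
    proof -
      have neg: "U *v (- P) = - (U *v P)" "U' *v (- P) = - (U' *v P)"
        by (simp_all add: vector2_eq_iff mat2_simps)
      have "adj2 g = U' ** adj2 (matpow s N) ** adj2 U"
        by (simp add: g_def adj2_matrix_mult matrix_mul_assoc)
      then show ?thesis
        using almost_rank_one_mono[OF hyperbolic_on_sandwich[OF h' dU(1), of U'], of \<tau>] \<tau> Ul by (simp add: neg)
    qed
    ultimately have rk: "almost_rank_one (if e then g else adj2 g) x (p e) (r e) \<tau>" for e
      by (simp add: p_def r_def)
    have big: "l ^ 20 \<le> cmod x * (1 / l ^ 10)"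
      using x l0 by (simp add: field_simps flip: power_add)
    \<comment> \<open>Ping-pong is run with \<open>\<rho> = l\<close>,
      \<open>\<delta> = 1 / l ^ 10\<close> and \<open>\<eta> = 1 / l ^ 12\<close>; the two extra
      powers of \<open>l\<close> pay for \<open>\<rho>\<close> and for the factor 2.\<close>
    have e1: "1 / l ^ 12 * l \<le> 1 / l ^ 10 / 2"
      using l l0 by (simp add: field_simps eval_nat_numeral)
    have l1: "1 \<le> l ^ k" for k using l by (simp add: one_le_power)
    have e2: "\<tau> * (l + 1 / l ^ 12) \<le> 1 / l ^ 12 * (cmod x * (1 / l ^ 10) / 2)"
    proof -
      have "1 / l ^ 12 \<le> 1" using l1[of 12] l0 by (subst divide_le_eq_1_pos) auto
      then have "l + 1 / l ^ 12 \<le> l * l" using mult_right_mono[of 2 l l] l by linarith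
      then have "\<tau> * (l + 1 / l ^ 12) \<le> \<tau> * (l * l)" by (intro mult_left_mono) (auto simp: \<tau>_def)
      also have "\<dots> = l ^ 4 / cmod x" by (simp add: \<tau>_def eval_nat_numeral)
      also have "\<dots> \<le> l ^ 4 / l ^ 30" using x l0 x0 by (intro divide_left_mono) auto
      also have "\<dots> \<le> 1" using l0 power_increasing[of 4 30 l] l by simp
      also have "1 \<le> l ^ 7" by (rule l1)
      also have "\<dots> \<le> 1 / l ^ 12 * (l ^ 20 / 2)" using l l0 by (simp add: field_simps eval_nat_numeral)
      also have "\<dots> \<le> 1 / l ^ 12 * (cmod x * (1 / l ^ 10) / 2)"
        using big l0 by (intro mult_left_mono divide_right_mono) auto
      finally show ?thesis .
    qed
    have half: "l ^ 19 \<le> l ^ 20 / 2" using l l0 by (simp add: eval_nat_numeral)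
    have e3: "l ^ 19 \<le> cmod x * (1 / l ^ 10) / 2" by (rule order_trans[OF half divide_right_mono[OF big]]) simp
    with l1[of 19] have e4: "1 \<le> cmod x * (1 / l ^ 10) / 2" by (rule order_trans)
    have same: "1 / l ^ 10 * mnorm a \<le> cmod (wedge (a *v p e) (r e))" if "a \<in> pm1" for a e
    proof -
      have "cmod (wedge (a *v p e) (r e)) = cmod (wedge (p e) (r e))"
        using pm1_simps(2)[OF that, of "p e" "r e"] by auto
      also have "\<dots> = cmod (wedge (U *v P) (U' *v R))"
        using cmod_wedge_commute[of "U *v P"] by (simp add: p_def r_def wedge_linear)
      finally show ?thesis using PP pm1_simps(1)[OF that] by (simp add: U_def U'_def)
    qed
    have gen': "1 / l ^ 10 * mnorm a \<le> cmod (wedge (a *v p e) (r e'))" if "a \<in> \<A>" for a e e'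
      using gen[OF that] by (auto simp: p_def r_def U_def U'_def wedge_linear)
    define e where "e = fst (hd xs)"
    have "\<exists>c. near (1 / l ^ 12) (p e) (eval_word g xs *v (a0 *v p (fst (last xs)))) c \<and>
       cmod x * (1 / l ^ 10) / 2 \<le> cmod c"
      unfolding e_def
    proof (rule ping_pong[OF rk pl(1) pl(2) _ _ e1 e2 e4 same gen' xs(1,5)])
      show "det a0 = 1" using det_D xs by blast
      show "snd (last xs) ** a0 \<in> \<A> \<or> snd (last xs) ** a0 \<in> pm1 \<and> fst (last xs) = fst (last xs)"
        by (auto simp: \<A>_def a1_def)
    qed (use l0 xs in \<open>auto simp: \<tau>_def \<A>_def det_D\<close>)
    then obtain c' where c': "near (1 / l ^ 12) (p e) (eval_word g xs *v (a0 *v p (fst (last xs)))) c'"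
      "l ^ 19 \<le> cmod c'" using e3 by (meson order_trans)
    \<comment> \<open>If the value were +-1, the word closed up cyclically would preserve the norm
      of the starting vector, which is at most \<open>l\<close>. But the image is nearly
      \<open>c'\<close> times a vector of norm at least \<open>2 / l ^ 11\<close>, and the relative
      error \<open>1 / l ^ 12\<close> takes away at most half of this. So
      \<open>cmod c' <= l ^ 12\<close>, against \<open>l ^ 19\<close>.\<close>
    have "a0 ** eval_word g xs \<notin> pm1"
    proof
      assume "a0 ** eval_word g xs \<in> pm1"
      then have "eval_word g xs ** a0 \<in> pm1" by (rule pm1_mult_commute[OF det_D[OF xs(3)]])
      from pm1_simps(3)[OF this, of "p (fst (last xs))"]
      have v: "vnorm (eval_word g xs *v (a0 *v p (fst (last xs)))) \<le> l"
        using pl(1) by (simp add: matrix_vector_mul_assoc)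
      let ?v = "eval_word g xs *v (a0 *v p (fst (last xs)))"
      have "cmod c' * vnorm (p e) = vnorm (?v - (?v - c' *s p e))" by (simp add: vnorm_scale)
      also have "\<dots> \<le> l + 1 / l ^ 12 * cmod c'"
        using vnorm_diff[of ?v "?v - c' *s p e"] v c'(1) unfolding near_def by linarith
      finally have 1: "cmod c' * vnorm (p e) \<le> l + 1 / l ^ 12 * cmod c'" .
      have "2 / l ^ 10 \<le> vnorm (p e) * l"
      proof -
        have "2 / l ^ 10 \<le> cmod (wedge (p e) (r e))"
          using PP cmod_wedge_commute[of "U *v P"] by (simp add: p_def r_def wedge_linear U_def U'_def)
        also have "\<dots> \<le> vnorm (p e) * l"
          using cmod_wedge_le[of "p e" "r e"] mult_left_mono[OF pl(2)[of e] vnorm_nonneg[of "p e"]] by linarith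
        finally show ?thesis .
      qed
      then have "2 / l ^ 11 \<le> vnorm (p e)" using l0 by (simp add: field_simps eval_nat_numeral)
      then have "cmod c' * (2 / l ^ 11) \<le> cmod c' * vnorm (p e)" by (intro mult_left_mono) auto
      moreover have "1 / l ^ 12 * cmod c' \<le> 1 / l ^ 11 * cmod c'"
        using l l0 by (intro mult_right_mono divide_left_mono power_increasing) auto
      ultimately have "cmod c' * (2 / l ^ 11) \<le> l + 1 / l ^ 11 * cmod c'" using 1 by linarith
      then have "cmod c' \<le> l ^ 12" using l0 by (simp add: field_simps eval_nat_numeral)
      then have "l ^ 19 \<le> l ^ 12" using c'(2) by linarith
      moreover have "l ^ 12 < l ^ 19" using l by (intro power_strict_increasing) auto
      ultimately show False by linarith
    qed
    then show ?thesis using len gw by blast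
  qed
  then show ?thesis using that[OF st(1,2) C] by blast
qed

section \<open>Words over the free product\<close>

lemma word_length_le:
  "set ws \<subseteq> S \<union> (\<lambda>s. inv\<^bsub>G\<^esub> s) ` S \<Longrightarrow> word_length G S (foldr (\<otimes>\<^bsub>G\<^esub>) ws \<one>\<^bsub>G\<^esub>) \<le> length ws"
  unfolding word_length_def by (rule Least_le) blast

lemma (in group) foldr_mult_closed:
  "set ws \<subseteq> carrier G \<Longrightarrow> foldr (\<otimes>) ws \<one> \<in> carrier G"
  by (induction ws) auto

lemma (in group) foldr_mult_append:
  "set ws \<subseteq> carrier G \<Longrightarrow> set ws' \<subseteq> carrier G \<Longrightarrow>
   foldr (\<otimes>) (ws @ ws') \<one> = foldr (\<otimes>) ws \<one> \<otimes> foldr (\<otimes>) ws' \<one>"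
proof (induction ws)
  case Nil
  then show ?case using foldr_mult_closed[of ws'] by simp
next
  case (Cons w ws)
  then show ?case using foldr_mult_closed[of ws] foldr_mult_closed[of ws'] by (simp add: m_assoc)
qed

lemma (in group) word_length_attained:
  assumes S: "S \<subseteq> carrier G" and g: "g \<in> generate G S"
  obtains ws where "length ws = word_length G S g" "set ws \<subseteq> S \<union> (\<lambda>s. inv s) ` S"
    "foldr (\<otimes>) ws \<one> = g"
proof -
  have sub: "S \<union> (\<lambda>s. inv s) ` S \<subseteq> carrier G" using S by auto
  have "\<exists>ws. set ws \<subseteq> S \<union> (\<lambda>s. inv s) ` S \<and> foldr (\<otimes>) ws \<one> = g"
    using g
  proof induction
    case one
    show ?case by (intro exI[of _ "[]"]) simp
  next
    case (incl h)
    then show ?case using S by (intro exI[of _ "[h]"]) auto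
  next
    case (inv h)
    then show ?case using S by (intro exI[of _ "[inv h]"]) auto
  next
    case (eng h1 h2)
    then obtain ws1 ws2 where "set ws1 \<subseteq> S \<union> (\<lambda>s. inv s) ` S" "foldr (\<otimes>) ws1 \<one> = h1"
      "set ws2 \<subseteq> S \<union> (\<lambda>s. inv s) ` S" "foldr (\<otimes>) ws2 \<one> = h2" by blast
    then show ?case
      using foldr_mult_append[of ws1 ws2] sub by (intro exI[of _ "ws1 @ ws2"]) auto
  qed
  then have "\<exists>n ws. length ws = n \<and> set ws \<subseteq> S \<union> (\<lambda>s. inv s) ` S \<and> foldr (\<otimes>) ws \<one> = g" by blast
  from LeastI_ex[OF this] show ?thesis using that unfolding word_length_def by blast
qed

text \<open>Guarantees that \<open>word_length\<close> on the free product is the length of an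
  actual word. Nonnegative powers of \<open>x\<close> come by induction, negative ones by
  inversion.\<close>

lemma generate_mif_generators:
  assumes G: "group G" and S: "S \<subseteq> carrier G" "generate G S = carrier G"
  shows "carrier (free_product_Z G) \<subseteq> generate (free_product_Z G) (mif_generators G S)"
proof -
  let ?Z = integer_group and ?F = "free_product_Z G" and ?T = "mif_generators G S"
  interpret G: group G by fact
  interpret F: group ?F by (rule group_free_product[OF G group_integer_group])
  note homl = fp_inl_hom[OF G group_integer_group] and homr = fp_inr_hom[OF G group_integer_group]
  interpret l: group_hom G ?F "fp_inl G ?Z" by unfold_locales (rule homl)
  interpret r: group_hom ?Z ?F "fp_inr G ?Z"
    by (intro group_hom.intro group_integer_group F.is_group group_hom_axioms.intro homr)
  have T: "?T \<subseteq> carrier ?F"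
    using S(1) hom_in_carrier[OF homl] hom_in_carrier[OF homr] by (auto simp: mif_generators_def)
  interpret H: subgroup "generate ?F ?T" ?F by (rule F.generate_is_subgroup[OF T])
  have l: "fp_inl G ?Z a \<in> generate ?F ?T" if "a \<in> carrier G" for a
  proof -
    have "fp_inl G ?Z a \<in> generate ?F (fp_inl G ?Z ` S)"
      using l.generate_img[OF S(1)] S(2) that by blast
    then show ?thesis using F.mono_generate[of "fp_inl G ?Z ` S" ?T] by (auto simp: mif_generators_def)
  qed
  have x: "fp_inr G ?Z 1 \<in> generate ?F ?T" by (rule generate.incl) (simp add: mif_generators_def)
  have nat: "fp_inr G ?Z (int n) \<in> generate ?F ?T" for n
  proof (induction n)
    case 0
    then show ?case using r.hom_one H.one_closed by simp
  next
    case (Suc n)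
    have "fp_inr G ?Z (int (Suc n)) = fp_inr G ?Z 1 \<otimes>\<^bsub>?F\<^esub> fp_inr G ?Z (int n)"
      using r.hom_mult[of 1 "int n"] by simp
    then show ?case using x Suc by (simp add: H.m_closed)
  qed
  have r: "fp_inr G ?Z k \<in> generate ?F ?T" for k
  proof (cases "0 \<le> k")
    case True
    then show ?thesis using nat[of "nat k"] by simp
  next
    case False
    then have "fp_inr G ?Z k = inv\<^bsub>?F\<^esub> (fp_inr G ?Z (int (nat (- k))))"
      using r.hom_inv[of "- k"] by simp
    then show ?thesis using H.m_inv_closed[OF nat[of "nat (- k)"]] by simp
  qed
  have "fp_class G ?Z u \<in> generate ?F ?T" if "u \<in> fp_words G ?Z" for u
    using that
  proof (induction u)
    case Nil
    then show ?case using H.one_closed by (simp add: free_product_def)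
  next
    case (Cons s u)
    then have su: "[s] \<in> fp_words G ?Z" "u \<in> fp_words G ?Z" by auto
    have "fp_class G ?Z [s] \<in> generate ?F ?T"
      using Cons.hyps(1) l r by (auto simp: fp_inl_def fp_inr_def)
    then show ?case
      using free_product_mult[OF G group_integer_group su] Cons.IH H.m_closed by fastforce
  qed
  then show ?thesis by (auto simp: free_product_def)
qed

text \<open>Formed in an arbitrary group \<open>K\<close>, so that one list of syllables can be read
  both in the free product, with \<open>y\<close> the generator \<open>x\<close>, and in the group,
  with \<open>y\<close> the element substituted for it.\<close>

definition syllable_prod ::
    "('c, 'k) monoid_scheme \<Rightarrow> ('a \<Rightarrow> 'c) \<Rightarrow> 'c \<Rightarrow> (bool \<times> 'a) list \<Rightarrow> 'c" where
  "syllable_prod K h y xs =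
     foldr (\<lambda>(e, a) z. (if e then y else inv\<^bsub>K\<^esub> y) \<otimes>\<^bsub>K\<^esub> (h a \<otimes>\<^bsub>K\<^esub> z)) xs \<one>\<^bsub>K\<^esub>"

lemma syllable_prod_simps [simp]:
  "syllable_prod K h y [] = \<one>\<^bsub>K\<^esub>"
  "syllable_prod K h y ((e, a) # xs) =
     (if e then y else inv\<^bsub>K\<^esub> y) \<otimes>\<^bsub>K\<^esub> (h a \<otimes>\<^bsub>K\<^esub> syllable_prod K h y xs)"
  by (simp_all add: syllable_prod_def)

lemma syllable_prod_closed:
  assumes "group K" "h \<in> hom G K" "y \<in> carrier K" "snd ` set xs \<subseteq> carrier G"
  shows "syllable_prod K h y xs \<in> carrier K"
proof -
  interpret K: group K by fact
  show ?thesis using assms(4)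
    by (induction xs) (use assms(2,3) hom_in_carrier[OF assms(2)] in auto)
qed

lemma hom_syllable_prod:
  assumes "group F" "group K" "\<phi> \<in> hom F K" "h \<in> hom G F" "y \<in> carrier F" "snd ` set xs \<subseteq> carrier G"
  shows "\<phi> (syllable_prod F h y xs) = syllable_prod K (\<phi> \<circ> h) (\<phi> y) xs"
proof -
  interpret \<phi>: group_hom F K \<phi> using assms by (simp add: group_hom_def group_hom_axioms_def)
  show ?thesis using assms(6)
  proof (induction xs)
    case (Cons x xs)
    obtain e a where x: "x = (e, a)" by fastforce
    have "syllable_prod F h y xs \<in> carrier F" "h a \<in> carrier F"
      using Cons.prems syllable_prod_closed[OF assms(1,4,5)] hom_in_carrier[OF assms(4)] by (auto simp: x)
    then show ?case using Cons assms(5) by (auto simp: x)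
  qed simp
qed

text \<open>\<open>z\<close> stands for the identity: an identity coefficient between opposite
  powers of \<open>x\<close> would allow a cancellation. For lifted coefficients the condition
  becomes \<open>reduced_word\<close>.\<close>

fun reduced_syllables :: "'a \<Rightarrow> (bool \<times> 'a) list \<Rightarrow> bool" where
  "reduced_syllables z ((e, a) # (e', a') # xs) \<longleftrightarrow> (a = z \<longrightarrow> e = e') \<and> reduced_syllables z ((e', a') # xs)"
| "reduced_syllables z _ \<longleftrightarrow> True"

text \<open>Letters are prepended one at a time: a group letter multiplies the leading coefficient,
  a power of \<open>x\<close> cancels against the first syllable or opens a new one. So each letter
  creates at most one syllable.\<close>

lemma reduced_syllables_exist:
  assumes G: "group G" and F: "group F" and h: "h \<in> hom G F" and y: "y \<in> carrier F"
    and ws: "set ws \<subseteq> h ` carrier G \<union> {y, inv\<^bsub>F\<^esub> y}"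
  obtains a0 xs where "a0 \<in> carrier G" "length xs \<le> length ws" "snd ` set xs \<subseteq> carrier G"
    "reduced_syllables \<one>\<^bsub>G\<^esub> xs" "foldr (\<otimes>\<^bsub>F\<^esub>) ws \<one>\<^bsub>F\<^esub> = h a0 \<otimes>\<^bsub>F\<^esub> syllable_prod F h y xs"
proof -
  interpret h: group_hom G F h using assms by (simp add: group_hom_def group_hom_axioms_def)
  have "\<exists>a0 xs. a0 \<in> carrier G \<and> length xs \<le> length ws \<and> snd ` set xs \<subseteq> carrier G \<and>
    reduced_syllables \<one>\<^bsub>G\<^esub> xs \<and> foldr (\<otimes>\<^bsub>F\<^esub>) ws \<one>\<^bsub>F\<^esub> = h a0 \<otimes>\<^bsub>F\<^esub> syllable_prod F h y xs"
    using ws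
  proof (induction ws)
    case Nil
    show ?case by (intro exI[of _ "\<one>\<^bsub>G\<^esub>"] exI[of _ "[]"]) simp
  next
    case (Cons w ws)
    then obtain a0 xs where IH: "a0 \<in> carrier G" "length xs \<le> length ws" "snd ` set xs \<subseteq> carrier G"
      "reduced_syllables \<one>\<^bsub>G\<^esub> xs" "foldr (\<otimes>\<^bsub>F\<^esub>) ws \<one>\<^bsub>F\<^esub> = h a0 \<otimes>\<^bsub>F\<^esub> syllable_prod F h y xs" by auto
    have cl: "syllable_prod F h y xs \<in> carrier F" by (rule syllable_prod_closed[OF F h y IH(3)])
    have "w \<in> h ` carrier G \<or> (\<exists>e. w = (if e then y else inv\<^bsub>F\<^esub> y))"
      using Cons.prems by (auto intro: exI[of _ True] exI[of _ False])
    then consider a where "a \<in> carrier G" "w = h a" | e where "w = (if e then y else inv\<^bsub>F\<^esub> y)" by blast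
    then show ?case
    proof cases
      case 1
      then show ?thesis using IH cl
        by (intro exI[of _ "a \<otimes>\<^bsub>G\<^esub> a0"] exI[of _ xs]) (simp add: h.H.m_assoc)
    next
      case 2
      have w: "w \<in> carrier F" using 2 y by simp
      show ?thesis
      \<comment> \<open>Cancellation occurs exactly when a trivial leading coefficient is followed
        by the opposite power of \<open>x\<close>; the coefficient of the deleted syllable then
        becomes the leading one.\<close>
      proof (cases "\<exists>a1 ys. a0 = \<one>\<^bsub>G\<^esub> \<and> xs = (\<not> e, a1) # ys")
        case True
        then obtain a1 ys where t: "a0 = \<one>\<^bsub>G\<^esub>" "xs = (\<not> e, a1) # ys" by blast
        have a1: "a1 \<in> carrier G" "snd ` set ys \<subseteq> carrier G" using IH(3) t by auto
        have c: "h a1 \<otimes>\<^bsub>F\<^esub> syllable_prod F h y ys \<in> carrier F"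
          using a1 syllable_prod_closed[OF F h y a1(2)] by simp
        have "foldr (\<otimes>\<^bsub>F\<^esub>) (w # ws) \<one>\<^bsub>F\<^esub> = h a1 \<otimes>\<^bsub>F\<^esub> syllable_prod F h y ys"
          using IH(5) c y 2 t by (auto simp flip: h.H.m_assoc)
        moreover have "reduced_syllables \<one>\<^bsub>G\<^esub> ys" using IH(4) t by (cases ys) auto
        ultimately show ?thesis using a1 IH(2) t by (intro exI[of _ a1] exI[of _ ys]) simp
      next
        case False
        then have "reduced_syllables \<one>\<^bsub>G\<^esub> ((e, a0) # xs)" using IH(4) by (cases xs) auto
        moreover have "foldr (\<otimes>\<^bsub>F\<^esub>) (w # ws) \<one>\<^bsub>F\<^esub> = h \<one>\<^bsub>G\<^esub> \<otimes>\<^bsub>F\<^esub> syllable_prod F h y ((e, a0) # xs)"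
          using IH cl w 2 by simp
        ultimately show ?thesis using IH
          by (intro exI[of _ "\<one>\<^bsub>G\<^esub>"] exI[of _ "(e, a0) # xs"]) simp
      qed
    qed
  qed
  then show ?thesis using that by blast
qed

section \<open>Lifting Kleinian groups to matrices\<close>

definition proj_class :: "complex^2^2 \<Rightarrow> (complex^2^2) set" where
  "proj_class A = {mat 1, - mat 1} #>\<^bsub>SL2C\<^esub> A"

lemma proj_class_eq: "proj_class A = {A, - A}"
  by (auto simp: proj_class_def r_coset_def SL2C_def matrix_neg_mult)

lemma proj_class_eq_iff: "proj_class A = proj_class B \<longleftrightarrow> A = B \<or> A = - B"
  by (auto simp: proj_class_eq doubleton_eq_iff)

lemma proj_class_hom: "proj_class \<in> hom SL2C PSL2C"
  using normal.r_coset_hom_Mod[OF normal_SL2C_center] unfolding proj_class_def PSL2C_def .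

lemma mem_SL2C: "A \<in> carrier SL2C \<longleftrightarrow> det A = 1"
  by (simp add: SL2C_def)

lemma proj_class_mult:
  "det A = 1 \<Longrightarrow> det B = 1 \<Longrightarrow> proj_class A \<otimes>\<^bsub>PSL2C\<^esub> proj_class B = proj_class (A ** B)"
  using hom_mult[OF proj_class_hom, of A B] by (simp add: SL2C_def)

lemma proj_class_one: "\<one>\<^bsub>PSL2C\<^esub> = proj_class (mat 1)"
  using hom_one[OF proj_class_hom group_SL2C group_PSL2C] by (simp add: SL2C_def)

lemma proj_class_carrier: "carrier PSL2C = proj_class ` carrier SL2C"
  by (simp add: carrier_PSL2C proj_class_def)

lemma proj_class_in_PSL2C: "det A = 1 \<Longrightarrow> proj_class A \<in> carrier PSL2C"
  by (auto simp: proj_class_carrier mem_SL2C)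

lemma proj_class_adj2: "det A = 1 \<Longrightarrow> inv\<^bsub>PSL2C\<^esub> (proj_class A) = proj_class (adj2 A)"
proof -
  assume A: "det A = 1"
  interpret group PSL2C by (rule group_PSL2C)
  show ?thesis
    by (rule inv_equality) (simp_all add: A proj_class_mult proj_class_one adj2_mult proj_class_in_PSL2C)
qed

text \<open>The full preimage, with both signs, which makes it closed under negation.\<close>

definition matrix_lifts :: "(complex^2^2) set set \<Rightarrow> (complex^2^2) set" where
  "matrix_lifts \<Gamma> = {A. det A = 1 \<and> proj_class A \<in> \<Gamma>}"

lemma matrix_lift_exists:
  assumes "subgroup \<Gamma> PSL2C" "X \<in> \<Gamma>"
  shows "\<exists>A\<in>matrix_lifts \<Gamma>. X = proj_class A"
proof -
  have "X \<in> proj_class ` carrier SL2C"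
    using subgroup.subset[OF assms(1)] assms(2) by (auto simp: proj_class_carrier)
  then show ?thesis using assms(2) by (auto simp: matrix_lifts_def mem_SL2C)
qed

lemma norm_le_mnorm: "norm A \<le> mnorm A"
proof -
  have "norm A \<le> (\<Sum>i\<in>UNIV. norm (A $ i))" by (simp add: norm_vec_def L2_set_le_sum)
  also have "\<dots> \<le> (\<Sum>i\<in>UNIV. \<Sum>j\<in>UNIV. cmod (A $ i $ j))"
    by (intro sum_mono) (simp add: norm_vec_def L2_set_le_sum)
  finally show ?thesis by (simp add: mnorm_def sum_2)
qed

text \<open>In the quotient topology a neighbourhood isolating the identity class pulls back to a
  neighbourhood of the identity matrix in which every lift is +-1. Torsion carries over because the
  class of a power is the power of the class.\<close>

lemma discrete_SL2_matrix_lifts: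
  assumes K: "Kleinian_group \<Gamma>" and tf: "torsion_free (PSL2C\<lparr>carrier := \<Gamma>\<rparr>)"
  shows "discrete_SL2 (matrix_lifts \<Gamma>)"
proof
  have sub: "subgroup \<Gamma> PSL2C" and disc: "subtopology PSL2C_topology \<Gamma> = discrete_topology \<Gamma>"
    using K by (auto simp: Kleinian_group_def)
  interpret PSL: group PSL2C by (rule group_PSL2C)
  interpret \<Gamma>: subgroup \<Gamma> PSL2C by (rule sub)
  interpret G: group "PSL2C\<lparr>carrier := \<Gamma>\<rparr>" by (rule PSL.subgroup_imp_group[OF sub])
  note D = matrix_lifts_def
  show "A \<in> matrix_lifts \<Gamma> \<Longrightarrow> det A = 1" for A by (simp add: D)
  show "mat 1 \<in> matrix_lifts \<Gamma>" using \<Gamma>.one_closed by (simp add: D proj_class_one)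
  show "A ** B \<in> matrix_lifts \<Gamma>" if "A \<in> matrix_lifts \<Gamma>" "B \<in> matrix_lifts \<Gamma>" for A B
    using that \<Gamma>.m_closed[of "proj_class A" "proj_class B"] by (simp add: D det_mul proj_class_mult)
  show "adj2 A \<in> matrix_lifts \<Gamma>" if "A \<in> matrix_lifts \<Gamma>" for A
    using that \<Gamma>.m_inv_closed[of "proj_class A"] by (simp add: D proj_class_adj2)
  show "- A \<in> matrix_lifts \<Gamma>" if "A \<in> matrix_lifts \<Gamma>" for A
  proof -
    have "proj_class (- A) = proj_class A" by (auto simp: proj_class_eq)
    then show ?thesis using that by (simp add: D det_neg_2)
  qed
  show "A \<in> {mat 1, - mat 1}"
    if A: "A \<in> matrix_lifts \<Gamma>" and n: "0 < n" "matpow A n \<in> {mat 1, - mat 1}" for A n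
  proof -
    have "proj_class A [^]\<^bsub>PSL2C\<lparr>carrier := \<Gamma>\<rparr>\<^esub> m = proj_class (matpow A m) \<and> det (matpow A m) = 1" for m :: nat
    proof (induction m)
      case (Suc m)
      have "proj_class A [^]\<^bsub>PSL2C\<lparr>carrier := \<Gamma>\<rparr>\<^esub> Suc m =
         proj_class A \<otimes>\<^bsub>PSL2C\<^esub> proj_class A [^]\<^bsub>PSL2C\<lparr>carrier := \<Gamma>\<rparr>\<^esub> m"
        using A G.nat_pow_Suc2[of "proj_class A" m] by (simp add: D)
      then show ?case using Suc A by (simp add: D proj_class_mult det_mul)
    qed (simp add: proj_class_one)
    moreover have "proj_class (matpow A n) = proj_class (mat 1)" using n(2) by (auto simp: proj_class_eq_iff)
    ultimately have "proj_class A = proj_class (mat 1)"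
      using tf A n(1) unfolding torsion_free_def by (auto simp: D proj_class_one)
    then show ?thesis by (simp add: proj_class_eq_iff)
  qed
  show "\<exists>e>0. \<forall>A\<in>matrix_lifts \<Gamma>. mnorm (A - mat 1) < e \<longrightarrow> A = mat 1"
  proof -
    have "openin (subtopology PSL2C_topology \<Gamma>) {\<one>\<^bsub>PSL2C\<^esub>}"
      unfolding disc using \<Gamma>.one_closed by simp
    then obtain U where U: "openin PSL2C_topology U" "{\<one>\<^bsub>PSL2C\<^esub>} = U \<inter> \<Gamma>"
      by (auto simp: openin_subtopology)
    then have "openin (top_of_set (carrier SL2C)) {A \<in> carrier SL2C. proj_class A \<in> U}"
      by (simp add: openin_PSL2C_topology proj_class_def)
    moreover have "mat 1 \<in> {A \<in> carrier SL2C. proj_class A \<in> U}"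
      using U(2) by (auto simp: mem_SL2C proj_class_one)
    ultimately obtain e where e: "e > 0"
      "\<And>A. A \<in> carrier SL2C \<Longrightarrow> dist A (mat 1) < e \<Longrightarrow> proj_class A \<in> U"
      unfolding openin_euclidean_subtopology_iff by blast
    show ?thesis
    \<comment> \<open>The bound 1 rules out \<open>- mat 1\<close>, which is at distance 4.\<close>
    proof (intro exI[of _ "min e 1"] conjI ballI impI)
      show "0 < min e 1" using e(1) by simp
      fix A assume A: "A \<in> matrix_lifts \<Gamma>" and lt: "mnorm (A - mat 1) < min e 1"
      have "dist A (mat 1) < e" using norm_le_mnorm[of "A - mat 1"] lt by (simp add: dist_norm)
      then have "proj_class A \<in> U \<inter> \<Gamma>" using e(2) A by (auto simp: D mem_SL2C)
      then have "proj_class A = proj_class (mat 1)" using U(2) by (auto simp: proj_class_one)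
      then have "A = mat 1 \<or> A = - mat 1" by (simp add: proj_class_eq_iff)
      moreover have "A \<noteq> - mat 1" using lt by (auto simp: mnorm_def)
      ultimately show "A = mat 1" by blast
    qed
  qed
qed

text \<open>If all lifts commuted, the group would be abelian and thus itself an abelian subgroup of
  index 1.\<close>

lemma noncommuting_matrix_lifts:
  assumes sub: "subgroup \<Gamma> PSL2C" and "nonelementary \<Gamma>"
  shows "\<exists>A\<in>matrix_lifts \<Gamma>. \<exists>B\<in>matrix_lifts \<Gamma>. A ** B \<noteq> B ** A"
proof (rule ccontr)
  assume "\<not> ?thesis"
  then have comm: "A ** B = B ** A" if "A \<in> matrix_lifts \<Gamma>" "B \<in> matrix_lifts \<Gamma>" for A B
    using that by blast
  let ?G = "PSL2C\<lparr>carrier := \<Gamma>\<rparr>"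
  interpret PSL: group PSL2C by (rule group_PSL2C)
  interpret G: group ?G by (rule PSL.subgroup_imp_group[OF sub])
  note lift = matrix_lift_exists[OF sub]
  have "comm_group ?G"
  proof (rule G.group_comm_groupI)
    fix X Y assume "X \<in> carrier ?G" "Y \<in> carrier ?G"
    then obtain A B where "A \<in> matrix_lifts \<Gamma>" "B \<in> matrix_lifts \<Gamma>" "X = proj_class A" "Y = proj_class B"
      using lift[of X] lift[of Y] by auto
    then show "X \<otimes>\<^bsub>?G\<^esub> Y = Y \<otimes>\<^bsub>?G\<^esub> X" using comm[of A B] by (simp add: matrix_lifts_def proj_class_mult)
  qed
  moreover have "rcosets\<^bsub>?G\<^esub> \<Gamma> \<subseteq> {\<Gamma>}"
    using G.coset_join2[OF _ G.subgroup_self] by (auto simp: RCOSETS_def)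
  then have "finite (rcosets\<^bsub>?G\<^esub> \<Gamma>)" by (rule finite_subset) simp
  ultimately have "virtually_abelian ?G"
    unfolding virtually_abelian_def using G.subgroup_self by (intro exI[of _ \<Gamma>]) simp
  then show False using assms(2) by (simp add: nonelementary_def)
qed

section \<open>From single words to the growth function\<close>

lemma mif_growth_le:
  assumes "\<And>w. w \<in> carrier (free_product_Z G) \<Longrightarrow> w \<noteq> \<one>\<^bsub>free_product_Z G\<^esub> \<Longrightarrow>
      word_length (free_product_Z G) (mif_generators G S) w \<le> n \<Longrightarrow>
      \<exists>g\<in>carrier G. mif_eval G w g \<noteq> \<one>\<^bsub>G\<^esub> \<and> real (word_length G S g) \<le> B"
    and "0 \<le> B"
  shows "ereal_of_enat (mif_growth G S n) \<le> ereal B"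
proof -
  \<comment> \<open>Lengths are integers, so the real bound is rounded down to stay in
    \<open>enat\<close>.\<close>
  have "mif_growth G S n \<le> enat (nat \<lfloor>B\<rfloor>)"
    unfolding mif_growth_def
  proof (rule SUP_least)
    fix w assume "w \<in> {w \<in> carrier (free_product_Z G). w \<noteq> \<one>\<^bsub>free_product_Z G\<^esub> \<and>
        word_length (free_product_Z G) (mif_generators G S) w \<le> n}"
    then obtain g where g: "g \<in> carrier G" "mif_eval G w g \<noteq> \<one>\<^bsub>G\<^esub>" "real (word_length G S g) \<le> B"
      using assms(1) by blast
    have "mif_complexity G S w \<le> enat (word_length G S g)"
      unfolding mif_complexity_def by (rule INF_lower) (use g in simp)
    also have "\<dots> \<le> enat (nat \<lfloor>B\<rfloor>)" using le_nat_floor[OF g(3)] by simp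
    finally show "mif_complexity G S w \<le> enat (nat \<lfloor>B\<rfloor>)" .
  qed
  then have "ereal_of_enat (mif_growth G S n) \<le> ereal_of_enat (enat (nat \<lfloor>B\<rfloor>))"
    by (simp only: ereal_of_enat_le_iff)
  also have "\<dots> \<le> ereal B" using assms(2) by simp
  finally show ?thesis .
qed

theorem theorem1p2:
  fixes \<Gamma> :: "(complex^2^2) set set"
  assumes "Kleinian_group \<Gamma>"
    and "finitely_generated (PSL2C\<lparr>carrier := \<Gamma>\<rparr>)"
    and "torsion_free (PSL2C\<lparr>carrier := \<Gamma>\<rparr>)"
    and "nonelementary \<Gamma>"
  shows "sharply_MIF (PSL2C\<lparr>carrier := \<Gamma>\<rparr>)"
proof -
  define G where "G = PSL2C\<lparr>carrier := \<Gamma>\<rparr>"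
  let ?D = "matrix_lifts \<Gamma>" and ?F = "free_product_Z G"
  have sub: "subgroup \<Gamma> PSL2C" using assms(1) by (simp add: Kleinian_group_def)
  interpret PSL: group PSL2C by (rule group_PSL2C)
  interpret G: group G unfolding G_def by (rule PSL.subgroup_imp_group[OF sub])
  interpret F: group ?F by (rule group_free_product[OF G.is_group group_integer_group])
  interpret D: discrete_SL2 ?D by (rule discrete_SL2_matrix_lifts[OF assms(1,3)])
  have G_simps: "carrier G = \<Gamma>" "\<one>\<^bsub>G\<^esub> = proj_class (mat 1)" by (simp_all add: G_def proj_class_one)
  have D_iff: "A \<in> ?D \<longleftrightarrow> det A = 1 \<and> proj_class A \<in> \<Gamma>" for A by (simp add: matrix_lifts_def)
  have mult: "proj_class A \<otimes>\<^bsub>G\<^esub> proj_class B = proj_class (A ** B)" if "A \<in> ?D" "B \<in> ?D" for A B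
    using that by (simp add: G_def D_iff proj_class_mult)
  have inv: "inv\<^bsub>G\<^esub> (proj_class A) = proj_class (adj2 A)" if "A \<in> ?D" for A
    using that PSL.m_inv_consistent[OF sub, of "proj_class A"]
    by (simp add: G_def D_iff proj_class_adj2)
  \<comment> \<open>One lift per element, of arbitrary sign; the signs disappear again because
    values are compared with \<open>pm1\<close>.\<close>
  define lift where "lift X = (SOME A. A \<in> ?D \<and> proj_class A = X)" for X
  have lift: "lift X \<in> ?D" "proj_class (lift X) = X" if "X \<in> \<Gamma>" for X
  proof -
    have "\<exists>A. A \<in> ?D \<and> proj_class A = X"
      using matrix_lift_exists[OF sub that] by blast
    from someI_ex[OF this] show "lift X \<in> ?D" "proj_class (lift X) = X" by (auto simp: lift_def)
  qed
  obtain A B where AB: "A \<in> ?D" "B \<in> ?D" "A ** B \<noteq> B ** A"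
    using noncommuting_matrix_lifts[OF sub assms(4)] by blast
  obtain s t C where st: "s \<in> ?D" "t \<in> ?D" "0 < C"
    and main: "\<And>n a0 xs. 2 \<le> n \<Longrightarrow> xs \<noteq> [] \<Longrightarrow> length xs \<le> n \<Longrightarrow> a0 \<in> ?D \<Longrightarrow> snd ` set xs \<subseteq> ?D \<Longrightarrow>
      reduced_word xs \<Longrightarrow>
      \<exists>bs. real (length bs) \<le> C * ln (real n) \<and> a0 ** eval_word (word_mat s t bs) xs \<notin> pm1"
    using D.log_length_nonsolution[OF AB] by blast
  obtain S0 where S0: "finite S0" "S0 \<subseteq> carrier G" "generate G S0 = carrier G"
    using assms(2) by (auto simp: finitely_generated_def finite_generating_set_def G_def)
  \<comment> \<open>Sharpness may be tested on a single finite generating set, so the Schottky pair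
    is adjoined; each letter of its words then costs at most one.\<close>
  define S where "S = insert (proj_class s) (insert (proj_class t) S0)"
  have SG: "S \<subseteq> carrier G" using S0 st by (auto simp: S_def G_simps D_iff)
  have "carrier G \<subseteq> generate G S" using G.mono_generate[of S0 S] S0(3) by (auto simp: S_def)
  then have genS: "generate G S = carrier G" using G.generate_incl[OF SG] by blast
  have fgs: "finite_generating_set G S"
    using S0 SG genS by (simp add: finite_generating_set_def S_def)
  have word: "proj_class (word_mat s t bs) = foldr (\<otimes>\<^bsub>G\<^esub>) (map (\<lambda>b. proj_class (if b then t else s)) bs) \<one>\<^bsub>G\<^esub>" for bs
  proof (induction bs)
    case (Cons b bs)
    have "(if b then t else s) \<in> ?D" using st by simp
    then show ?case using mult[of "if b then t else s" "word_mat s t bs"] Cons D.word_mat_D[OF st(1,2), of bs]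
      by simp
  qed (simp add: G_simps)
  have len: "word_length G S (proj_class (word_mat s t bs)) \<le> length bs" for bs
  proof -
    have "set (map (\<lambda>b. proj_class (if b then t else s)) bs) \<subseteq> S"
      by (simp add: S_def image_subset_iff)
    then show ?thesis
      unfolding word by (intro order_trans[OF word_length_le]) (use le_supI1 in auto)
  qed
  have ev: "eval_word g (map (apsnd lift) xs) \<in> ?D \<and>
      proj_class (eval_word g (map (apsnd lift) xs)) = syllable_prod G (\<lambda>a. a) (proj_class g) xs"
    if g: "g \<in> ?D" and xs: "snd ` set xs \<subseteq> \<Gamma>" for g xs
    using xs
  proof (induction xs)
    case Nil
    then show ?case by (simp add: G_simps D.one_D)
  next
    case (Cons x xs)
    obtain e a where x: "x = (e, a)" by fastforce
    have a: "a \<in> \<Gamma>" using Cons.prems by (simp add: x)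
    have h: "(if e then g else adj2 g) \<in> ?D" using g D.adj2_D by simp
    have IH: "eval_word g (map (apsnd lift) xs) \<in> ?D"
      "proj_class (eval_word g (map (apsnd lift) xs)) = syllable_prod G (\<lambda>a. a) (proj_class g) xs"
      using Cons by auto
    have "syllable_prod G (\<lambda>a. a) (proj_class g) (x # xs) = proj_class (if e then g else adj2 g) \<otimes>\<^bsub>G\<^esub>
        (proj_class (lift a) \<otimes>\<^bsub>G\<^esub> proj_class (eval_word g (map (apsnd lift) xs)))"
      by (simp add: x IH(2) lift(2)[OF a] inv[OF g])
    also have "\<dots> = proj_class ((if e then g else adj2 g) ** (lift a ** eval_word g (map (apsnd lift) xs)))"
      by (simp only: mult[OF lift(1)[OF a] IH(1)] mult[OF h D.mult_D[OF lift(1)[OF a] IH(1)]])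
    finally show ?case using D.mult_D[OF h D.mult_D[OF lift(1)[OF a] IH(1)]]
      by (simp add: x matrix_mul_assoc)
  qed
  \<comment> \<open>A lift is +-1 only for the identity, so reducedness passes to the
    matrices.\<close>
  have red: "reduced_word (map (apsnd lift) xs)"
    if "reduced_syllables \<one>\<^bsub>G\<^esub> xs" "snd ` set xs \<subseteq> \<Gamma>" for xs
    using that
  proof (induction "\<one>\<^bsub>G\<^esub>" xs rule: reduced_syllables.induct)
    case (1 e a e' a' xs)
    have "a = \<one>\<^bsub>G\<^esub>" if "lift a \<in> pm1"
    proof -
      have "proj_class (lift a) = proj_class (mat 1)"
        unfolding proj_class_eq_iff using that by (simp add: pm1_def)
      then show ?thesis using lift(2)[of a] "1.prems"(2) by (simp add: G_simps)
    qed
    then show ?case using 1 by auto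
  qed auto
  have "ereal_of_enat (mif_growth G S n) \<le> ereal (C * ln (real n))" if n: "2 \<le> n" for n
  proof (rule mif_growth_le)
    show "0 \<le> C * ln (real n)" using st(3) n by simp
    fix w assume w: "w \<in> carrier ?F" "w \<noteq> \<one>\<^bsub>?F\<^esub>" "word_length ?F (mif_generators G S) w \<le> n"
    let ?x = "fp_inr G integer_group 1" and ?l = "fp_inl G integer_group"
    have homl: "?l \<in> hom G ?F" by (rule fp_inl_hom[OF G.is_group group_integer_group])
    have x: "?x \<in> carrier ?F"
      using hom_in_carrier[OF fp_inr_hom[OF G.is_group group_integer_group], of 1] by simp
    have gens: "mif_generators G S \<subseteq> carrier ?F"
      using SG x hom_in_carrier[OF homl] by (auto simp: mif_generators_def)
    have "w \<in> generate ?F (mif_generators G S)"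
      using generate_mif_generators[OF G.is_group SG genS] w(1) by blast
    then obtain ws where ws: "length ws = word_length ?F (mif_generators G S) w"
      "set ws \<subseteq> mif_generators G S \<union> (\<lambda>s. inv\<^bsub>?F\<^esub> s) ` mif_generators G S"
      "foldr (\<otimes>\<^bsub>?F\<^esub>) ws \<one>\<^bsub>?F\<^esub> = w"
      by (rule F.word_length_attained[OF gens])
    interpret l: group_hom G ?F ?l by unfold_locales (rule homl)
    have "set ws \<subseteq> ?l ` carrier G \<union> {?x, inv\<^bsub>?F\<^esub> ?x}"
    proof
      fix z assume "z \<in> set ws"
      then consider a where "a \<in> S" "z = ?l a" | "z = ?x" | a where "a \<in> S" "z = inv\<^bsub>?F\<^esub> (?l a)" | "z = inv\<^bsub>?F\<^esub> ?x"
        using ws(2) by (auto simp: mif_generators_def)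
      then show "z \<in> ?l ` carrier G \<union> {?x, inv\<^bsub>?F\<^esub> ?x}"
      proof cases
        case 3
        then have "a \<in> carrier G" "z = ?l (inv\<^bsub>G\<^esub> a)" using SG by auto
        then show ?thesis by blast
      qed (use SG in auto)
    qed
    then obtain a0 xs where nf: "a0 \<in> carrier G" "length xs \<le> length ws" "snd ` set xs \<subseteq> carrier G"
      "reduced_syllables \<one>\<^bsub>G\<^esub> xs" "w = ?l a0 \<otimes>\<^bsub>?F\<^esub> syllable_prod ?F ?l ?x xs"
      using reduced_syllables_exist[OF G.is_group F.is_group homl x] ws(3) by metis
    have eval: "mif_eval G w g = a0 \<otimes>\<^bsub>G\<^esub> syllable_prod G (\<lambda>a. a) g xs" if g: "g \<in> carrier G" for g
    proof -
      note e = mif_eval_hom[OF G.is_group g]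
      have "mif_eval G w g = mif_eval G (?l a0) g \<otimes>\<^bsub>G\<^esub> mif_eval G (syllable_prod ?F ?l ?x xs) g"
        unfolding nf(5) using hom_mult[OF e(1)] nf(1) syllable_prod_closed[OF F.is_group homl x nf(3)] by simp
      also have "mif_eval G (syllable_prod ?F ?l ?x xs) g =
          syllable_prod G ((\<lambda>w. mif_eval G w g) \<circ> ?l) (mif_eval G ?x g) xs"
        using hom_syllable_prod[OF F.is_group G.is_group e(1) homl x nf(3)] .
      also have "\<dots> = syllable_prod G (\<lambda>a. a) g xs"
        using nf(3) by (induction xs) (auto simp: e(2,3))
      finally show ?thesis using e(2) nf(1) by simp
    qed
    show "\<exists>g\<in>carrier G. mif_eval G w g \<noteq> \<one>\<^bsub>G\<^esub> \<and> real (word_length G S g) \<le> C * ln (real n)"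
    proof (cases "xs = []")
      \<comment> \<open>Without syllables \<open>w\<close> is a nontrivial constant, and the
        identity, of length 0, already witnesses it.\<close>
      case True
      have "a0 \<noteq> \<one>\<^bsub>G\<^esub>" using w(2) nf(5) True by auto
      then have "mif_eval G w \<one>\<^bsub>G\<^esub> \<noteq> \<one>\<^bsub>G\<^esub>" using eval[of "\<one>\<^bsub>G\<^esub>"] nf(1) True by simp
      moreover have "word_length G S \<one>\<^bsub>G\<^esub> \<le> 0" using word_length_le[of "[]" S G] by simp
      then have "real (word_length G S \<one>\<^bsub>G\<^esub>) \<le> C * ln (real n)" using st(3) n by simp
      ultimately show ?thesis by blast
    next
      case False
      let ?xs = "map (apsnd lift) xs"
      have xs\<Gamma>: "snd ` set xs \<subseteq> \<Gamma>" "a0 \<in> \<Gamma>" using nf by (simp_all add: G_simps)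
      have "snd ` set ?xs \<subseteq> ?D" using xs\<Gamma> lift(1) by auto
      moreover have "length ?xs \<le> n" using nf(2) ws(1) w(3) by simp
      ultimately obtain bs where bs: "real (length bs) \<le> C * ln (real n)"
        "lift a0 ** eval_word (word_mat s t bs) ?xs \<notin> pm1"
        using main[OF n, of ?xs "lift a0"] False lift(1)[OF xs\<Gamma>(2)] red[OF nf(4) xs\<Gamma>(1)] by auto
      define g where "g = proj_class (word_mat s t bs)"
      have gD: "word_mat s t bs \<in> ?D" by (rule D.word_mat_D[OF st(1,2)])
      then have g: "g \<in> carrier G" by (simp add: g_def G_simps D_iff)
      have "mif_eval G w g = proj_class (lift a0 ** eval_word (word_mat s t bs) ?xs)"
        using eval[OF g] ev[OF gD xs\<Gamma>(1)] lift(2)[OF xs\<Gamma>(2)]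
          mult[OF lift(1)[OF xs\<Gamma>(2)] ev[OF gD xs\<Gamma>(1), THEN conjunct1]] by (simp add: g_def)
      then have "mif_eval G w g \<noteq> \<one>\<^bsub>G\<^esub>" using bs(2) by (simp add: G_simps proj_class_eq_iff pm1_def)
      moreover have "real (word_length G S g) \<le> C * ln (real n)"
        using len[of bs] bs(1) by (simp add: g_def)
      ultimately show ?thesis using g by blast
    qed
  qed
  then show ?thesis unfolding sharply_MIF_def G_def[symmetric] using fgs st(3) by blast
qed

end
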